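(* Let $\varphi = P_m$ be a Chebyshev polynomial ($m \geq 2$), let $K$ be a number field, and let $(x_n)_{n=1}^\infty$ be a nonrepeating sequence of $\varphi$-preperiodic points in $\overline{K}$. Then for any $\alpha \in K$ that is not $\varphi$-preperiodic and any place $v$ of $K$, $$\hat{h}_v(\alpha) = \lim_{n \to \infty} \frac{1}{[K(x_n):K]} \sum_{\sigma : K(x_n)/K \hookrightarrow \overline{K}_v} \log |\sigma(x_n) - \alpha|_v,$$ where the sum runs over all embeddings $\sigma$ of $K(x_n)$ into $\overline{K}_v$ fixing $K$.
   Context: The polynomials $P_m$ are defined by $P_1(z) = z$, $P_2(z) = z^2 - 2$, and $P_{m+1}(z) = z P_m(z) - P_{m-1}(z)$ for $m \geq 2$; a Chebyshev polynomial is any $P_m$ with $m \geq 2$. A point $x$ is $\varphi$-preperiodic if $\varphi^j(x) = \varphi^k(x)$ for some integers $j \neq k \geq 0$. For a place $v$ of $K$, $|\cdot|_v$ is an absolute value in the class of $v$ extended to an algebraic closure $\overline{K}_v$ of $K_v$, and the local canonical height of $\beta \in \overline{K}_v$ is $\hat{h}_v(\beta) = \lim_{k \to \infty} m^{-k} \log \max(|\varphi^k(\beta)|_v, 1)$, where $\varphi^k$ is the $k$-th iterate of $\varphi$ and $m = \deg \varphi$. *)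

theory Defs
  imports Complex_Main "HOL-Library.FuncSet" "HOL-Algebra.Algebraic_Closure_Type"
begin

text \<open>
  The number field \<open>K\<close> is the type \<open>'k\<close>, its completion \<open>K\<^sub>v\<close> is a type \<open>'c\<close> with an embedding
  \<open>\<iota> :: 'k \<Rightarrow> 'c\<close>, and their algebraic closures are \<open>'k alg_closure\<close> and \<open>'c alg_closure\<close>. The
  inclusion of \<open>K\<close> into the algebraic closure of \<open>K\<^sub>v\<close> is therefore \<open>\<lambda>c. to_ac (\<iota> c)\<close>.
\<close>

subsection \<open>Chebyshev polynomials and preperiodic points\<close>

text \<open>The value \<open>2\<close> at index \<open>0\<close> is the one that extends the recurrence; it is never used.\<close>

fun cheb :: "nat \<Rightarrow> 'a::comm_ring_1 poly" where
  "cheb 0 = [:2:]"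
| "cheb (Suc 0) = [:0, 1:]"
| "cheb (Suc (Suc 0)) = [:-2, 0, 1:]"
| "cheb (Suc (Suc (Suc m))) = [:0, 1:] * cheb (Suc (Suc m)) - cheb (Suc m)"

definition preperiodic :: "'a::comm_ring_1 poly \<Rightarrow> 'a \<Rightarrow> bool" where
  "preperiodic \<phi> x \<longleftrightarrow> (\<exists>j k. j \<noteq> k \<and> (poly \<phi> ^^ j) x = (poly \<phi> ^^ k) x)"

subsection \<open>Number fields and simple extensions\<close>

definition number_field :: "'k::field_char_0 itself \<Rightarrow> bool" where
  "number_field _ \<longleftrightarrow>
     (\<exists>B. finite_dimensional_vector_space (\<lambda>(q::rat) (x::'k). of_rat q * x) B)"

definition is_subfield :: "'a::field set \<Rightarrow> bool" where
  "is_subfield F \<longleftrightarrow> 1 \<in> F \<and> (\<forall>x\<in>F. \<forall>y\<in>F. x - y \<in> F \<and> x * y \<in> F) \<and> (\<forall>x\<in>F. inverse x \<in> F)"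

definition adjoin :: "'k::field alg_closure \<Rightarrow> 'k alg_closure set" where
  "adjoin x = \<Inter>{F. is_subfield F \<and> range to_ac \<subseteq> F \<and> x \<in> F}"

definition ext_degree :: "'k::field alg_closure set \<Rightarrow> nat" where
  "ext_degree F = vector_space.dim (\<lambda>c y. to_ac c * y) F"

text \<open>
  The embeddings of \<open>F\<close> over \<open>K\<close> are partial maps, so they are made extensional outside \<open>F\<close>
  for each of them to be counted once.
\<close>

definition embeddings_over ::
    "('k::field \<Rightarrow> 'b::field) \<Rightarrow> 'k alg_closure set \<Rightarrow> ('k alg_closure \<Rightarrow> 'b) set" where
  "embeddings_over j F = {\<sigma> \<in> extensional F.
     (\<forall>x\<in>F. \<forall>y\<in>F. \<sigma> (x + y) = \<sigma> x + \<sigma> y \<and> \<sigma> (x * y) = \<sigma> x * \<sigma> y) \<and>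
     (\<forall>c. \<sigma> (to_ac c) = j c)}"

subsection \<open>Places and completions\<close>

definition abs_value :: "('a::field \<Rightarrow> real) \<Rightarrow> bool" where
  "abs_value a \<longleftrightarrow> (\<forall>x. 0 \<le> a x) \<and> (\<forall>x. a x = 0 \<longleftrightarrow> x = 0) \<and>
     (\<forall>x y. a (x * y) = a x * a y) \<and> (\<forall>x y. a (x + y) \<le> a x + a y)"

definition nontrivial_abs_values :: "('a::field \<Rightarrow> real) set" where
  "nontrivial_abs_values = {a. abs_value a \<and> (\<exists>x. x \<noteq> 0 \<and> a x \<noteq> 1)}"

definition abs_equiv :: "(('a::field \<Rightarrow> real) \<times> ('a \<Rightarrow> real)) set" where
  "abs_equiv = {(a, b). a \<in> nontrivial_abs_values \<and> b \<in> nontrivial_abs_values \<and>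
     (\<exists>s>0. \<forall>x. b x = a x powr s)}"

definition places :: "('a::field \<Rightarrow> real) set set" where
  "places = nontrivial_abs_values // abs_equiv"

definition is_completion ::
    "('k::field \<Rightarrow> real) set \<Rightarrow> ('k \<Rightarrow> 'c::field) \<Rightarrow> ('c \<Rightarrow> real) \<Rightarrow> bool" where
  "is_completion v \<iota> a \<longleftrightarrow>
     \<iota> 1 = 1 \<and> (\<forall>x y. \<iota> (x + y) = \<iota> x + \<iota> y \<and> \<iota> (x * y) = \<iota> x * \<iota> y) \<and>
     abs_value a \<and> (\<lambda>x. a (\<iota> x)) \<in> v \<and>
     (\<forall>y. \<forall>e>0. \<exists>x. a (y - \<iota> x) < e) \<and>
     (\<forall>u::nat \<Rightarrow> 'c. (\<forall>e>0. \<exists>N. \<forall>i\<ge>N. \<forall>j\<ge>N. a (u i - u j) < e) \<longrightarrow>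
        (\<exists>l. (\<lambda>i. a (u i - l)) \<longlonglongrightarrow> 0))"

definition local_height :: "('b::field \<Rightarrow> real) \<Rightarrow> 'b poly \<Rightarrow> 'b \<Rightarrow> real" where
  "local_height w \<phi> \<beta> =
     lim (\<lambda>k. ln (max (w ((poly \<phi> ^^ k) \<beta>)) 1) / real (degree \<phi>) ^ k)"

end

theory Submission
  imports Defs "Subresultants.Resultant_Prelim" "HOL-Complex_Analysis.Complex_Analysis"
    "HOL-Number_Theory.Number_Theory" "HOL-Real_Asymp.Real_Asymp"
begin

text \<open>
  Since \<open>P\<^sub>m (z + 1/z) = z\<^sup>m + 1/z\<^sup>m\<close>, the preperiodic points are the \<open>u + 1/u\<close> with \<open>u\<close> a root of unity.
  Write \<open>\<alpha> = b + 1/b\<close>; then the local height of \<open>\<alpha>\<close> is \<open>\<bar>log |b|\<bar>\<close> and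
  \<open>u + 1/u - \<alpha> = (u - b) (u - 1/b) / u\<close>, so the claim is about averages of \<open>log |u - b|\<close> over the
  conjugates of \<open>u\<close>.

  At a non-archimedean place only finitely many roots of unity lie in a closed disc of radius less than
  \<open>1\<close>, because \<open>\<Prod>\<^sub>j (1 - \<zeta>\<^sup>j) = n\<close> for \<open>\<zeta>\<close> of order \<open>n\<close>, whereas \<open>|n|\<close> decays only like a power of \<open>n\<close>. Hence
  the summands themselves converge.

  At an archimedean place everything happens in the complex numbers. The conjugates of \<open>u\<close> of order \<open>N\<close>
  form a coset of a subgroup of \<open>(\<int>/N)\<^sup>\<times>\<close> of bounded index (Landau's proof of the irreducibility of
  cyclotomic polynomials), and Parseval's identity bounds the power sums over such a coset by
  \<open>\<surd>(kN)\<close>. This settles \<open>|b| \<noteq> 1\<close>. If \<open>|b| = 1\<close>, the sum is compared with that for \<open>(1 - N\<^sup>-\<^sup>1\<^sup>/\<^sup>4) b\<close>; the few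
  conjugates close to \<open>b\<close> are controlled by the Gelfond-type inequality
  \<open>|u - b| \<ge> exp (- C (log N)\<^sup>4)\<close>, proved with Laurent's interpolation determinants: a determinant of
  values \<open>n\<^sup>i b\<^sup>j\<^sup>s\<close> at \<open>n = ks + Nt\<close> is nonzero by a zero estimate, bounded below by Liouville's inequality,
  and would be too small by Cauchy's formula if \<open>b\<close> were very close to \<open>u = exp (2 \<pi> i k/N)\<close>.
\<close>

hide_const (open) Polynomials.degree Polynomials.lead_coeff Coset.order UnivPoly.coeff UnivPoly.monom
  UnivPoly.deg Module.smult Divisibility.prime Divisibility.irreducible Determinants.det
  Finite_Cartesian_Product.mat Finite_Cartesian_Product.vec Finite_Cartesian_Product.row
  Finite_Cartesian_Product.transpose Henstock_Kurzweil_Integration.content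

no_notation Finite_Cartesian_Product.vec_nth (infixl "$" 90)
no_notation Group.m_inv (\<open>(\<open>open_block notation=\<open>prefix inv\<close>\<close>inv\<index> _)\<close> [81] 80)
no_notation fps_nth (infixl "$" 75)

subsection \<open>Determinants and Liouville's inequality\<close>

text \<open>When \<open>|b| = 1\<close> equidistribution alone does not suffice:
  \<open>log |u - b|\<close> is unbounded, and a single conjugate could dominate the average. A
  lower bound \<open>exp (- C N)\<close> for \<open>|u - b|\<close> would be too weak, since the
  number of conjugates is only bounded below by a multiple of \<open>N / log N\<close>; this is why
  a power of \<open>log N\<close> is wanted in the exponent. The radius \<open>1 - d\<close> with
  \<open>d = N^(-1/4)\<close> balances the error \<open>sqrt N / d\<close> at the shifted point
  against the number of conjugates within a multiple of \<open>d\<close> of \<open>b\<close>, which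
  is of order at most \<open>d N\<close>; both become \<open>N^(3/4)\<close>.

  That \<alpha> is not preperiodic says that \<open>b\<close> is not a root of unity. That the
  sequence does not repeat makes the orders \<open>N\<close> tend to infinity, since each
  \<open>N\<close> admits only finitely many values \<open>u + 1/u\<close>. The field enters through
  its degree over the rationals, which bounds the index of the coset. At an archimedean place all
  numbers involved are algebraic, so they lie in the image of an embedding of the complex numbers
  into the closure of the completion, and the problem can be pulled back along it.\<close>

lemma norm_det_le_prod_row_sums:
  fixes A :: "'a :: real_normed_field mat"
  assumes A: "A \<in> carrier_mat n n"
  shows "norm (det A) \<le> (\<Prod>i<n. \<Sum>j<n. norm (A $$ (i,j)))"
proof -
  have "norm (det A) \<le> (\<Sum>p | p permutes {0..<n}. norm (signof p * (\<Prod>i = 0..<n. A $$ (i, p i))))"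
    unfolding det_def'[OF A] by (rule norm_sum)
  also have "\<dots> = (\<Sum>p | p permutes {0..<n}. \<Prod>i<n. norm (A $$ (i, p i)))"
    by (intro sum.cong refl) (auto simp: norm_mult prod_norm sign_def atLeast0LessThan)
  \<comment> \<open>Multiplying out the product of the row sums gives a sum over all choice
    functions on the indices. Restricted permutations are some of these, and restriction loses
    nothing because a permutation is the identity elsewhere.\<close>
  also have "\<dots> = (\<Sum>g\<in>(\<lambda>p. restrict p {..<n}) ` {p. p permutes {0..<n}}. \<Prod>i<n. norm (A $$ (i, g i)))"
  proof (subst sum.reindex)
    show "inj_on (\<lambda>p. restrict p {..<n}) {p. p permutes {0..<n}}"
    proof (rule inj_onI, rule ext)
      fix p q x assume pq: "p \<in> {p. p permutes {0..<n}}" "q \<in> {p. p permutes {0..<n}}"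
        and eq: "restrict p {..<n} = restrict q {..<n}"
      show "p x = q x"
      proof (cases "x < n")
        case True
        then show ?thesis using fun_cong[OF eq, of x] by simp
      next
        case False
        then show ?thesis using pq by (simp add: permutes_def)
      qed
    qed
  qed (auto intro!: sum.cong prod.cong)
  also have "\<dots> \<le> (\<Sum>g\<in>PiE {..<n} (\<lambda>_. {..<n}). \<Prod>i<n. norm (A $$ (i, g i)))"
  proof (rule sum_mono2)
    show "(\<lambda>p. restrict p {..<n}) ` {p. p permutes {0..<n}} \<subseteq> {..<n} \<rightarrow>\<^sub>E {..<n}"
    proof (rule image_subsetI, rule PiE_I)
      fix p i assume "p \<in> {p. p permutes {0..<n}}" "i \<in> {..<n}"
      thus "restrict p {..<n} i \<in> {..<n}" using permutes_in_image[of p "{0..<n}" i] by simp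
    qed simp
  qed (auto intro!: finite_PiE prod_nonneg)
  also have "\<dots> = (\<Prod>i<n. \<Sum>j<n. norm (A $$ (i,j)))"
    by (subst prod_sum_PiE) auto
  finally show ?thesis .
qed

text \<open>The length is used rather than the largest coefficient because it is submultiplicative,
  so that it passes through products and determinants without factors depending on degrees.\<close>

definition poly_length :: "int poly \<Rightarrow> int" where
  "poly_length p = (\<Sum>i\<le>degree p. \<bar>coeff p i\<bar>)"

lemma poly_length_ge_sum: "finite I \<Longrightarrow> (\<Sum>i\<in>I. \<bar>coeff p i\<bar>) \<le> poly_length p"
proof -
  assume I: "finite I"
  have "(\<Sum>i\<in>I. \<bar>coeff p i\<bar>) = (\<Sum>i\<in>I \<inter> {..degree p}. \<bar>coeff p i\<bar>)"
    by (rule sum.mono_neutral_right) (use I in \<open>auto intro: le_degree\<close>)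
  also have "\<dots> \<le> poly_length p"
    unfolding poly_length_def by (rule sum_mono2) auto
  finally show ?thesis .
qed

lemma poly_length_ge_1:
  assumes "p \<noteq> 0"
  shows "1 \<le> poly_length p"
proof -
  have "lead_coeff p \<noteq> 0" using assms by simp
  hence "1 \<le> \<bar>lead_coeff p\<bar>" by linarith
  also have "\<dots> \<le> poly_length p" using poly_length_ge_sum[of "{degree p}" p] by simp
  finally show ?thesis .
qed

lemma poly_length_eq_sum: "degree p < n \<Longrightarrow> poly_length p = (\<Sum>i<n. \<bar>coeff p i\<bar>)"
  unfolding poly_length_def
  by (rule sum.mono_neutral_left) (auto intro: le_degree)

lemma poly_length_nonneg [simp]: "poly_length p \<ge> 0"
  by (simp add: poly_length_def sum_nonneg)

lemma poly_length_0 [simp]: "poly_length 0 = 0"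
  by (simp add: poly_length_def)

lemma poly_length_monom [simp]: "poly_length (monom a n) = \<bar>a\<bar>"
  by (subst poly_length_eq_sum[of _ "Suc n"])
     (auto intro: le_less_trans[OF degree_monom_le])

lemma poly_length_pCons [simp]: "poly_length (pCons a p) = \<bar>a\<bar> + poly_length p"
proof -
  have "poly_length (pCons a p) = (\<Sum>i<Suc (Suc (degree p)). \<bar>coeff (pCons a p) i\<bar>)"
    by (rule poly_length_eq_sum) (auto intro: le_less_trans[OF degree_pCons_le])
  also have "\<dots> = \<bar>a\<bar> + (\<Sum>i<Suc (degree p). \<bar>coeff p i\<bar>)"
    by (subst sum.lessThan_Suc_shift) auto
  finally show ?thesis by (simp add: poly_length_eq_sum[of p "Suc (degree p)"])
qed

lemma poly_length_add: "poly_length (p + q) \<le> poly_length p + poly_length q"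
proof -
  have "poly_length (p + q) \<le> (\<Sum>i\<le>degree (p+q). \<bar>coeff p i\<bar> + \<bar>coeff q i\<bar>)"
    unfolding poly_length_def by (intro sum_mono) auto
  also have "\<dots> \<le> poly_length p + poly_length q"
    unfolding sum.distrib by (intro add_mono poly_length_ge_sum) auto
  finally show ?thesis .
qed

lemma poly_length_smult: "poly_length (smult c p) = \<bar>c\<bar> * poly_length p"
  by (induction p) (auto simp: abs_mult algebra_simps)

lemma poly_length_mult: "poly_length (p * q) \<le> poly_length p * poly_length q"
proof (induction p)
  case (pCons a p)
  have "poly_length (pCons a p * q) \<le> poly_length (smult a q) + poly_length (pCons 0 (p * q))"
    by (simp only: mult_pCons_left poly_length_add)
  then show ?case using pCons by (simp add: poly_length_smult algebra_simps)
qed auto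

lemma poly_length_sum: "poly_length (sum f A) \<le> (\<Sum>x\<in>A. poly_length (f x))"
  by (induction A rule: infinite_finite_induct) (auto intro: order_trans[OF poly_length_add])

lemma poly_length_prod: "poly_length (prod f A) \<le> (\<Prod>x\<in>A. poly_length (f x))"
  by (induction A rule: infinite_finite_induct)
     (auto simp: one_pCons intro!: order_trans[OF poly_length_mult] mult_left_mono)

lemma poly_length_det:
  assumes A: "A \<in> carrier_mat n n" and M: "M \<ge> 0"
    and b: "\<And>i j. i < n \<Longrightarrow> j < n \<Longrightarrow> poly_length (A $$ (i,j)) \<le> M"
  shows "poly_length (det A) \<le> int (fact n) * M ^ n"
proof -
  have "poly_length (det A) \<le> (\<Sum>p | p permutes {0..<n}. poly_length (signof p * (\<Prod>i = 0..<n. A $$ (i, p i))))"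
    unfolding det_def'[OF A] by (rule poly_length_sum)
  also have "\<dots> \<le> (\<Sum>p | p permutes {0..<n}. M ^ n)"
  proof (rule sum_mono)
    fix p assume p: "p \<in> {p. p permutes {0..<n}}"
    have "poly_length (signof p * (\<Prod>i = 0..<n. A $$ (i, p i))) \<le>
          poly_length (signof p) * poly_length (\<Prod>i = 0..<n. A $$ (i, p i))"
      by (rule poly_length_mult)
    also have "poly_length (signof p) = 1"
      by (auto simp: sign_def one_pCons poly_length_def)
    also have "poly_length (\<Prod>i = 0..<n. A $$ (i, p i)) \<le> (\<Prod>i = 0..<n. M)"
      by (rule order_trans[OF poly_length_prod prod_mono]) (use p b in \<open>auto dest: permutes_in_image\<close>)
    finally show "poly_length (signof p * (\<Prod>i = 0..<n. A $$ (i, p i))) \<le> M ^ n" by simp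
  qed
  also have "\<dots> = int (fact n) * M ^ n"
    by (simp add: card_permutations)
  finally show ?thesis .
qed

abbreviation cpoly :: "int poly \<Rightarrow> complex poly" where "cpoly \<equiv> map_poly of_int"

text \<open>Only the degree is minimal; content and leading coefficient are left free, so that
  existence is a matter of well-ordering. The primitive, monic form is obtained separately for roots
  of unity.\<close>

definition int_minimal :: "int poly \<Rightarrow> complex \<Rightarrow> bool" where
  "int_minimal f b \<longleftrightarrow> f \<noteq> 0 \<and> poly (cpoly f) b = 0 \<and>
     (\<forall>h. poly (cpoly h) b = 0 \<longrightarrow> degree h < degree f \<longrightarrow> h = 0)"

lemma poly_as_sum:
  fixes p :: "'a :: comm_semiring_1 poly"
  shows "degree p < n \<Longrightarrow> poly p x = (\<Sum>i<n. coeff p i * x ^ i)"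
  unfolding poly_altdef by (intro sum.mono_neutral_left) (auto simp: coeff_eq_0)

text \<open>
  The determinant of the Sylvester-type matrix of \<open>f\<close> and \<open>G\<close> is a nonzero integer; by Cramer's rule it is
  \<open>G (b)\<close> times a determinant with bounded entries.
\<close>

lemma liouville_inequality:
  fixes b :: complex and f G :: "int poly"
  assumes f: "int_minimal f b" and b: "norm b \<le> 1" and G: "poly (cpoly G) b \<noteq> 0"
  shows "1 \<le> norm (poly (cpoly G) b) * real_of_int (poly_length f) ^ degree G
              * (1 + real_of_int (poly_length G)) ^ degree f"
proof -
  define n D where "n = degree G" and "D = degree f"
  define row where "row = (\<lambda>i. if i < n then monom 1 i * f else monom 1 (i - n) * G)"
  define S where "S = mat (n + D) (n + D) (\<lambda>(i, j). coeff (row i) j)"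
  have S: "S \<in> carrier_mat (n + D) (n + D)" by (simp add: S_def)
  have degrow: "degree (row i) < n + D" if "i < n + D" for i
    using that le_less_trans[OF degree_mult_le[of "monom 1 i" f], of "n + D"]
      le_less_trans[OF degree_mult_le[of "monom 1 (i - n)" G], of "n + D"]
    by (auto simp: row_def n_def D_def degree_monom_eq split: if_splits)
  interpret h: inj_idom_hom "of_int :: int \<Rightarrow> complex" by unfold_locales auto
  interpret ph: map_poly_inj_idom_hom "of_int :: int \<Rightarrow> complex" ..
  \<comment> \<open>A kernel vector of the transpose consists of the coefficients of
    \<open>p\<close> and \<open>q\<close> with \<open>p f + q G = 0\<close> and \<open>q\<close> of
    smaller degree than \<open>f\<close>. At \<open>b\<close> this forces \<open>q\<close> to
    vanish, because \<open>G\<close> does not; minimality gives \<open>q = 0\<close>, and then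
    \<open>p = 0\<close>.\<close>
  have "det S \<noteq> 0"
  proof
    assume "det S = 0"
    hence "det (transpose_mat S) = 0" using Determinant.det_transpose[OF S] by simp
    then obtain v where v: "v \<in> carrier_vec (n + D)" "v \<noteq> 0\<^sub>v (n + D)" "transpose_mat S *\<^sub>v v = 0\<^sub>v (n + D)"
      using det_0_iff_vec_prod_zero[of "transpose_mat S" "n + D"] S by auto
    define p q where "p = (\<Sum>i<n. monom (v $ i) i)" and "q = (\<Sum>i<D. monom (v $ (n + i)) i)"
    have cp: "coeff p i = (if i < n then v $ i else 0)" for i
      unfolding p_def by (auto simp: coeff_sum coeff_monom if_distrib cong: if_cong)
    have cq: "coeff q i = (if i < D then v $ (n + i) else 0)" for i
      unfolding q_def by (auto simp: coeff_sum coeff_monom if_distrib cong: if_cong)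
    have "(\<Sum>i<n+D. smult (v $ i) (row i)) = 0"
    proof (rule poly_eqI)
      fix j
      show "coeff (\<Sum>i<n+D. smult (v $ i) (row i)) j = coeff 0 j"
      proof (cases "j < n + D")
        case True
        have "(transpose_mat S *\<^sub>v v) $ j = (\<Sum>i<n+D. coeff (row i) j * v $ i)"
          using True carrier_vecD[OF v(1)] by (simp add: S_def scalar_prod_def atLeast0LessThan)
        hence "coeff (\<Sum>i<n+D. smult (v $ i) (row i)) j = (transpose_mat S *\<^sub>v v) $ j"
          by (simp add: coeff_sum mult.commute)
        then show ?thesis using v True by simp
      next
        case False
        then show ?thesis
          by (auto simp: coeff_sum intro!: sum.neutral coeff_eq_0 less_le_trans[OF degrow])
      qed
    qed
    moreover have "(\<Sum>i<n+D. smult (v $ i) (row i)) =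
       (\<Sum>i<n. smult (v $ i) (row i)) + (\<Sum>i<D. smult (v $ (n+i)) (row (n+i)))"
      by (subst lessThan_atLeast0, subst sum.atLeastLessThan_concat[of 0 n "n+D", symmetric])
         (auto simp: atLeast0LessThan sum.shift_bounds_nat_ivl[of _ 0 n D, simplified add.commute] 
           sum.atLeastLessThan_shift_0[of _ n])
    moreover have "(\<Sum>i<n. smult (v $ i) (row i)) = p * f"
      unfolding p_def sum_distrib_right by (intro sum.cong) (auto simp: row_def smult_monom_mult smult_monom
        simp flip: mult_smult_left)
    moreover have "(\<Sum>i<D. smult (v $ (n+i)) (row (n+i))) = q * G"
      unfolding q_def sum_distrib_right by (intro sum.cong) (auto simp: row_def smult_monom
        simp flip: mult_smult_left)
    ultimately have eq: "p * f + q * G = 0" by simp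
    hence "poly (cpoly (p * f + q * G)) b = 0" by simp
    hence "poly (cpoly q) b = 0"
      using f G by (simp add: hom_distribs int_minimal_def)
    moreover have "q = 0 \<or> degree q < D"
    proof (cases "D = 0")
      case False
      have "degree q \<le> D - 1" by (rule degree_le) (auto simp: cq)
      with False show ?thesis by auto
    qed (simp add: q_def)
    ultimately have q0: "q = 0" using f by (auto simp: int_minimal_def D_def)
    hence p0: "p = 0" using eq f by (auto simp: int_minimal_def)
    have "v $ i = 0" if "i < n + D" for i
    proof (cases "i < n")
      case True
      then show ?thesis using cp[of i] p0 by simp
    next
      case False
      then obtain k where "i = n + k" by (metis le_add_diff_inverse not_less)
      then show ?thesis using cq[of k] q0 that by simp
    qed
    hence "v = 0\<^sub>v (n + D)" using v by (intro eq_vecI) auto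
    thus False using v by simp
  qed
  hence "\<bar>det S\<bar> \<ge> 1" by simp
  define SC where "SC = map_mat complex_of_int S"
  have SC: "SC \<in> carrier_mat (n + D) (n + D)" by (simp add: SC_def S)
  have detSC: "det SC = of_int (det S)" unfolding SC_def by simp
  have "D \<noteq> 0"
  proof
    assume "D = 0"
    then obtain c where "f = [:c:]" unfolding D_def by (auto elim: degree_eq_zeroE)
    thus False using f by (auto simp: int_minimal_def)
  qed
  \<comment> \<open>On the vector of powers of \<open>b\<close> the rows of \<open>f\<close> give 0
    and those of \<open>G\<close> give multiples of the value of \<open>G\<close> at
    \<open>b\<close>. Dividing by that value leaves a right-hand side of norm at most 1 and puts its
    inverse into entry 0, which Cramer's rule isolates.\<close>
  define x where "x = vec (n + D) (\<lambda>j. b ^ j / poly (cpoly G) b)"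
  define u where "u = SC *\<^sub>v x"
  have u: "u $ i = (if i < n then 0 else b ^ (i - n))" if "i < n + D" for i
  proof -
    have "u $ i = poly (cpoly (row i)) b / poly (cpoly G) b"
      using that degrow[OF that] S
      by (auto simp: u_def SC_def x_def S_def scalar_prod_def atLeast0LessThan sum_divide_distrib
          poly_as_sum[of "cpoly (row i)" "n + D"] intro!: sum.cong)
    thus ?thesis using f G
      by (simp add: row_def hom_distribs int_minimal_def poly_monom)
  qed
  define A where "A = replace_col SC u 0"
  have "det A = x $ 0 * det SC"
    unfolding A_def u_def by (rule cramer_lemma_mat[OF SC]) (use \<open>D \<noteq> 0\<close> in \<open>auto simp: x_def\<close>)
  hence "det SC = poly (cpoly G) b * det A"
    using G \<open>D \<noteq> 0\<close> by (simp add: x_def)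
  moreover have "norm (det SC) \<ge> 1"
    using \<open>\<bar>det S\<bar> \<ge> 1\<close> unfolding detSC norm_of_int by linarith
  ultimately have 1: "1 \<le> norm (poly (cpoly G) b) * norm (det A)" by (simp add: norm_mult)
  have AC: "A \<in> carrier_mat (n + D) (n + D)" using SC by (auto simp: A_def replace_col_def)
  have A: "A $$ (i, j) = (if j = 0 then u $ i else of_int (coeff (row i) j))" if "i < n + D" "j < n + D" for i j
    using that S by (auto simp: A_def replace_col_def SC_def S_def)
  have lenrow: "(\<Sum>j<n+D. \<bar>coeff (row i) j\<bar>) \<le> (if i < n then poly_length f else poly_length G)" for i
    by (rule order_trans[OF poly_length_ge_sum]) 
       (auto simp: row_def intro: order_trans[OF poly_length_mult])
  have "norm (det A) \<le> (\<Prod>i<n+D. \<Sum>j<n+D. norm (A $$ (i,j)))"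
    by (rule norm_det_le_prod_row_sums[OF AC])
  also have "\<dots> \<le> (\<Prod>i<n+D. if i < n then real_of_int (poly_length f) else 1 + real_of_int (poly_length G))"
  proof (intro prod_mono conjI sum_nonneg)
    fix i assume i: "i \<in> {..<n+D}"
    have "(\<Sum>j<n+D. norm (A $$ (i,j))) \<le> (\<Sum>j<n+D. (if j = 0 then norm (u $ i) else 0) + real_of_int \<bar>coeff (row i) j\<bar>)"
      by (rule sum_mono) (use i A in auto)
    also have "\<dots> = norm (u $ i) + real_of_int (\<Sum>j<n+D. \<bar>coeff (row i) j\<bar>)"
      using \<open>D \<noteq> 0\<close> by (simp add: sum.distrib)
    also have "\<dots> \<le> norm (u $ i) + real_of_int (if i < n then poly_length f else poly_length G)"
      using lenrow[of i] by linarith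
    also have "\<dots> \<le> (if i < n then real_of_int (poly_length f) else 1 + real_of_int (poly_length G))"
      using u[of i] i b by (auto simp: norm_power power_le_one)
    finally show "(\<Sum>j<n+D. norm (A $$ (i,j))) \<le> (if i < n then real_of_int (poly_length f) else 1 + real_of_int (poly_length G))" .
  qed auto
  also have "\<dots> = real_of_int (poly_length f) ^ n * (1 + real_of_int (poly_length G)) ^ D"
    by (induction D) auto
  finally show ?thesis
    using 1 mult_left_mono[of "norm (det A)" _ "norm (poly (cpoly G) b)"] 
    by (fastforce simp: n_def D_def mult.assoc)
qed

subsection \<open>Interpolation determinants\<close>

text \<open>This is the divided difference of order \<open>q\<close>, in Lagrange form: the
  coefficients that produce it from the values are explicit and form a triangular matrix.\<close>

definition ddiff :: "(nat \<Rightarrow> complex) \<Rightarrow> nat \<Rightarrow> (complex \<Rightarrow> complex) \<Rightarrow> complex" where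
  "ddiff z q f = (\<Sum>p\<le>q. f (z p) / (\<Prod>r\<in>{..q}-{p}. z p - z r))"

text \<open>Lagrange interpolation of the constant 1: the interpolating polynomial minus 1 has
  degree at most \<open>q\<close> and the \<open>q + 1\<close> nodes as roots, so it is zero.
  Dividing by the node polynomial gives the expansion.\<close>

lemma partial_fractions:
  fixes z :: "nat \<Rightarrow> complex"
  assumes inj: "inj_on z {..q}" and w: "w \<notin> z ` {..q}"
  shows "1 / (\<Prod>r\<le>q. w - z r) = (\<Sum>p\<le>q. 1 / ((w - z p) * (\<Prod>r\<in>{..q}-{p}. z p - z r)))"
proof -
  define c where "c = (\<lambda>p. \<Prod>r\<in>{..q}-{p}. z p - z r)"
  define P where "P = (\<Sum>p\<le>q. smult (1 / c p) (\<Prod>r\<in>{..q}-{p}. [:- z r, 1:])) - 1"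
  have ev: "poly P y = (\<Sum>p\<le>q. (1 / c p) * (\<Prod>r\<in>{..q}-{p}. y - z r)) - 1" for y
    unfolding P_def by (simp add: poly_sum poly_prod)
  have c: "c p \<noteq> 0" if "p \<le> q" for p
    using that inj by (auto simp: c_def inj_on_def)
  have "degree P \<le> q"
    unfolding P_def
  proof (intro degree_diff_le degree_sum_le)
    fix p assume "p \<in> {..q}"
    have "degree (smult (1 / c p) (\<Prod>r\<in>{..q}-{p}. [:- z r, 1:])) \<le> degree (\<Prod>r\<in>{..q}-{p}. [:- z r, 1:])"
      by (rule degree_smult_le)
    also have "\<dots> \<le> sum (degree \<circ> (\<lambda>r. [:- z r, 1:])) ({..q}-{p})"
      by (rule degree_prod_sum_le) auto
    also have "\<dots> = q" using \<open>p \<in> {..q}\<close> by simp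
    finally show "degree (smult (1 / c p) (\<Prod>r\<in>{..q}-{p}. [:- z r, 1:])) \<le> q" .
  qed auto
  have root: "poly P (z s) = 0" if "s \<le> q" for s
  proof -
    have "(\<Sum>p\<le>q. (1 / c p) * (\<Prod>r\<in>{..q}-{p}. z s - z r)) = (\<Sum>p\<le>q. if p = s then 1 else 0)"
    proof (rule sum.cong)
      fix p assume "p \<in> {..q}"
      show "(1 / c p) * (\<Prod>r\<in>{..q}-{p}. z s - z r) = (if p = s then 1 else 0)"
      proof (cases "p = s")
        case True
        then show ?thesis using c[of p] that by (simp add: c_def)
      next
        case False
        hence "(\<Prod>r\<in>{..q}-{p}. z s - z r) = 0" using that by (intro prod_zero) auto
        then show ?thesis using False by simp
      qed
    qed simp
    also have "\<dots> = 1" using that by simp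
    finally show ?thesis unfolding ev by simp
  qed
  have "P = 0"
  proof (rule ccontr)
    assume "P \<noteq> 0"
    have "Suc q = card (z ` {..q})" using card_image[OF inj] by simp
    also have "\<dots> \<le> card {x. poly P x = 0}"
      by (rule card_mono) (use root poly_roots_finite[OF \<open>P \<noteq> 0\<close>] in auto)
    also have "\<dots> \<le> degree P" by (rule card_poly_roots_bound[OF \<open>P \<noteq> 0\<close>])
    finally show False using \<open>degree P \<le> q\<close> by simp
  qed
  hence "1 = (\<Sum>p\<le>q. (1 / c p) * (\<Prod>r\<in>{..q}-{p}. w - z r))" using ev[of w] by simp
  hence "1 / (\<Prod>r\<le>q. w - z r) = (\<Sum>p\<le>q. (1 / c p) * (\<Prod>r\<in>{..q}-{p}. w - z r)) / (\<Prod>r\<le>q. w - z r)"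
    by simp
  also have "\<dots> = (\<Sum>p\<le>q. 1 / ((w - z p) * c p))"
    unfolding sum_divide_distrib
  proof (rule sum.cong)
    fix p assume p: "p \<in> {..q}"
    have "(\<Prod>r\<le>q. w - z r) = (w - z p) * (\<Prod>r\<in>{..q}-{p}. w - z r)"
      using p by (simp add: prod.remove)
    moreover have "w - z p \<noteq> 0" "(\<Prod>r\<in>{..q}-{p}. w - z r) \<noteq> 0" using w p by auto
    moreover have "(1 / c p) * A / ((w - z p) * A) = 1 / ((w - z p) * c p)" if "A \<noteq> 0" for A
      using that by simp
    ultimately show "(1 / c p) * (\<Prod>r\<in>{..q}-{p}. w - z r) / (\<Prod>r\<le>q. w - z r) = 1 / ((w - z p) * c p)"
      by simp
  qed simp
  finally show ?thesis by (simp add: c_def)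
qed

text \<open>Partial fractions combine the Cauchy integrals of the values into a single integral of
  \<open>f w\<close> over the product of all \<open>w - z r\<close>, and each of these
  \<open>q + 1\<close> factors is at least \<open>R - R0\<close> on the circle.\<close>

lemma ddiff_bound:
  assumes f: "f holomorphic_on UNIV" and inj: "inj_on z {..q}"
    and z: "\<And>p. p \<le> q \<Longrightarrow> norm (z p) \<le> R0" and R: "0 \<le> R0" "R0 < R"
    and M: "\<And>w. norm w = R \<Longrightarrow> norm (f w) \<le> M"
  shows "norm (ddiff z q f) \<le> R * M / (R - R0) ^ Suc q"
proof -
  define c where "c = (\<lambda>p. \<Prod>r\<in>{..q}-{p}. z p - z r)"
  have M0: "M \<ge> 0" using M[of "of_real R"] R by (auto intro: order_trans[OF norm_ge_zero])
  have hci: "((\<lambda>w. \<Sum>p\<le>q. (f w / (w - z p)) / c p) has_contour_integral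
          (\<Sum>p\<le>q. (2 * of_real pi * \<i> * f (z p)) / c p)) (circlepath 0 R)"
    by (intro has_contour_integral_sum has_contour_integral_div Cauchy_integral_circlepath_simple)
       (use z R in \<open>auto intro: holomorphic_on_subset[OF f] le_less_trans\<close>)
  have bd: "norm (\<Sum>p\<le>q. (f w / (w - z p)) / c p) \<le> M / (R - R0) ^ Suc q" if w: "norm (w - 0) = R" for w
  proof -
    have ne: "w \<notin> z ` {..q}" using w z R by force
    have "(\<Sum>p\<le>q. (f w / (w - z p)) / c p) = f w * (\<Sum>p\<le>q. 1 / ((w - z p) * c p))"
      by (simp add: sum_distrib_left)
    also have "\<dots> = f w / (\<Prod>r\<le>q. w - z r)"
      unfolding c_def partial_fractions[OF inj ne, symmetric] by simp
    finally have "norm (\<Sum>p\<le>q. (f w / (w - z p)) / c p) = norm (f w) / (\<Prod>r\<le>q. norm (w - z r))"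
      by (simp add: norm_divide prod_norm)
    also have "\<dots> \<le> M / (\<Prod>r\<le>q. R - R0)"
    proof (rule frac_le)
      show "(\<Prod>r\<le>q. R - R0) \<le> (\<Prod>r\<le>q. norm (w - z r))"
      proof (rule prod_mono)
        fix r assume "r \<in> {..q}"
        hence "norm (z r) \<le> R0" using z by simp
        thus "0 \<le> R - R0 \<and> R - R0 \<le> norm (w - z r)"
          using norm_triangle_ineq2[of w "z r"] w R by simp
      qed
    qed (use M[of w] w M0 R in auto)
    finally show ?thesis by simp
  qed
  have "norm (\<Sum>p\<le>q. (2 * of_real pi * \<i> * f (z p)) / c p) \<le> M / (R - R0) ^ Suc q * (2 * pi * R)"
    by (rule has_contour_integral_bound_circlepath[OF hci _ _ bd]) (use M0 R in auto)
  moreover have "(\<Sum>p\<le>q. (2 * of_real pi * \<i> * f (z p)) / c p) = 2 * of_real pi * \<i> * ddiff z q f"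
    by (simp add: ddiff_def c_def sum_distrib_left)
  ultimately have "2 * pi * norm (ddiff z q f) \<le> 2 * pi * (R * M / (R - R0) ^ Suc q)"
    by (simp add: norm_mult mult_ac)
  thus ?thesis by (subst (asm) mult_le_cancel_left_pos) auto
qed

text \<open>Passing from values to divided differences is multiplication by a lower triangular
  matrix, whose diagonal product is the inverse of the Vandermonde product.\<close>

lemma det_ddiff:
  fixes z :: "nat \<Rightarrow> complex" and F :: "nat \<Rightarrow> complex \<Rightarrow> complex"
  assumes inj: "inj_on z {..<L}"
  shows "det (mat L L (\<lambda>(p,l). F l (z p))) =
           (\<Prod>q<L. \<Prod>r<q. z q - z r) * det (mat L L (\<lambda>(q,l). ddiff z q (F l)))"
proof -
  define T where "T = mat L L (\<lambda>(q,p). if p \<le> q then 1 / (\<Prod>r\<in>{..q}-{p}. z p - z r) else 0)"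
  define M where "M = mat L L (\<lambda>(p,l). F l (z p))"
  have T: "T \<in> carrier_mat L L" and M: "M \<in> carrier_mat L L" by (simp_all add: T_def M_def)
  have "T * M = mat L L (\<lambda>(q,l). ddiff z q (F l))"
  proof (rule eq_matI)
    fix q l assume "q < dim_row (mat L L (\<lambda>(q,l). ddiff z q (F l)))" "l < dim_col (mat L L (\<lambda>(q,l). ddiff z q (F l)))"
    hence ql: "q < L" "l < L" by simp_all
    have "(T * M) $$ (q,l) = (\<Sum>p<L. (if p \<le> q then 1 / (\<Prod>r\<in>{..q}-{p}. z p - z r) else 0) * F l (z p))"
      using ql by (simp add: T_def M_def scalar_prod_def atLeast0LessThan)
    also have "\<dots> = (\<Sum>p\<le>q. (if p \<le> q then 1 / (\<Prod>r\<in>{..q}-{p}. z p - z r) else 0) * F l (z p))"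
      by (rule sum.mono_neutral_right) (use ql in auto)
    also have "\<dots> = ddiff z q (F l)" unfolding ddiff_def by (intro sum.cong) auto
    finally show "(T * M) $$ (q,l) = mat L L (\<lambda>(q,l). ddiff z q (F l)) $$ (q,l)" using ql by simp
  qed (simp_all add: T_def M_def)
  moreover have "det T = (\<Prod>q<L. 1 / (\<Prod>r<q. z q - z r))"
  proof -
    have "det T = prod_list (diag_mat T)"
      by (rule det_lower_triangular[OF _ T]) (auto simp: T_def)
    also have "\<dots> = (\<Prod>q<L. T $$ (q,q))" using T
      by (simp add: prod_list_diag_prod atLeast0LessThan)
    also have "\<dots> = (\<Prod>q<L. 1 / (\<Prod>r<q. z q - z r))"
    proof (rule prod.cong)
      fix q assume "q \<in> {..<L}"
      moreover have "{..q} - {q} = {..<q}" by auto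
      ultimately show "T $$ (q,q) = 1 / (\<Prod>r<q. z q - z r)" by (simp add: T_def)
    qed simp
    finally show ?thesis .
  qed
  moreover have "(\<Prod>q<L. \<Prod>r<q. z q - z r) * (\<Prod>q<L. 1 / (\<Prod>r<q. z q - z r)) = 1"
  proof -
    have "(\<Prod>r<q. z q - z r) \<noteq> 0" if "q < L" for q
      using that by (auto dest!: inj_onD[OF inj])
    thus ?thesis by (auto simp flip: prod.distrib intro!: prod.neutral)
  qed
  ultimately show ?thesis
    using Determinant.det_mult[OF T M] by (simp add: M_def flip: mult.assoc)
qed

text \<open>A difference of nodes is at most \<open>2 R0\<close>, while on the circle of radius
  \<open>7 R0\<close> a divided difference of order \<open>q\<close> gains \<open>(6 R0)^q\<close>
  in the denominator. The net gain is \<open>3^q\<close> in row \<open>q\<close>, so the exponent is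
  quadratic in \<open>L\<close>, which is what must beat all other contributions. The factor 2
  rounds up \<open>7/6\<close>.\<close>

lemma interpolation_det_bound:
  fixes z :: "nat \<Rightarrow> complex" and F :: "nat \<Rightarrow> complex \<Rightarrow> complex"
  assumes inj: "inj_on z {..<L}" and z: "\<And>p. p < L \<Longrightarrow> norm (z p) \<le> R0" and R0: "R0 > 0"
    and F: "\<And>l. l < L \<Longrightarrow> F l holomorphic_on UNIV"
    and M: "\<And>l w. l < L \<Longrightarrow> norm w = 7 * R0 \<Longrightarrow> norm (F l w) \<le> M"
  shows "norm (det (mat L L (\<lambda>(p,l). F l (z p)))) \<le> (2 * real L * M) ^ L / 3 ^ (\<Sum>{..<L})"
proof (cases "L = 0")
  case False
  have M0: "M \<ge> 0" using M[of 0 "of_real (7 * R0)"] R0 False by (auto intro: order_trans[OF norm_ge_zero])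
  have "norm (\<Prod>q<L. \<Prod>r<q. z q - z r) \<le> (\<Prod>q<L. (2 * R0) ^ q)"
    unfolding prod_norm[symmetric]
  proof (intro prod_mono conjI prod_nonneg ballI norm_ge_zero)
    fix q assume q: "q \<in> {..<L}"
    have "(\<Prod>r<q. norm (z q - z r)) \<le> (\<Prod>r<q. 2 * R0)"
    proof (intro prod_mono conjI norm_ge_zero)
      fix r assume "r \<in> {..<q}"
      thus "norm (z q - z r) \<le> 2 * R0"
        using norm_triangle_ineq4[of "z q" "z r"] z[of q] z[of r] q by simp
    qed
    thus "(\<Prod>r<q. norm (z q - z r)) \<le> (2 * R0) ^ q" by simp
  qed
  moreover have "norm (det (mat L L (\<lambda>(q,l). ddiff z q (F l)))) \<le> (\<Prod>q<L. 2 * real L * M / (6 * R0) ^ q)"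
  proof -
    have "norm (det (mat L L (\<lambda>(q,l). ddiff z q (F l)))) \<le> (\<Prod>q<L. \<Sum>l<L. norm (ddiff z q (F l)))"
      by (rule order_trans[OF norm_det_le_prod_row_sums[of _ L]]) (auto intro!: prod_mono sum_nonneg)
    also have "\<dots> \<le> (\<Prod>q<L. 2 * real L * M / (6 * R0) ^ q)"
    proof (intro prod_mono conjI sum_nonneg norm_ge_zero)
      fix q assume q: "q \<in> {..<L}"
      have "(\<Sum>l<L. norm (ddiff z q (F l))) \<le> (\<Sum>l<L. 7 * R0 * M / (7 * R0 - R0) ^ Suc q)"
      proof (intro sum_mono ddiff_bound)
        show "inj_on z {..q}" using q by (intro inj_on_subset[OF inj]) auto
      qed (use q z R0 F M in auto)
      also have "\<dots> = (7 / 6) * real L * M / (6 * R0) ^ q"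
        using R0 by (simp add: field_simps)
      also have "\<dots> \<le> 2 * real L * M / (6 * R0) ^ q"
        using R0 M0 by (intro divide_right_mono mult_right_mono) auto
      finally show "(\<Sum>l<L. norm (ddiff z q (F l))) \<le> 2 * real L * M / (6 * R0) ^ q" .
    qed
    finally show ?thesis .
  qed
  ultimately have "norm (det (mat L L (\<lambda>(p,l). F l (z p)))) \<le>
      (\<Prod>q<L. (2 * R0) ^ q) * (\<Prod>q<L. 2 * real L * M / (6 * R0) ^ q)"
    unfolding det_ddiff[OF inj] norm_mult by (intro mult_mono prod_nonneg) (use R0 in auto)
  also have "\<dots> = (\<Prod>q<L. 2 * real L * M / 3 ^ q)"
    unfolding prod.distrib[symmetric]
  proof (rule prod.cong)
    fix q
    have "(6 * R0) ^ q = 3 ^ q * (2 * R0) ^ q" using power_mult_distrib[of 3 "2 * R0" q] by simp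
    thus "(2 * R0) ^ q * (2 * real L * M / (6 * R0) ^ q) = 2 * real L * M / 3 ^ q"
      using R0 by simp
  qed simp
  also have "\<dots> = (2 * real L * M) ^ L / 3 ^ (\<Sum>{..<L})"
    by (simp add: prod_dividef power_sum)
  finally show ?thesis .
qed simp

subsection \<open>Casoratians and the zero estimate\<close>

lemma det_mat_0_iff:
  fixes f :: "nat \<times> nat \<Rightarrow> 'a :: idom"
  shows "det (mat n n f) = 0 \<longleftrightarrow> (\<exists>v. (\<exists>i<n. v i \<noteq> 0) \<and> (\<forall>l<n. (\<Sum>m<n. f (l,m) * v m) = 0))"
proof -
  have "det (mat n n f) = 0 \<longleftrightarrow> (\<exists>v. v \<in> carrier_vec n \<and> v \<noteq> 0\<^sub>v n \<and> mat n n f *\<^sub>v v = 0\<^sub>v n)"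
    by (rule det_0_iff_vec_prod_zero) simp
  also have "\<dots> \<longleftrightarrow> (\<exists>v. (\<exists>i<n. v i \<noteq> 0) \<and> (\<forall>l<n. (\<Sum>m<n. f (l,m) * v m) = 0))"
  proof safe
    fix v assume v: "v \<in> carrier_vec n" "v \<noteq> 0\<^sub>v n" "mat n n f *\<^sub>v v = 0\<^sub>v n"
    have "\<exists>i<n. v $ i \<noteq> 0"
    proof (rule ccontr)
      assume "\<not> (\<exists>i<n. v $ i \<noteq> 0)"
      hence "v = 0\<^sub>v n" using v(1) by (intro eq_vecI) auto
      thus False using v(2) by simp
    qed
    moreover have "(\<Sum>m<n. f (l,m) * v $ m) = 0" if "l < n" for l
    proof -
      have "(\<Sum>m<n. f (l,m) * v $ m) = (mat n n f *\<^sub>v v) $ l"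
        using that carrier_vecD[OF v(1)] by (simp add: scalar_prod_def atLeast0LessThan)
      thus ?thesis using v(3) that by simp
    qed
    ultimately show "\<exists>v. (\<exists>i<n. v i \<noteq> 0) \<and> (\<forall>l<n. (\<Sum>m<n. f (l,m) * v m) = 0)" by blast
  next
    fix v i assume v: "\<forall>l<n. (\<Sum>m<n. f (l,m) * v m) = 0" and i: "i < n" "v i \<noteq> 0"
    have "vec n v \<noteq> 0\<^sub>v n"
    proof
      assume "vec n v = 0\<^sub>v n"
      hence "vec n v $ i = 0\<^sub>v n $ i" by simp
      thus False using i by simp
    qed
    moreover have "mat n n f *\<^sub>v vec n v = 0\<^sub>v n"
      by (rule eq_vecI) (use v in \<open>auto simp: scalar_prod_def atLeast0LessThan\<close>)
    ultimately show "\<exists>v. v \<in> carrier_vec n \<and> v \<noteq> 0\<^sub>v n \<and> mat n n f *\<^sub>v v = 0\<^sub>v n"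
      by (intro exI[of _ "vec n v"]) simp
  qed
  finally show ?thesis .
qed

text \<open>Points are added one at a time. Expansion along the last row turns the new determinant
  into a linear combination of the functions, in which the last coefficient is the previous nonzero
  minor; so it cannot vanish at every point.\<close>

lemma exists_nonzero_minor:
  fixes F :: "nat \<Rightarrow> 'p \<Rightarrow> 'a :: idom"
  assumes "\<And>c. (\<And>p. p \<in> Pts \<Longrightarrow> (\<Sum>l<L. c l * F l p) = 0) \<Longrightarrow> \<forall>l<L. c l = 0"
  shows "\<exists>P. (\<forall>q<L. P q \<in> Pts) \<and> det (mat L L (\<lambda>(q,l). F l (P q))) \<noteq> 0"
  using assms
proof (induction L)
  case (Suc L)
  have "\<forall>l<L. c l = 0" if c: "\<And>p. p \<in> Pts \<Longrightarrow> (\<Sum>l<L. c l * F l p) = 0" for c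
  proof -
    have "\<forall>l<Suc L. (c(L := 0)) l = 0"
    proof (rule Suc.prems)
      fix p assume "p \<in> Pts"
      have "(\<Sum>l<L. (c(L := 0)) l * F l p) = (\<Sum>l<L. c l * F l p)" by (intro sum.cong) auto
      thus "(\<Sum>l<Suc L. (c(L := 0)) l * F l p) = 0" using c[OF \<open>p \<in> Pts\<close>] by simp
    qed
    thus ?thesis by (metis fun_upd_other less_Suc_eq nat_neq_iff)
  qed
  from Suc.IH[OF this] obtain P where P: "\<forall>q<L. P q \<in> Pts" "det (mat L L (\<lambda>(q,l). F l (P q))) \<noteq> 0" by blast
  define A where "A = (\<lambda>p. mat (Suc L) (Suc L) (\<lambda>(q,l). F l (if q < L then P q else p)))"
  define c where "c = (\<lambda>j. (- 1) ^ (L + j) * det (mat L L (\<lambda>(q,l). F (if l < j then l else Suc l) (P q))))"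
  have detA: "det (A p) = (\<Sum>l<Suc L. c l * F l p)" for p
  proof -
    have "det (A p) = (\<Sum>j<Suc L. A p $$ (L,j) * cofactor (A p) L j)"
      by (rule laplace_expansion_row) (auto simp: A_def)
    also have "\<dots> = (\<Sum>l<Suc L. c l * F l p)"
    proof (rule sum.cong)
      fix j assume "j \<in> {..<Suc L}"
      moreover have "mat_delete (A p) L j = mat L L (\<lambda>(q,l). F (if l < j then l else Suc l) (P q))"
        by (rule eq_matI) (auto simp: A_def mat_delete_def)
      ultimately show "A p $$ (L,j) * cofactor (A p) L j = c j * F j p"
        by (simp add: cofactor_def c_def A_def)
    qed simp
    finally show ?thesis .
  qed
  have "c L \<noteq> 0"
  proof -
    have "mat L L (\<lambda>(q,l). F (if l < L then l else Suc l) (P q)) = mat L L (\<lambda>(q,l). F l (P q))"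
      by (rule eq_matI) auto
    thus ?thesis using P by (simp add: c_def)
  qed
  then obtain p where p: "p \<in> Pts" "det (A p) \<noteq> 0"
    using Suc.prems[of c] unfolding detA by blast
  show ?case
    by (rule exI[of _ "\<lambda>q. if q < L then P q else p"]) (use p P in \<open>simp add: A_def\<close>)
qed simp

lemma degree_det_le:
  fixes A :: "'a :: idom poly mat"
  assumes A: "A \<in> carrier_mat n n" and b: "\<And>i j. i < n \<Longrightarrow> j < n \<Longrightarrow> degree (A $$ (i,j)) \<le> d"
  shows "degree (det A) \<le> n * d"
  unfolding det_def'[OF A]
proof (rule degree_sum_le)
  show "finite {p. p permutes {0..<n}}" by (simp add: finite_permutations)
  fix p assume p: "p \<in> {p. p permutes {0..<n}}"
  have "degree (signof p * (\<Prod>i = 0..<n. A $$ (i, p i))) \<le> degree (\<Prod>i = 0..<n. A $$ (i, p i))"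
    by (simp add: sign_def)
  also have "\<dots> \<le> sum (degree \<circ> (\<lambda>i. A $$ (i, p i))) {0..<n}"
    by (rule degree_prod_sum_le) simp
  also have "\<dots> \<le> (\<Sum>i\<in>{0..<n}. d)"
    by (rule sum_mono) (use b p in \<open>auto dest: permutes_in_image\<close>)
  finally show "degree (signof p * (\<Prod>i = 0..<n. A $$ (i, p i))) \<le> n * d" by simp
qed

text \<open>This is the discrete counterpart of the Wronskian, with shifts by \<open>h\<close> in
  place of derivatives. It is kept as a polynomial so that its zeros can be counted.\<close>

definition casoratian :: "nat \<Rightarrow> (nat \<Rightarrow> complex poly) \<Rightarrow> complex \<Rightarrow> complex poly" where
  "casoratian r Q h = det (mat r r (\<lambda>(l,m). pcompose (Q m) [:of_nat l * h, 1:]))"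

lemma poly_casoratian:
  "poly (casoratian r Q h) x = det (mat r r (\<lambda>(l,m). poly (Q m) (x + of_nat l * h)))"
proof -
  have "comm_ring_hom (\<lambda>p :: complex poly. poly p x)" by unfold_locales auto
  note hom_det = comm_ring_hom.hom_det[OF this]
  have "poly (casoratian r Q h) x = det (map_mat (\<lambda>p. poly p x) (mat r r (\<lambda>(l,m). pcompose (Q m) [:of_nat l * h, 1:])))"
    unfolding casoratian_def by (rule hom_det[symmetric])
  also have "map_mat (\<lambda>p. poly p x) (mat r r (\<lambda>(l,m). pcompose (Q m) [:of_nat l * h, 1:])) =
        mat r r (\<lambda>(l,m). poly (Q m) (x + of_nat l * h))"
    by (rule eq_matI) (auto simp: poly_pcompose algebra_simps)
  finally show ?thesis .
qed

lemma degree_casoratian_le: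
  assumes "\<And>m. m < r \<Longrightarrow> degree (Q m) \<le> d"
  shows "degree (casoratian r Q h) \<le> r * d"
  unfolding casoratian_def using assms by (intro degree_det_le) (auto simp: degree_pcompose)

text \<open>
  If the Casoratian vanished identically, normalised kernel vectors at the points \<open>n h\<close> would not depend
  on \<open>n\<close>, which gives a linear relation between the polynomials.
\<close>

lemma casoratian_nonzero:
  assumes "\<And>d. (\<Sum>m<r. smult (d m) (Q m)) = 0 \<Longrightarrow> \<forall>m<r. d m = 0" and h: "h \<noteq> 0"
  shows "casoratian r Q h \<noteq> 0"
  using assms(1)
proof (induction r)
  case 0
  then show ?case by (simp add: casoratian_def)
next
  case (Suc r)
  have "\<forall>m<r. d m = 0" if d: "(\<Sum>m<r. smult (d m) (Q m)) = 0" for d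
  proof -
    have "(\<Sum>m<r. smult ((d(r := 0)) m) (Q m)) = (\<Sum>m<r. smult (d m) (Q m))"
      by (intro sum.cong) auto
    hence "\<forall>m<Suc r. (d(r := 0)) m = 0" using d by (intro Suc.prems) simp
    thus ?thesis by (metis fun_upd_other less_Suc_eq nat_neq_iff)
  qed
  from Suc.IH[OF this] have nz: "casoratian r Q h \<noteq> 0" .
  show ?case
  proof
    assume z: "casoratian (Suc r) Q h = 0"
    have "finite {n. poly (casoratian r Q h) (of_nat n * h) = 0}"
    proof (rule finite_imageD[of "\<lambda>n. of_nat n * h"])
      show "finite ((\<lambda>n. of_nat n * h) ` {n. poly (casoratian r Q h) (of_nat n * h) = 0})"
        by (rule finite_subset[OF _ poly_roots_finite[OF nz]]) auto
    qed (use h in \<open>auto simp: inj_on_def\<close>)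
    then obtain n0 where "\<forall>n\<in>{n. poly (casoratian r Q h) (of_nat n * h) = 0}. n < n0"
      using finite_nat_set_iff_bounded by blast
    hence n0: "poly (casoratian r Q h) (of_nat n * h) \<noteq> 0" if "n \<ge> n0" for n
      using that by fastforce
    \<comment> \<open>Beyond \<open>n0\<close> the smaller Casoratian is nonzero. A kernel vector
      with last coordinate 0 would be a kernel vector of the smaller matrix, so the last coordinate
      can be normalised to 1.\<close>
    have "\<exists>u. u r = 1 \<and> (\<forall>l<Suc r. (\<Sum>m<Suc r. poly (Q m) (of_nat (n + l) * h) * u m) = 0)" if n: "n \<ge> n0" for n
    proof -
      have "det (mat (Suc r) (Suc r) (\<lambda>(l,m). poly (Q m) (of_nat n * h + of_nat l * h))) = 0"
        unfolding poly_casoratian[symmetric] z by simp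
      then obtain v i where v: "\<forall>l<Suc r. (\<Sum>m<Suc r. poly (Q m) (of_nat n * h + of_nat l * h) * v m) = 0"
        and i: "i < Suc r" "v i \<noteq> 0" unfolding det_mat_0_iff by auto
      have "v r \<noteq> 0"
      proof
        assume vr: "v r = 0"
        hence "i < r" using i by (cases "i = r") auto
        moreover have "\<forall>l<r. (\<Sum>m<r. poly (Q m) (of_nat n * h + of_nat l * h) * v m) = 0"
          using v vr by simp
        ultimately have "det (mat r r (\<lambda>(l,m). poly (Q m) (of_nat n * h + of_nat l * h))) = 0"
          using i unfolding det_mat_0_iff by auto
        thus False using n0[OF n] unfolding poly_casoratian by simp
      qed
      show ?thesis
      proof (rule exI[of _ "\<lambda>m. v m / v r"], intro conjI allI impI)
        fix l assume l: "l < Suc r"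
        have "(\<Sum>m<Suc r. poly (Q m) (of_nat (n + l) * h) * (v m / v r)) =
              (\<Sum>m<Suc r. poly (Q m) (of_nat n * h + of_nat l * h) * v m) / v r"
          unfolding sum_divide_distrib by (intro sum.cong) (simp_all add: algebra_simps)
        thus "(\<Sum>m<Suc r. poly (Q m) (of_nat (n + l) * h) * (v m / v r)) = 0" using v l by simp
      qed (use \<open>v r \<noteq> 0\<close> in simp)
    qed
    then obtain u where u1: "\<And>n. n \<ge> n0 \<Longrightarrow> u n r = 1"
      and u: "\<And>n l. n \<ge> n0 \<Longrightarrow> l < Suc r \<Longrightarrow> (\<Sum>m<Suc r. poly (Q m) (of_nat (n + l) * h) * u n m) = 0"
      by metis
    \<comment> \<open>The systems at \<open>n\<close> and \<open>n + 1\<close> share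
      \<open>r\<close> of their rows. The difference of the two normalised vectors has last
      coordinate 0 and satisfies these common rows, so it lies in the kernel of the smaller matrix
      at \<open>n + 1\<close>, which is invertible.\<close>
    have step: "u (Suc n) m = u n m" if n: "n \<ge> n0" and m: "m < r" for n m
    proof (rule ccontr)
      assume ne: "u (Suc n) m \<noteq> u n m"
      have "\<forall>l<r. (\<Sum>m<r. poly (Q m) (of_nat (Suc n) * h + of_nat l * h) * (u (Suc n) m - u n m)) = 0"
      proof (intro allI impI)
        fix l assume l: "l < r"
        have "(\<Sum>m<Suc r. poly (Q m) (of_nat (Suc n + l) * h) * u (Suc n) m) - 
              (\<Sum>m<Suc r. poly (Q m) (of_nat (n + Suc l) * h) * u n m) = 0"
          using u[of "Suc n" l] u[of n "Suc l"] n l by simp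
        hence "(\<Sum>m<r. poly (Q m) (of_nat (Suc n + l) * h) * u (Suc n) m) - 
              (\<Sum>m<r. poly (Q m) (of_nat (Suc n + l) * h) * u n m) = 0"
          using u1[of n] u1[of "Suc n"] n by simp
        thus "(\<Sum>m<r. poly (Q m) (of_nat (Suc n) * h + of_nat l * h) * (u (Suc n) m - u n m)) = 0"
          by (simp add: algebra_simps sum_subtractf)
      qed
      hence "det (mat r r (\<lambda>(l,m). poly (Q m) (of_nat (Suc n) * h + of_nat l * h))) = 0"
        unfolding det_mat_0_iff using m ne by (intro exI[of _ "\<lambda>m. u (Suc n) m - u n m"]) auto
      thus False using n0[of "Suc n"] n unfolding poly_casoratian by simp
    qed
    have const: "u n m = u n0 m" if "n \<ge> n0" "m < Suc r" for n m
      using that(1)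
    proof (induction n rule: dec_induct)
      case (step n)
      then show ?case using \<open>\<And>n m. n0 \<le> n \<Longrightarrow> m < r \<Longrightarrow> u (Suc n) m = u n m\<close>[of n m] u1[of n] u1[of "Suc n"] that
        by (cases "m = r") auto
    qed simp
    define p where "p = (\<Sum>m<Suc r. smult (u n0 m) (Q m))"
    have root: "poly p (of_nat n * h) = 0" if n: "n \<ge> n0" for n
    proof -
      have "poly p (of_nat n * h) = (\<Sum>m<Suc r. poly (Q m) (of_nat (n + 0) * h) * u n m)"
        unfolding p_def poly_sum by (intro sum.cong) (use const[OF n] in auto)
      thus ?thesis using u[of n 0] n by simp
    qed
    have "p = 0"
    proof (rule ccontr)
      assume "p \<noteq> 0"
      have "infinite ((\<lambda>n. of_nat n * h) ` {n0..})"
        using h by (subst finite_image_iff) (auto simp: inj_on_def infinite_Ici)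
      moreover have "(\<lambda>n. of_nat n * h) ` {n0..} \<subseteq> {x. poly p x = 0}" using root by auto
      ultimately show False using poly_roots_finite[OF \<open>p \<noteq> 0\<close>] finite_subset by blast
    qed
    hence "\<forall>m<Suc r. u n0 m = 0" unfolding p_def by (rule Suc.prems)
    hence "u n0 r = 0" by simp
    thus False using u1[of n0] by simp
  qed
qed

definition tensor_rep :: "nat \<Rightarrow> nat \<Rightarrow> (nat \<Rightarrow> nat \<Rightarrow> complex) \<Rightarrow> nat set \<Rightarrow> (nat \<Rightarrow> complex poly) \<Rightarrow> (nat \<Rightarrow> complex poly) \<Rightarrow> bool" where
  "tensor_rep A B c I Q E \<longleftrightarrow> finite I \<and> (\<forall>m\<in>I. degree (Q m) < A \<and> degree (E m) < B) \<and>
     (\<forall>i<A. \<forall>j<B. (\<Sum>m\<in>I. coeff (Q m) i * coeff (E m) j) = c i j)"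

text \<open>A linear relation expresses one \<open>Q m\<close> through the others; its term is then
  distributed over the remaining \<open>E l\<close>.\<close>

lemma tensor_rep_reduce:
  assumes rep: "tensor_rep A B c I Q E" and m: "m \<in> I"
    and dep: "(\<Sum>m\<in>I. smult (d m) (Q m)) = 0" "d m \<noteq> 0"
  shows "tensor_rep A B c (I - {m}) Q (\<lambda>l. E l - smult (d l / d m) (E m))"
proof -
  have I: "finite I" using rep by (simp add: tensor_rep_def)
  show ?thesis unfolding tensor_rep_def
  proof (intro conjI ballI allI impI)
    fix l assume l: "l \<in> I - {m}"
    show "degree (E l - smult (d l / d m) (E m)) < B"
      by (rule degree_diff_less) (use rep m l in \<open>auto simp: tensor_rep_def intro: le_less_trans[OF degree_smult_le]\<close>)
  next
    fix i j assume ij: "i < A" "j < B"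
    have "coeff (\<Sum>m\<in>I. smult (d m) (Q m)) i = 0" using dep by simp
    hence "d m * coeff (Q m) i + (\<Sum>l\<in>I-{m}. d l * coeff (Q l) i) = 0"
      using I m by (simp add: coeff_sum sum.remove)
    hence Qm: "coeff (Q m) i = - (\<Sum>l\<in>I-{m}. d l / d m * coeff (Q l) i)"
      using dep(2) by (simp add: sum_divide_distrib[symmetric] field_simps eq_neg_iff_add_eq_0)
    have "c i j = coeff (Q m) i * coeff (E m) j + (\<Sum>l\<in>I-{m}. coeff (Q l) i * coeff (E l) j)"
      using rep ij I m by (auto simp: tensor_rep_def sum.remove)
    also have "\<dots> = (\<Sum>l\<in>I-{m}. coeff (Q l) i * coeff (E l) j) -
        (\<Sum>l\<in>I-{m}. d l / d m * coeff (Q l) i) * coeff (E m) j"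
      unfolding Qm by simp
    also have "\<dots> = (\<Sum>l\<in>I-{m}. coeff (Q l) i * coeff (E l - smult (d l / d m) (E m)) j)"
      unfolding sum_distrib_right sum_subtractf[symmetric] by (intro sum.cong) (auto simp: algebra_simps)
    finally show "(\<Sum>l\<in>I-{m}. coeff (Q l) i * coeff (E l - smult (d l / d m) (E m)) j) = c i j" ..
  qed (use rep in \<open>auto simp: tensor_rep_def\<close>)
qed

text \<open>The least number of terms is taken. A relation among the \<open>Q m\<close> or a
  vanishing \<open>E m\<close> would allow one term fewer, and one term for each column of
  \<open>c\<close> shows that \<open>B\<close> terms suffice.\<close>

lemma tensor_rep_minimal:
  assumes ne: "i0 < A" "j0 < B" "c i0 j0 \<noteq> 0"
  obtains r Q E where "0 < r" "r \<le> B" "tensor_rep A B c {..<r} Q E"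
    "\<And>d. (\<Sum>m<r. smult (d m) (Q m)) = 0 \<Longrightarrow> \<forall>m<r. d m = 0" "E 0 \<noteq> 0"
proof -
  define P where "P = (\<lambda>r. \<exists>I Q E. tensor_rep A B c I Q E \<and> card I = r)"
  have "tensor_rep A B c {..<B} (\<lambda>j. \<Sum>i<A. monom (c i j) i) (\<lambda>j. monom 1 j)"
    unfolding tensor_rep_def
  proof (intro conjI ballI allI impI)
    fix m assume "m \<in> {..<B}"
    have "degree (\<Sum>i<A. monom (c i m) i) \<le> A - 1"
      by (intro degree_sum_le) (auto intro: order_trans[OF degree_monom_le])
    thus "degree (\<Sum>i<A. monom (c i m) i) < A" using ne by simp
  qed (auto simp: degree_monom_eq coeff_sum coeff_monom if_distrib cong: if_cong)
  hence PB: "P B" unfolding P_def by (intro exI[of _ "{..<B}"]) auto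
  define r where "r = (LEAST r. P r)"
  have "P r" unfolding r_def using PB by (rule LeastI)
  then obtain I Q E where rep: "tensor_rep A B c I Q E" and r: "card I = r" unfolding P_def by blast
  have I: "finite I" using rep by (simp add: tensor_rep_def)
  have smaller: False if "tensor_rep A B c (I - {m}) Q' E'" "m \<in> I" for m Q' E'
  proof -
    have "P (r - 1)" using that I r unfolding P_def by (metis card_Diff_singleton)
    hence "r \<le> r - 1" unfolding r_def by (rule Least_le)
    moreover have "r > 0" using that I r by (auto simp: card_gt_0_iff)
    ultimately show False by simp
  qed
  have "I \<noteq> {}" using rep ne by (force simp: tensor_rep_def)
  have E: "E m \<noteq> 0" if "m \<in> I" for m
  proof
    assume "E m = 0"
    hence "tensor_rep A B c (I - {m}) Q E"
      using rep I that unfolding tensor_rep_def by (auto simp: sum.remove)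
    thus False using smaller that by blast
  qed
  from ex_bij_betw_nat_finite[OF I] obtain g where g: "bij_betw g {..<r} I"
    by (auto simp: r atLeast0LessThan)
  show ?thesis
  proof (rule that)
    show "0 < r" using I \<open>I \<noteq> {}\<close> r by (auto simp: card_gt_0_iff)
    show "r \<le> B" unfolding r_def using PB by (rule Least_le)
    show "tensor_rep A B c {..<r} (Q \<circ> g) (E \<circ> g)"
      using rep bij_betwE[OF g] sum.reindex_bij_betw[OF g, of "\<lambda>m. coeff (Q m) i * coeff (E m) j" for i j]
      by (auto simp: tensor_rep_def)
    show "(E \<circ> g) 0 \<noteq> 0" using E bij_betwE[OF g] \<open>0 < r\<close> by auto
    fix d assume d: "(\<Sum>m<r. smult (d m) ((Q \<circ> g) m)) = 0"
    show "\<forall>m<r. d m = 0"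
    proof (rule ccontr)
      assume "\<not> (\<forall>m<r. d m = 0)"
      then obtain m where m: "m < r" "d m \<noteq> 0" by blast
      define d' where "d' = (\<lambda>i. d (the_inv_into {..<r} g i))"
      have d': "d' (g i) = d i" if "i < r" for i
        using that the_inv_into_f_f[OF bij_betw_imp_inj_on[OF g], of i] by (simp add: d'_def)
      have "(\<Sum>i\<in>I. smult (d' i) (Q i)) = (\<Sum>m<r. smult (d' (g m)) (Q (g m)))"
        by (rule sum.reindex_bij_betw[OF g, symmetric])
      also have "\<dots> = 0" using d d' by simp
      finally show False
        using tensor_rep_reduce[OF rep, of "g m" d'] smaller[of "g m"] m d' bij_betwE[OF g] by auto
    qed
  qed
qed

text \<open>
  For \<open>P = \<Sum>\<^sub>m Q\<^sub>m (X) E\<^sub>m (Y)\<close> with the fewest possible terms, the Casoratian of the \<open>Q\<^sub>m\<close> is nonzero, but it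
  vanishes at every \<open>k s + N t\<close> for which the vector of the \<open>E\<^sub>m (b\<^sup>s)\<close> is nonzero.
\<close>

lemma zero_estimate:
  fixes b :: complex and k N A B S T :: nat
  assumes b: "\<And>n. n > 0 \<Longrightarrow> b ^ n \<noteq> 1" "b \<noteq> 0" and cop: "coprime k N" and N: "N > 0" "S \<le> N"
    and BS: "B \<le> S" "B \<le> T" and AB: "A * B \<le> (S - B) * (T - B)"
    and van: "\<And>s t. s < S \<Longrightarrow> t < T \<Longrightarrow> (\<Sum>i<A. \<Sum>j<B. c i j * of_nat (k * s + N * t) ^ i * b ^ (j * s)) = 0"
  shows "\<forall>i<A. \<forall>j<B. c i j = 0"
proof (rule ccontr)
  assume "\<not> ?thesis"
  then obtain i0 j0 where ne: "i0 < A" "j0 < B" "c i0 j0 \<noteq> 0" by blast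
  obtain r Q E where r: "0 < r" "r \<le> B" and rep: "tensor_rep A B c {..<r} Q E"
    and indep: "\<And>d. (\<Sum>m<r. smult (d m) (Q m)) = 0 \<Longrightarrow> \<forall>m<r. d m = 0" and E0: "E 0 \<noteq> 0"
    by (rule tensor_rep_minimal[of i0 A j0 B c, OF ne]) (rule that)
  define W where "W = casoratian r Q (of_nat N)"
  have W: "W \<noteq> 0" unfolding W_def by (rule casoratian_nonzero) (use indep N in auto)
  have "degree W \<le> r * (A - 1)"
    unfolding W_def by (rule degree_casoratian_le) (use rep in \<open>force simp: tensor_rep_def\<close>)
  also have "\<dots> \<le> B * (A - 1)" using r by simp
  also have "\<dots> < A * B" using ne by (simp add: mult.commute)
  finally have degW: "degree W < A * B" .
  \<comment> \<open>As \<open>b\<close> is not a root of unity, its powers are distinct, so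
    \<open>E 0\<close> vanishes at fewer than \<open>B\<close> of them. These exponents
    \<open>s\<close> are given up.\<close>
  have inj_b: "inj_on (\<lambda>s. b ^ s) {..<S}"
  proof (rule linorder_inj_onI)
    fix s s' assume "s < s'" "s \<in> {..<S}" "s' \<in> {..<S}"
    have "b ^ s' = b ^ s * b ^ (s' - s)" using \<open>s < s'\<close> by (simp flip: power_add)
    thus "b ^ s \<noteq> b ^ s'" using b(1)[of "s' - s"] b(2) \<open>s < s'\<close> by simp
  qed auto
  define bad good where "bad = {s\<in>{..<S}. poly (E 0) (b ^ s) = 0}" and "good = {s\<in>{..<S}. poly (E 0) (b ^ s) \<noteq> 0}"
  have "card bad = card ((\<lambda>s. b ^ s) ` bad)"
    by (rule card_image[symmetric]) (rule inj_on_subset[OF inj_b], auto simp: bad_def)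
  also have "\<dots> \<le> card {x. poly (E 0) x = 0}"
    by (rule card_mono) (use poly_roots_finite[OF E0] in \<open>auto simp: bad_def\<close>)
  also have "\<dots> \<le> degree (E 0)" by (rule card_poly_roots_bound[OF E0])
  also have "\<dots> \<le> B" using rep r by (auto simp: tensor_rep_def less_imp_le)
  finally have "card bad \<le> B" .
  moreover have "card bad + card good = S"
  proof -
    have "card (bad \<union> good) = card bad + card good" by (rule card_Un_disjoint) (auto simp: bad_def good_def)
    moreover have "bad \<union> good = {..<S}" by (auto simp: bad_def good_def)
    ultimately show ?thesis by simp
  qed
  ultimately have good: "S - B \<le> card good" by simp
  define pt :: "nat \<times> nat \<Rightarrow> complex" where "pt = (\<lambda>(s,t). of_nat (k * s + N * t))"
  have eval: "(\<Sum>i<A. \<Sum>j<B. c i j * x ^ i * y ^ j) = (\<Sum>m<r. poly (Q m) x * poly (E m) y)" for x y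
  proof -
    have "(\<Sum>m<r. poly (Q m) x * poly (E m) y) =
       (\<Sum>m<r. \<Sum>i<A. \<Sum>j<B. (coeff (Q m) i * coeff (E m) j) * (x ^ i * y ^ j))"
      using rep by (intro sum.cong) (auto simp: tensor_rep_def poly_as_sum[of _ A] poly_as_sum[of _ B] sum_product mult_ac)
    also have "\<dots> = (\<Sum>i<A. \<Sum>m<r. \<Sum>j<B. (coeff (Q m) i * coeff (E m) j) * (x ^ i * y ^ j))"
      by (rule sum.swap)
    also have "\<dots> = (\<Sum>i<A. \<Sum>j<B. \<Sum>m<r. (coeff (Q m) i * coeff (E m) j) * (x ^ i * y ^ j))"
      by (rule sum.cong[OF refl], rule sum.swap)
    also have "\<dots> = (\<Sum>i<A. \<Sum>j<B. (\<Sum>m<r. coeff (Q m) i * coeff (E m) j) * (x ^ i * y ^ j))"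
      by (simp add: sum_distrib_right)
    also have "\<dots> = (\<Sum>i<A. \<Sum>j<B. c i j * x ^ i * y ^ j)"
      using rep by (intro sum.cong) (auto simp: tensor_rep_def mult_ac)
    finally show ?thesis ..
  qed
  \<comment> \<open>The rows of the Casoratian matrix are shifts by \<open>l N\<close>, that is,
    passages from \<open>t\<close> to \<open>t + l\<close> with \<open>l < r \<le> B\<close>.
    Restricting to \<open>t < T - B\<close> keeps them within the range where vanishing is
    known.\<close>
  have root: "poly W (pt (s,t)) = 0" if s: "s \<in> good" and t: "t < T - B" for s t
  proof -
    have "(\<Sum>m<r. poly (Q m) (pt (s,t) + of_nat l * of_nat N) * poly (E m) (b ^ s)) = 0" if l: "l < r" for l
    proof -
      have "(\<Sum>i<A. \<Sum>j<B. c i j * of_nat (k * s + N * (t + l)) ^ i * b ^ (j * s)) = 0"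
        by (rule van) (use s t l r in \<open>auto simp: good_def\<close>)
      hence "(\<Sum>i<A. \<Sum>j<B. c i j * of_nat (k * s + N * (t + l)) ^ i * (b ^ s) ^ j) = 0"
        by (simp add: power_mult[symmetric] mult.commute)
      hence "(\<Sum>m<r. poly (Q m) (of_nat (k * s + N * (t + l))) * poly (E m) (b ^ s)) = 0"
        unfolding eval .
      moreover have "(of_nat (k * s + N * (t + l)) :: complex) = pt (s,t) + of_nat l * of_nat N"
        by (simp add: pt_def algebra_simps)
      ultimately show ?thesis by simp
    qed
    moreover have "poly (E 0) (b ^ s) \<noteq> 0" using s by (simp add: good_def)
    ultimately show ?thesis
      unfolding W_def poly_casoratian det_mat_0_iff using r
      by (intro exI[of _ "\<lambda>m. poly (E m) (b ^ s)"]) auto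
  qed
  \<comment> \<open>The residue of \<open>k s + N t\<close> modulo \<open>N\<close> determines
    \<open>s\<close>, because \<open>k\<close> is invertible and \<open>s < S \<le> N\<close>;
    afterwards \<open>t\<close> is determined too.\<close>
  have inj_pt: "inj_on pt (good \<times> {..<T - B})"
  proof (rule inj_onI, clarify)
    fix s t s' t' assume s: "s \<in> good" "s' \<in> good" and "pt (s,t) = pt (s',t')"
    hence "of_nat (k * s + N * t) = (of_nat (k * s' + N * t') :: complex)" by (simp add: pt_def)
    hence eq: "k * s + N * t = k * s' + N * t'" by (rule of_nat_eq_iff[THEN iffD1])
    hence "[k * s = k * s'] (mod N)"
      by (metis cong_add_rcancel_0_nat cong_add_lcancel_nat cong_def mod_mult_self2)
    hence "[s = s'] (mod N)" using cop by (simp add: cong_mult_lcancel_nat coprime_commute)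
    moreover have "s < N" "s' < N" using s N by (auto simp: good_def)
    ultimately have "s = s'" by (simp add: cong_less_modulus_unique_nat)
    thus "s = s' \<and> t = t'" using eq N by simp
  qed
  have "(S - B) * (T - B) \<le> card good * (T - B)" using good by simp
  also have "\<dots> = card (pt ` (good \<times> {..<T - B}))" using card_image[OF inj_pt] by (simp add: card_cartesian_product)
  also have "\<dots> \<le> card {x. poly W x = 0}"
    by (rule card_mono) (use poly_roots_finite[OF W] root in auto)
  also have "\<dots> \<le> degree W" by (rule card_poly_roots_bound[OF W])
  finally show False using degW AB by simp
qed

subsection \<open>A lower bound for the distance to roots of unity\<close>

lemma sum_mod_div:
  fixes g :: "nat \<Rightarrow> nat \<Rightarrow> 'a :: comm_monoid_add"
  shows "(\<Sum>l<A * B. g (l mod A) (l div A)) = (\<Sum>i<A. \<Sum>j<B. g i j)"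
proof (cases "A = 0")
  case False
  have "(\<Sum>l<A * B. g (l mod A) (l div A)) = (\<Sum>(i,j)\<in>{..<A} \<times> {..<B}. g i j)"
  proof (rule sum.reindex_bij_witness[of _ "\<lambda>(i,j). i + A * j" "\<lambda>l. (l mod A, l div A)"])
    fix p assume p: "p \<in> {..<A} \<times> {..<B}"
    then obtain i j where ij: "p = (i,j)" "i < A" "j < B" by auto
    have "i + A * j < A * (Suc j)" using ij by simp
    also have "\<dots> \<le> A * B" using ij by (intro mult_le_mono) auto
    finally show "(case p of (i,j) \<Rightarrow> i + A * j) \<in> {..<A * B}" using ij by simp
  qed (use False in \<open>auto simp: less_mult_imp_div_less mult.commute\<close>)
  thus ?thesis by (simp add: sum.cartesian_product)
qed simp

lemma norm_cpoly_diff_le: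
  assumes "norm x \<le> 1" "norm y \<le> 1"
  shows "norm (poly (cpoly G) x - poly (cpoly G) y) \<le> norm (x - y) * (real (degree G) * of_int (poly_length G))"
proof -
  have "poly (cpoly G) x - poly (cpoly G) y = (\<Sum>i\<le>degree G. of_int (coeff G i) * (x ^ i - y ^ i))"
    by (simp add: poly_altdef sum_subtractf algebra_simps)
  also have "norm \<dots> \<le> (\<Sum>i\<le>degree G. \<bar>of_int (coeff G i)\<bar> * (real (degree G) * norm (x - y)))"
  proof (rule sum_norm_le)
    fix i assume i: "i \<in> {..degree G}"
    have "norm (x ^ i - y ^ i) \<le> real i * norm (x - y)"
      by (rule norm_power_diff[OF assms])
    also have "\<dots> \<le> real (degree G) * norm (x - y)" using i by (intro mult_right_mono) auto
    finally show "norm (of_int (coeff G i) * (x ^ i - y ^ i)) \<le> \<bar>of_int (coeff G i)\<bar> * (real (degree G) * norm (x - y))"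
      by (simp add: norm_mult mult_left_mono)
  qed
  also have "\<dots> = norm (x - y) * (real (degree G) * of_int (poly_length G))"
    by (simp add: poly_length_def sum_distrib_left sum_distrib_right mult_ac)
  finally show ?thesis .
qed

text \<open>Rows of the determinant are points \<open>(s, t)\<close>, columns are monomials
  \<open>X^i Y^j\<close> evaluated at \<open>k s + N t\<close> and \<open>b^s\<close>; as a function
  of \<open>b\<close> it is an integer polynomial \<open>G\<close>. Liouville bounds
  \<open>G (b)\<close> from below. At \<open>z\<close> in place of \<open>b\<close> the entries
  become values of entire functions at the integers \<open>k s + N t\<close>, so
  \<open>G (z)\<close> is tiny. Hypothesis \<open>key\<close> says that \<open>G (z)\<close> is at
  most half of the lower bound for \<open>G (b)\<close>, so the other half must come from
  \<open>b - z\<close>.\<close>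

lemma gelfond_core:
  fixes b :: complex and f :: "int poly" and k N A B S :: nat
  assumes f: "int_minimal f b" and b: "norm b = 1" "\<And>n. n > 0 \<Longrightarrow> b ^ n \<noteq> 1"
    and kN: "coprime k N" "k < N" and S: "0 < S" "S \<le> N" "B \<le> S" "A * B \<le> (S - B) * (S - B)"
  defines "z \<equiv> cis (2 * pi * real k / real N)"
  defines "L \<equiv> A * B"
  defines "l \<equiv> real_of_int (poly_length f)"
  defines "\<Lambda> \<equiv> (real L * real (2 * N * S) ^ A) ^ L"
  defines "M \<equiv> real (14 * N * S) ^ A * exp (28 * pi * real (B * S))"
  assumes L: "L > 0"
    and key: "2 * (2 * real L * M) ^ L * (l ^ (L * B * S) * (1 + \<Lambda>) ^ degree f) \<le> 3 ^ (\<Sum>{..<L})"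
  shows "1 \<le> norm (b - z) * (2 * real (L * B * S) * \<Lambda> * (l ^ (L * B * S) * (1 + \<Lambda>) ^ degree f))"
proof -
  have N: "N > 0" using kN by simp
  have A: "A > 0" using L by (simp add: L_def)
  have b0: "b \<noteq> 0" using b(1) by auto
  \<comment> \<open>The zero estimate says that no nontrivial combination of the columns vanishes at
    all points of the square, so some choice of \<open>L\<close> points gives a nonzero minor.
    Column \<open>l\<close> encodes \<open>i = l mod A\<close> and
    \<open>j = l div A\<close>.\<close>
  have "\<exists>P. (\<forall>q<L. P q \<in> {..<S} \<times> {..<S}) \<and>
     det (mat L L (\<lambda>(q,l). (\<lambda>l (s,t). of_nat (k * s + N * t) ^ (l mod A) * b ^ (l div A * s)) l (P q))) \<noteq> 0"
  proof (rule exists_nonzero_minor)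
    fix c :: "nat \<Rightarrow> complex"
    assume c: "\<And>p. p \<in> {..<S} \<times> {..<S} \<Longrightarrow>
      (\<Sum>l<L. c l * (case p of (s, t) \<Rightarrow> of_nat (k * s + N * t) ^ (l mod A) * b ^ (l div A * s))) = 0"
    have "\<forall>i<A. \<forall>j<B. c (A * j + i) = 0"
    proof (rule zero_estimate[OF b(2) b0 kN(1) N S(2) S(3) S(3) S(4)])
      fix s t assume st: "s < S" "t < S"
      have "(\<Sum>l<L. c l * (of_nat (k * s + N * t) ^ (l mod A) * b ^ (l div A * s))) =
        (\<Sum>l<A*B. (\<lambda>i j. c (A * j + i) * of_nat (k * s + N * t) ^ i * b ^ (j * s)) (l mod A) (l div A))"
        unfolding L_def by (intro sum.cong) (auto simp: mult.assoc)
      also have "\<dots> = (\<Sum>i<A. \<Sum>j<B. c (A * j + i) * of_nat (k * s + N * t) ^ i * b ^ (j * s))"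
        by (rule sum_mod_div)
      finally show "(\<Sum>i<A. \<Sum>j<B. c (A * j + i) * of_nat (k * s + N * t) ^ i * b ^ (j * s)) = 0"
        using c[of "(s,t)"] st by simp
    qed auto
    thus "\<forall>l<L. c l = 0"
    proof (intro allI impI)
      fix l assume h: "\<forall>i<A. \<forall>j<B. c (A * j + i) = 0" and "l < L"
      hence "l div A < B" by (simp add: L_def less_mult_imp_div_less mult.commute)
      thus "c l = 0" using h A by (metis mod_less_divisor mult_div_mod_eq)
    qed
  qed
  then obtain P where P: "\<And>q. q < L \<Longrightarrow> P q \<in> {..<S} \<times> {..<S}"
    and detP: "det (mat L L (\<lambda>(q,l). case P q of (s,t) \<Rightarrow> of_nat (k * s + N * t) ^ (l mod A) * b ^ (l div A * s))) \<noteq> 0"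
    by (auto simp: case_prod_unfold)
  define s n where "s = (\<lambda>q. fst (P q))" and "n = (\<lambda>q. k * fst (P q) + N * snd (P q))"
  have sS: "s q < S" and nR: "n q \<le> 2 * N * S" if "q < L" for q
  proof -
    have "fst (P q) < S" "snd (P q) < S" using P[OF that] by auto
    thus "s q < S" by (simp add: s_def)
    have "k * fst (P q) \<le> N * S" "N * snd (P q) \<le> N * S"
      using \<open>fst (P q) < S\<close> \<open>snd (P q) < S\<close> kN by (auto intro!: mult_le_mono)
    thus "n q \<le> 2 * N * S" unfolding n_def mult.assoc by linarith
  qed
  define GM where "GM = mat L L (\<lambda>(q,l). monom (int (n q) ^ (l mod A)) (l div A * s q))"
  define G where "G = det GM"
  have evG: "poly (cpoly G) y = det (mat L L (\<lambda>(q,l). of_nat (n q) ^ (l mod A) * y ^ (l div A * s q)))" for y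
  proof -
    interpret h: inj_idom_hom "of_int :: int \<Rightarrow> complex" by unfold_locales auto
    interpret ph: map_poly_inj_idom_hom "of_int :: int \<Rightarrow> complex" ..
    have "comm_ring_hom (\<lambda>p. poly (cpoly p) y)" by unfold_locales (auto simp: hom_distribs)
    from comm_ring_hom.hom_det[OF this, of GM]
    have "poly (cpoly G) y = det (map_mat (\<lambda>p. poly (cpoly p) y) GM)" by (simp add: G_def)
    also have "map_mat (\<lambda>p. poly (cpoly p) y) GM = mat L L (\<lambda>(q,l). of_nat (n q) ^ (l mod A) * y ^ (l div A * s q))"
      by (rule eq_matI) (auto simp: GM_def poly_monom)
    finally show ?thesis .
  qed
  have Gb: "poly (cpoly G) b \<noteq> 0"
    using detP unfolding evG by (simp add: s_def n_def case_prod_unfold)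
  have GM: "GM \<in> carrier_mat L L" by (simp add: GM_def)
  have div_less: "l div A < B" if "l < L" for l
    using that by (simp add: L_def less_mult_imp_div_less mult.commute)
  have degG: "degree G \<le> L * B * S"
  proof -
    have "degree G \<le> L * (B * S)" unfolding G_def
    proof (rule degree_det_le[OF GM])
      fix i j assume ij: "i < L" "j < L"
      have "degree (GM $$ (i,j)) \<le> j div A * s i" using ij by (simp add: GM_def degree_monom_le)
      also have "\<dots> \<le> B * S" using div_less[OF ij(2)] sS[OF ij(1)] by (intro mult_le_mono) auto
      finally show "degree (GM $$ (i,j)) \<le> B * S" .
    qed
    thus ?thesis by (simp add: mult.assoc)
  qed
  have NS: "1 \<le> 2 * N * S" using N S by simp
  have lenG: "of_int (poly_length G) \<le> \<Lambda>"
  proof -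
    have "poly_length G \<le> int (fact L) * (int (2 * N * S) ^ A) ^ L" unfolding G_def
    proof (rule poly_length_det[OF GM])
      fix i j assume ij: "i < L" "j < L"
      have "poly_length (GM $$ (i,j)) = int (n i ^ (j mod A))" using ij by (simp add: GM_def)
      also have "n i ^ (j mod A) \<le> (2 * N * S) ^ (j mod A)" using nR[OF ij(1)] by (rule power_mono) simp
      also have "(2 * N * S) ^ (j mod A) \<le> (2 * N * S) ^ A"
        by (rule power_increasing) (use NS A in \<open>auto simp: less_imp_le\<close>)
      finally show "poly_length (GM $$ (i,j)) \<le> int (2 * N * S) ^ A" by simp
    qed simp
    hence "real_of_int (poly_length G) \<le> real_of_int (int (fact L) * (int (2 * N * S) ^ A) ^ L)"
      by (rule of_int_le_iff[THEN iffD2])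
    also have "\<dots> = real (fact L) * (real (2 * N * S) ^ A) ^ L" by simp
    also have "\<dots> \<le> real L ^ L * (real (2 * N * S) ^ A) ^ L"
      using fact_le_power[of L, where 'a = real] by (intro mult_right_mono) auto
    finally show ?thesis by (simp add: \<Lambda>_def power_mult_distrib)
  qed
  have znorm: "norm z = 1" by (simp add: z_def)
  \<comment> \<open>The summand \<open>N t\<close> of \<open>n q\<close> changes the exponent by an
    integral multiple of \<open>2 \<pi> i\<close> only. Hence the power of \<open>z\<close>, which
    involves \<open>s\<close> alone, is an exponential function of \<open>k s + N t\<close>.\<close>
  have zpow: "z ^ (j * s q) = exp (2 * of_real pi * \<i> * of_nat j * of_nat (n q) / of_nat N)" for j q
  proof -
    have "2 * of_real pi * \<i> * of_nat j * of_nat (n q) / of_nat N =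
      of_nat (j * s q) * (\<i> * of_real (2 * pi * real k / real N)) + (2 * of_nat (j * snd (P q)) * of_real pi) * \<i>"
      using N by (simp add: n_def s_def field_simps)
    hence "exp (2 * of_real pi * \<i> * of_nat j * of_nat (n q) / of_nat N) =
       exp (of_nat (j * s q) * (\<i> * of_real (2 * pi * real k / real N))) * exp ((2 * of_nat (j * snd (P q)) * of_real pi) * \<i>)"
      by (simp only: exp_add)
    also have "exp ((2 * of_nat (j * snd (P q)) * of_real pi) * \<i>) = 1"
      unfolding exp_eq_1 by (auto intro!: exI[of _ "int (j * snd (P q))"])
    also have "exp (of_nat (j * s q) * (\<i> * of_real (2 * pi * real k / real N))) = z ^ (j * s q)"
      unfolding z_def cis_conv_exp by (rule exp_of_nat_mult)
    finally show ?thesis by simp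
  qed
  define F where "F = (\<lambda>l w. w ^ (l mod A) * exp (2 * of_real pi * \<i> * of_nat (l div A) * w / of_nat N))"
  have Gz_eq: "poly (cpoly G) z = det (mat L L (\<lambda>(q,l). F l (of_nat (n q))))"
    unfolding evG F_def zpow ..
  have Gz: "norm (poly (cpoly G) z) \<le> (2 * real L * M) ^ L / 3 ^ (\<Sum>{..<L})"
  proof (cases "inj_on (\<lambda>q. of_nat (n q) :: complex) {..<L}")
    case True
    show ?thesis unfolding Gz_eq
    proof (rule interpolation_det_bound[OF True, of "real (2 * N * S)"])
      show "0 < real (2 * N * S)" using NS by simp
      show "norm (of_nat (n q) :: complex) \<le> real (2 * N * S)" if "q < L" for q
        using nR[OF that] unfolding norm_of_nat by (rule of_nat_mono)
      show "F l holomorphic_on UNIV" for l unfolding F_def by (intro holomorphic_intros) (use N in auto)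
      fix l and w :: complex assume l: "l < L" and w: "norm w = 7 * real (2 * N * S)"
      have "norm (w ^ (l mod A)) \<le> real (14 * N * S) ^ A"
      proof -
        have "norm w = real (14 * N * S)" using w by simp
        hence "norm (w ^ (l mod A)) = real (14 * N * S) ^ (l mod A)" by (simp only: norm_power)
        also have "\<dots> \<le> real (14 * N * S) ^ A"
        proof (rule power_increasing)
          have "real 1 \<le> real (14 * N * S)" by (rule of_nat_mono) (use N S in simp)
          thus "1 \<le> real (14 * N * S)" by simp
        qed (use A in \<open>simp add: less_imp_le\<close>)
        finally show ?thesis .
      qed
      \<comment> \<open>The radius is \<open>7\<close> times the bound \<open>2 N S\<close> for the
        nodes; the denominator \<open>N\<close> cancels, and \<open>2 \<pi> * 14 = 28 \<pi>\<close>
        remains.\<close>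
      moreover have "norm (exp (2 * of_real pi * \<i> * of_nat (l div A) * w / of_nat N)) \<le> exp (28 * pi * real (B * S))"
      proof -
        have "norm (exp (2 * of_real pi * \<i> * of_nat (l div A) * w / of_nat N)) \<le> exp (norm (2 * of_real pi * \<i> * of_nat (l div A) * w / of_nat N))"
          by (rule norm_exp)
        also have "norm (2 * of_real pi * \<i> * of_nat (l div A) * w / of_nat N) = 28 * pi * (real (l div A) * real S)"
          using w N by (simp add: norm_mult norm_divide)
        also have "\<dots> \<le> 28 * pi * real (B * S)"
          using div_less[OF l] by (simp add: mult_right_mono)
        finally show ?thesis by simp
      qed
      ultimately show "norm (F l w) \<le> M"
        unfolding F_def M_def norm_mult by (intro mult_mono) auto
    qed
  next
    \<comment> \<open>Different pairs may give the same integer. Then two rows at \<open>z\<close>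
      coincide and the determinant is 0, so injectivity of the nodes can be assumed in the other
      case.\<close>
    case False
    then obtain q q' where q: "q < L" "q' < L" "q \<noteq> q'" "n q = n q'" unfolding inj_on_def by auto
    have "det (mat L L (\<lambda>(q,l). F l (of_nat (n q)))) = 0"
      by (rule Determinant.det_identical_rows[of _ L q q']) (use q in \<open>auto simp: row_def\<close>)
    thus ?thesis unfolding Gz_eq by (simp add: M_def)
  qed
  define H where "H = l ^ (L * B * S) * (1 + \<Lambda>) ^ degree f"
  have l1: "l \<ge> 1" using poly_length_ge_1[of f] f by (simp add: l_def int_minimal_def)
  have "1 \<le> norm (poly (cpoly G) b) * (l ^ degree G * (1 + real_of_int (poly_length G)) ^ degree f)"
    using liouville_inequality[OF f _ Gb] b(1) by (simp add: l_def mult.assoc)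
  also have "\<dots> \<le> norm (poly (cpoly G) b) * H"
    unfolding H_def by (intro mult_left_mono mult_mono power_increasing power_mono)
      (use l1 degG lenG in \<open>auto intro: zero_le_power\<close>)
  finally have low: "1 \<le> norm (poly (cpoly G) b) * H" .
  have H0: "H > 0" using low by (smt (verit) mult_nonneg_nonpos norm_ge_zero)
  have "2 * norm (poly (cpoly G) z) * H \<le> 1"
  proof -
    have "2 * norm (poly (cpoly G) z) * H \<le> 2 * ((2 * real L * M) ^ L / 3 ^ (\<Sum>{..<L})) * H"
      using Gz H0 by (intro mult_right_mono mult_left_mono) auto
    also have "\<dots> = (2 * (2 * real L * M) ^ L * H) / 3 ^ (\<Sum>{..<L})" by simp
    also have "\<dots> \<le> 1" using key by (simp add: H_def)
    finally show ?thesis .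
  qed
  moreover have "norm (poly (cpoly G) b) \<le> norm (poly (cpoly G) z) + norm (b - z) * (real (L * B * S) * \<Lambda>)"
  proof -
    have "norm (poly (cpoly G) b - poly (cpoly G) z) \<le> norm (b - z) * (real (degree G) * of_int (poly_length G))"
      by (rule norm_cpoly_diff_le) (use b znorm in auto)
    also have "\<dots> \<le> norm (b - z) * (real (L * B * S) * \<Lambda>)"
      using degG lenG by (intro mult_left_mono mult_mono) (auto simp del: of_nat_mult)
    finally show ?thesis using norm_triangle_ineq2[of "poly (cpoly G) b" "poly (cpoly G) z"] by linarith
  qed
  ultimately have "2 \<le> 1 + 2 * (norm (b - z) * (real (L * B * S) * \<Lambda>)) * H"
    using low H0 mult_right_mono[of "norm (poly (cpoly G) b)" "norm (poly (cpoly G) z) + norm (b - z) * (real (L * B * S) * \<Lambda>)" H]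
    by (simp add: algebra_simps)
  thus ?thesis by (simp add: H_def mult_ac)
qed

lemma int_minimal_exists:
  assumes "f \<noteq> 0" "poly (cpoly f) b = 0"
  obtains g where "int_minimal g b"
proof -
  define P where "P = (\<lambda>n. \<exists>g. g \<noteq> 0 \<and> poly (cpoly g) b = 0 \<and> degree g = n)"
  have "P (degree f)" using assms by (auto simp: P_def)
  hence "P (LEAST n. P n)" by (rule LeastI)
  then obtain g where g: "g \<noteq> 0" "poly (cpoly g) b = 0" "degree g = (LEAST n. P n)"
    unfolding P_def by blast
  have "h = 0" if "poly (cpoly h) b = 0" "degree h < degree g" for h
    using that not_less_Least[of "degree h" P] g(3) by (auto simp: P_def)
  hence "int_minimal g b" using g(1,2) unfolding int_minimal_def by blast
  thus ?thesis by (rule that)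
qed

lemma eventually_le_if_ratio_tendsto_0:
  fixes g h :: "nat \<Rightarrow> real"
  assumes "(\<lambda>n. g n / h n) \<longlonglongrightarrow> 0" "eventually (\<lambda>n. h n > 0) sequentially"
  shows "eventually (\<lambda>n. C * g n \<le> h n) sequentially"
proof -
  have "(\<lambda>n. C * (g n / h n)) \<longlonglongrightarrow> 0" using tendsto_mult_right_zero[OF assms(1)] .
  hence "eventually (\<lambda>n. C * (g n / h n) < 1) sequentially" by (rule order_tendstoD) simp
  with assms(2) show ?thesis by eventually_elim (simp add: field_simps)
qed

text \<open>The parameters are \<open>B\<close> about \<open>16 (D + 1) log N\<close>, then
  \<open>S = e B\<close>, \<open>A = c S\<close> and \<open>L = A B\<close>. The interpolation gain
  is about \<open>L^2 / 2\<close>. The powers of \<open>N\<close> cost at most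
  \<open>L^2 / 4\<close> by the size of \<open>B\<close>, and the exponentials together with the
  length of \<open>f\<close> cost at most \<open>L^2 / 8\<close> by the size of \<open>c\<close>.
  Since \<open>A\<close>, \<open>B\<close> and \<open>S\<close> are all of order
  \<open>log N\<close>, the loss in the final bound, governed by \<open>L B S\<close> and
  \<open>L A log N\<close>, is of order \<open>(log N)^4\<close>.\<close>

lemma gelfond_bound:
  fixes b :: complex
  assumes alg: "f0 \<noteq> 0" "poly (cpoly f0) b = 0" and b: "norm b = 1" "\<And>n. n > 0 \<Longrightarrow> b ^ n \<noteq> 1"
  shows "\<exists>C N0. \<forall>N\<ge>N0. \<forall>k<N. coprime k N \<longrightarrow>
           exp (- C * ln (real N) ^ 4) \<le> norm (b - cis (2 * pi * real k / real N))"
proof -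
  obtain f where f: "int_minimal f b" using int_minimal_exists[OF alg] by blast
  define D where "D = degree f"
  define l where "l = real_of_int (poly_length f)"
  have l1: "l \<ge> 1" using poly_length_ge_1[of f] f by (simp add: l_def int_minimal_def)
  \<comment> \<open>Here 88 exceeds \<open>28 \<pi>\<close>, the constant in the exponential growth,
    and \<open>ln l\<close> comes from the power of the length in Liouville's inequality. As
    \<open>L = c B S\<close>, this choice makes their total at most \<open>L / 8\<close>.\<close>
  define c where "c = nat \<lceil>8 * (88 + ln l)\<rceil>"
  have c: "8 * (88 + ln l) \<le> real c" unfolding c_def by linarith
  have "1 \<le> 8 * (88 + ln l)" using ln_ge_zero[OF l1] by simp
  hence "1 \<le> real c" using c by (rule order_trans)
  hence c1: "c \<ge> 1" by simp
  \<comment> \<open>With \<open>S = (c + 2) B\<close> the condition of the zero estimate becomes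
    \<open>c (c + 2) \<le> (c + 1)^2\<close>.\<close>
  define e where "e = c + 2"
  define c2 where "c2 = 17 * (real D + 1)"
  define K where "K = 1 + real c * (real e)\<^sup>2 * c2 ^ 4 * (1 + ln l) + 4 * (real D + 1) * (real c * real e)\<^sup>2 * c2 ^ 3"
  have "eventually (\<lambda>N::nat. ln (real N) \<ge> 1) at_top" by real_asymp
  \<comment> \<open>These two conditions yield \<open>14 S \<le> N\<close> and
    \<open>2 L \<le> N^2\<close>, so that the bases \<open>14 N S\<close> and \<open>2 L\<close> can
    both be replaced by \<open>N^2\<close>. The constant \<open>c2\<close> bounds
    \<open>B / log N\<close>, its 17 absorbing the rounding of 16.\<close>
  moreover have "eventually (\<lambda>N::nat. (14 * real e * c2) * ln (real N) \<le> real N) at_top"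
    by (rule eventually_le_if_ratio_tendsto_0; real_asymp)
  moreover have "eventually (\<lambda>N::nat. (2 * real c * real e * c2\<^sup>2) * (ln (real N))\<^sup>2 \<le> (real N)\<^sup>2) at_top"
    by (rule eventually_le_if_ratio_tendsto_0; real_asymp)
  ultimately have "eventually (\<lambda>N::nat. ln (real N) \<ge> 1 \<and> (14 * real e * c2) * ln (real N) \<le> real N \<and>
      (2 * real c * real e * c2\<^sup>2) * (ln (real N))\<^sup>2 \<le> (real N)\<^sup>2) at_top"
    by (intro eventually_conj)
  then obtain N0 where N0: "\<And>N. N \<ge> N0 \<Longrightarrow> ln (real N) \<ge> 1 \<and> (14 * real e * c2) * ln (real N) \<le> real N \<and>
      (2 * real c * real e * c2\<^sup>2) * (ln (real N))\<^sup>2 \<le> (real N)\<^sup>2"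
    unfolding eventually_at_top_linorder by blast
  show ?thesis
  proof (intro exI allI impI)
    fix N k :: nat assume N: "N \<ge> N0" and k: "k < N" "coprime k N"
    define x where "x = ln (real N)"
    have x: "x \<ge> 1" "(14 * real e * c2) * x \<le> real N" "(2 * real c * real e * c2\<^sup>2) * x\<^sup>2 \<le> (real N)\<^sup>2"
      using N0[OF N] by (auto simp: x_def)
    have Nx: "real N = exp x" using k by (simp add: x_def)
    define B where "B = nat \<lceil>16 * (real D + 1) * x\<rceil>"
    have B1: "16 * (real D + 1) * x \<le> real B" unfolding B_def by linarith
    have B2: "real B \<le> c2 * x"
    proof -
      have "16 * (real D + 1) * x \<ge> 0" using x by simp
      hence "real B \<le> 16 * (real D + 1) * x + 1" unfolding B_def by linarith
      moreover have "1 \<le> (real D + 1) * x" using x mult_mono[of 1 "real D + 1" 1 x] by simp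
      ultimately show ?thesis by (simp add: c2_def algebra_simps)
    qed
    have B16: "real B \<ge> 16"
    proof -
      have "1 \<le> (real D + 1) * x" using x mult_mono[of 1 "real D + 1" 1 x] by simp
      moreover have "16 * (real D + 1) * x = 16 * ((real D + 1) * x)" by simp
      ultimately show ?thesis using B1 by linarith
    qed
    define S where "S = e * B"
    define A where "A = c * S"
    define L where "L = A * B"
    have SN: "14 * S \<le> N"
    proof -
      have "real (14 * S) = 14 * real e * real B" by (simp add: S_def)
      also have "\<dots> \<le> 14 * real e * (c2 * x)" using B2 by (intro mult_left_mono) auto
      also have "\<dots> \<le> real N" using x(2) by (simp add: mult_ac)
      finally show ?thesis by (simp only: of_nat_le_iff)
    qed
    have LN: "real (2 * L) \<le> (real N)\<^sup>2"
    proof -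
      have "real (2 * L) = 2 * real c * real e * (real B)\<^sup>2"
        by (simp add: L_def A_def S_def power2_eq_square)
      also have "\<dots> \<le> 2 * real c * real e * (c2 * x)\<^sup>2" using B2 by (intro mult_left_mono power_mono) auto
      also have "\<dots> \<le> (real N)\<^sup>2" using x(3) by (simp add: power_mult_distrib mult_ac)
      finally show ?thesis .
    qed
    have AB: "A * B \<le> (S - B) * (S - B)"
    proof -
      have "S - B = (c + 1) * B" by (simp add: S_def e_def algebra_simps)
      hence "(S - B) * (S - B) = (c + 1) * (c + 1) * (B * B)" by (simp add: algebra_simps)
      moreover have "A * B = c * (c + 2) * (B * B)" by (simp add: A_def S_def e_def algebra_simps)
      moreover have "c * (c + 2) \<le> (c + 1) * (c + 1)" by simp
      ultimately show ?thesis by (metis mult_le_mono1)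
    qed
    have pos: "0 < B" "0 < S" "0 < A" "0 < L" using B16 c1 by (auto simp: S_def A_def L_def e_def)
    have "12 \<le> real L"
    proof -
      have "B \<le> L" using pos by (simp add: L_def)
      thus ?thesis using B16 by linarith
    qed
    define \<Lambda> where "\<Lambda> = (real L * real (2 * N * S) ^ A) ^ L"
    define M where "M = real (14 * N * S) ^ A * exp (28 * pi * real (B * S))"
    have N2: "(real N)\<^sup>2 = exp (2 * x)" unfolding Nx by (simp flip: exp_of_nat_mult)
    have powA: "real (14 * N * S) ^ A \<le> exp (real A * (2 * x))" 
    proof -
      have "real (14 * N * S) = real N * real (14 * S)" by simp
      also have "\<dots> \<le> real N * real N" using SN by (intro mult_left_mono of_nat_mono) auto
      also have "\<dots> = exp (2 * x)" unfolding N2[symmetric] by (simp add: power2_eq_square)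
      finally have "real (14 * N * S) ^ A \<le> exp (2 * x) ^ A" by (intro power_mono) auto
      thus ?thesis by (simp flip: exp_of_nat_mult)
    qed
    have powA': "real (2 * N * S) ^ A \<le> exp (real A * (2 * x))"
    proof -
      have "real (2 * N * S) ^ A \<le> real (14 * N * S) ^ A" by (intro power_mono of_nat_mono) auto
      thus ?thesis using powA by linarith
    qed
    have Ax: "2 * x + real A * (2 * x) \<le> 4 * real A * x"
    proof -
      have "2 * x * 1 \<le> 2 * x * real A" using pos x by (intro mult_left_mono) auto
      thus ?thesis by (simp add: algebra_simps)
    qed
    have LM: "2 * real L * M \<le> exp (4 * real A * x + 88 * real (B * S))"
    proof -
      have "2 * real L * M \<le> exp (2 * x) * (exp (real A * (2 * x)) * exp (88 * real (B * S)))"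
        unfolding M_def using LN powA pi_less_4
      proof (intro mult_mono)
        have "28 * pi \<le> 88" using pi_approx(2) by simp
        thus "exp (28 * pi * real (B * S)) \<le> exp (88 * real (B * S))"
          by (simp add: mult_right_mono)
      qed (auto simp: N2)
      also have "\<dots> = exp ((2 * x + real A * (2 * x)) + 88 * real (B * S))" by (simp add: exp_add)
      finally show ?thesis using Ax by (smt (verit) exp_le_cancel_iff)
    qed
    have L1: "1 + \<Lambda> \<le> exp (real L * (4 * real A * x))"
    proof -
      have "1 \<le> real L * real (2 * N * S) ^ A"
        using pos k by (intro mult_ge1_I one_le_power) (auto simp: Suc_leI simp del: of_nat_mult)
      hence "1 \<le> \<Lambda>" unfolding \<Lambda>_def by (rule one_le_power)
      hence "1 + \<Lambda> \<le> 2 * \<Lambda>" by simp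
      also have "\<dots> \<le> 2 ^ L * \<Lambda>" using pos \<open>1 \<le> \<Lambda>\<close> self_le_power[of "2::real" L] by (intro mult_right_mono) auto
      also have "\<dots> = (real (2 * L) * real (2 * N * S) ^ A) ^ L" by (simp add: \<Lambda>_def flip: power_mult_distrib mult.assoc)
      also have "\<dots> \<le> (exp (2 * x) * exp (real A * (2 * x))) ^ L"
        using LN powA' by (intro power_mono mult_mono) (auto simp: N2)
      also have "\<dots> = exp (real L * (2 * x + real A * (2 * x)))" by (simp flip: exp_of_nat_mult exp_add)
      also have "\<dots> \<le> exp (real L * (4 * real A * x))" using Ax by (simp add: mult_left_mono)
      finally show ?thesis .
    qed
    have L0: "0 \<le> \<Lambda>" by (simp add: \<Lambda>_def)
    have M0: "0 \<le> M" by (simp add: M_def)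
    have lpow: "l ^ (L * B * S) = exp (real (L * B * S) * ln l)"
      using l1 by (simp add: exp_of_nat_mult del: of_nat_mult)
    have H: "l ^ (L * B * S) * (1 + \<Lambda>) ^ D \<le> exp (real (L * B * S) * ln l + real D * (real L * (4 * real A * x)))"
    proof -
      have "(1 + \<Lambda>) ^ D \<le> exp (real L * (4 * real A * x)) ^ D" using L1 L0 by (intro power_mono) auto
      also have "\<dots> = exp (real D * (real L * (4 * real A * x)))" by (simp flip: exp_of_nat_mult)
      finally show ?thesis unfolding lpow exp_add by (intro mult_left_mono) auto
    qed
    have sumL: "real (\<Sum>{..<n}) = real n * (real n - 1) / 2" for n
      by (induction n) (auto simp: field_simps)
    have key: "2 * (2 * real L * M) ^ L * (l ^ (L * B * S) * (1 + \<Lambda>) ^ D) \<le> 3 ^ (\<Sum>{..<L})"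
    proof -
      have "(2 * real L * M) ^ L \<le> exp (4 * real A * x + 88 * real (B * S)) ^ L"
        using LM M0 by (intro power_mono) auto
      hence "2 * (2 * real L * M) ^ L * (l ^ (L * B * S) * (1 + \<Lambda>) ^ D) \<le> 
        exp (real L) * exp (real L * (4 * real A * x + 88 * real (B * S))) *
         exp (real (L * B * S) * ln l + real D * (real L * (4 * real A * x)))"
      proof (intro mult_mono H)
        have "2 \<le> 1 + real L" using pos by simp
        thus "2 \<le> exp (real L)" using exp_ge_add_one_self[of "real L"] by linarith
      qed (use M0 L0 l1 in \<open>auto simp flip: exp_of_nat_mult\<close>)
      also have "\<dots> = exp (real L * (1 + (real D + 1) * (4 * real A * x) + real (B * S) * (88 + ln l)))"
        by (simp flip: exp_add) (simp add: algebra_simps)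
      also have "\<dots> \<le> exp (real L * ((real L - 1) / 2))"
      proof -
        have "real A * (16 * (real D + 1) * x) \<le> real A * real B" using B1 by (intro mult_left_mono) auto
        hence 1: "(real D + 1) * (4 * real A * x) \<le> real L / 4" by (simp add: L_def algebra_simps)
        have "real (B * S) * (8 * (88 + ln l)) \<le> real (B * S) * real c" using c by (intro mult_left_mono) auto
        hence 2: "real (B * S) * (88 + ln l) \<le> real L / 8" by (simp add: L_def A_def algebra_simps)
        have "1 + (real D + 1) * (4 * real A * x) + real (B * S) * (88 + ln l) \<le> (real L - 1) / 2"
        proof -
          \<comment> \<open>The parts \<open>1/4\<close> and \<open>1/8\<close> leave a margin of
            \<open>t / 8\<close>, which covers the constant \<open>3/2\<close> from
            \<open>t = 12\<close> on.\<close>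
          have aux: "1 + p + q \<le> (t - 1) / 2" if "p \<le> t / 4" "q \<le> t / 8" "12 \<le> t" for p q t :: real
            using that by (simp add: field_simps)
          show ?thesis using aux[OF 1 2 \<open>12 \<le> real L\<close>] .
        qed
        thus ?thesis unfolding exp_le_cancel_iff by (rule mult_left_mono) simp
      qed
      also have "\<dots> = exp (real (\<Sum>{..<L}) * 1)" unfolding sumL by simp
      also have "\<dots> = exp 1 ^ (\<Sum>{..<L})" by (rule exp_of_nat_mult)
      also have "\<dots> \<le> 3 ^ (\<Sum>{..<L})" using exp_le by (intro power_mono) auto
      finally show ?thesis .
    qed
    have "B \<le> S" "S \<le> N" using SN by (auto simp: S_def e_def)
    hence "1 \<le> norm (b - cis (2 * pi * real k / real N)) * (2 * real (L * B * S) * \<Lambda> * (l ^ (L * B * S) * (1 + \<Lambda>) ^ D))"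
      using gelfond_core[OF f b k(2,1) pos(2) _ _ AB] key pos(4)
      unfolding L_def[symmetric] l_def[symmetric] \<Lambda>_def[symmetric] M_def[symmetric] D_def[symmetric] by blast
    also have "\<dots> \<le> norm (b - cis (2 * pi * real k / real N)) * exp (K * x ^ 4)"
    proof (rule mult_left_mono)
      have "2 * real (L * B * S) * \<Lambda> * (l ^ (L * B * S) * (1 + \<Lambda>) ^ D) \<le> exp 1 * exp (real (L * B * S)) * exp (real L * (4 * real A * x)) *
          exp (real (L * B * S) * ln l + real D * (real L * (4 * real A * x)))"
      proof (intro mult_mono H)
        show "real (L * B * S) \<le> exp (real (L * B * S))" using exp_ge_add_one_self[of "real (L * B * S)"] by linarith
        show "2 \<le> exp (1::real)" using exp_ge_add_one_self[of "1::real"] by linarith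
      qed (use L0 L1 l1 in auto)
      also have "\<dots> = exp (1 + real (L * B * S) * (1 + ln l) + 4 * (real D + 1) * (real L * real A * x))"
        by (simp flip: exp_add) (simp add: algebra_simps)
      also have "\<dots> \<le> exp (K * x ^ 4)"
      proof -
        have B0: "0 \<le> real B" by simp
        have c20: "0 \<le> c2" by (simp add: c2_def)
        have "real (L * B * S) = real c * (real e)\<^sup>2 * real B ^ 4"
          by (simp add: L_def A_def S_def power2_eq_square power4_eq_xxxx)
        also have "\<dots> \<le> real c * (real e)\<^sup>2 * (c2 * x) ^ 4" using B2 by (intro mult_left_mono power_mono) auto
        finally have 1: "real (L * B * S) * (1 + ln l) \<le> real c * (real e)\<^sup>2 * (c2 * x) ^ 4 * (1 + ln l)"
          using l1 by (intro mult_right_mono) auto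
        have "real L * real A * x = (real c * real e)\<^sup>2 * real B ^ 3 * x"
          by (simp add: L_def A_def S_def power2_eq_square power3_eq_cube)
        also have "\<dots> \<le> (real c * real e)\<^sup>2 * (c2 * x) ^ 3 * x"
          using B2 x by (intro mult_right_mono mult_left_mono power_mono) auto
        finally have 2: "4 * (real D + 1) * (real L * real A * x) \<le> 4 * (real D + 1) * ((real c * real e)\<^sup>2 * (c2 * x) ^ 3 * x)"
          by (intro mult_left_mono) auto
        have 3: "1 \<le> x ^ 4" using x by (intro one_le_power) auto
        have eqK: "K * x ^ 4 = x ^ 4 + real c * (real e)\<^sup>2 * (c2 * x) ^ 4 * (1 + ln l) + 
            4 * (real D + 1) * ((real c * real e)\<^sup>2 * (c2 * x) ^ 3 * x)"
          by (simp add: K_def power_mult_distrib algebra_simps eval_nat_numeral)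
        show ?thesis unfolding exp_le_cancel_iff eqK by (intro add_mono 1 2 3)
      qed
      finally show "2 * real (L * B * S) * \<Lambda> * (l ^ (L * B * S) * (1 + \<Lambda>) ^ D) \<le> exp (K * x ^ 4)" .
    qed simp
    finally show "exp (- K * ln (real N) ^ 4) \<le> norm (b - cis (2 * pi * real k / real N))"
      unfolding x_def[symmetric] by (simp add: exp_minus field_simps)
  qed
qed

subsection \<open>Averages over Galois orbits of roots of unity\<close>

lemma power_mod_eq:
  fixes x :: "'a :: monoid_mult"
  assumes "x ^ N = 1"
  shows "x ^ (a mod N) = x ^ a"
proof -
  have "x ^ a = x ^ (N * (a div N) + a mod N)" by simp
  thus ?thesis by (simp only: power_add power_mult assms power_one mult_1)
qed

lemma cis_root_of_unity: "N > 0 \<Longrightarrow> cis (2 * pi / real N) ^ N = 1"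
  using Complex.DeMoivre[of "2 * pi / real N" N] by simp

lemma parseval_roots_of_unity:
  fixes N :: nat and H :: "nat set"
  assumes N: "N > 0" and H: "H \<subseteq> {..<N}" and z: "z = cis (2 * pi / real N)"
  shows "(\<Sum>j<N. (norm (\<Sum>h\<in>H. z ^ (h * j)))\<^sup>2) = real N * real (card H)"
proof -
  have fin: "finite H" using H finite_subset by blast
  have zN: "z ^ N = 1" unfolding z by (rule cis_root_of_unity[OF N])
  have z0: "z \<noteq> 0" by (simp add: z)
  have nz: "norm z = 1" by (simp add: z)
  have inj: "z ^ a \<noteq> z ^ b" if "a < b" "b < N" for a b
  proof
    assume "z ^ a = z ^ b"
    moreover have "bij_betw (\<lambda>k. cis (2 * pi * real k / real N)) {..<N} {z. z ^ N = 1}"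
      using N by (rule Complex.bij_betw_roots_unity)
    moreover have "cis (2 * pi * real k / real N) = z ^ k" for k
      using Complex.DeMoivre[of "2 * pi / real N" k] by (simp add: z field_simps)
    ultimately show False using that by (auto simp: bij_betw_def inj_on_def)
  qed
  have orth: "(\<Sum>j<N. z ^ (h * j) * cnj (z ^ (h' * j))) = (if h = h' then of_nat N else 0)"
    if "h \<in> H" "h' \<in> H" for h h'
  proof -
    define w where "w = z ^ h * cnj (z ^ h')"
    have "(\<Sum>j<N. z ^ (h * j) * cnj (z ^ (h' * j))) = (\<Sum>j<N. w ^ j)"
      unfolding w_def by (intro sum.cong) (auto simp: power_mult power_mult_distrib)
    also have "\<dots> = (if h = h' then of_nat N else 0)"
    proof (cases "h = h'")
      case True
      have "w = 1" unfolding w_def True complex_norm_square[symmetric] using nz by (simp add: norm_power)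
      thus ?thesis using True by simp
    next
      case False
      have "w \<noteq> 1"
      proof
        assume w1: "w = 1"
        have "cnj (z ^ h') * z ^ h' = 1"
          using complex_norm_square[of "z ^ h'"] nz by (simp add: norm_power mult.commute)
        hence "z ^ h = z ^ h * (cnj (z ^ h') * z ^ h')" by (simp only: mult_1_right)
        also have "\<dots> = w * z ^ h'" by (simp only: w_def mult.assoc)
        finally have "z ^ h = z ^ h'" by (simp add: w1)
        thus False using inj[of h h'] inj[of h' h] False that H by (metis in_mono lessThan_iff nat_neq_iff)
      qed
      moreover have "w ^ N = 1"
      proof -
        have "w ^ N = (z ^ N) ^ h * (cnj (z ^ N)) ^ h'"
          by (simp add: w_def power_mult_distrib mult.commute flip: power_mult)
        thus ?thesis by (simp add: zN)
      qed
      ultimately show ?thesis using False by (simp add: geometric_sum)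
    qed
    finally show ?thesis .
  qed
  have "complex_of_real (\<Sum>j<N. (norm (\<Sum>h\<in>H. z ^ (h * j)))\<^sup>2) =
     (\<Sum>j<N. (\<Sum>h\<in>H. z ^ (h * j)) * cnj (\<Sum>h\<in>H. z ^ (h * j)))"
    by (simp only: of_real_sum complex_norm_square)
  also have "\<dots> = (\<Sum>j<N. \<Sum>h\<in>H. \<Sum>h'\<in>H. z ^ (h * j) * cnj (z ^ (h' * j)))"
    by (simp only: cnj_sum sum_product)
  also have "\<dots> = (\<Sum>h\<in>H. \<Sum>h'\<in>H. \<Sum>j<N. z ^ (h * j) * cnj (z ^ (h' * j)))"
    by (subst sum.swap, rule sum.cong[OF refl], rule sum.swap)
  also have "\<dots> = (\<Sum>h\<in>H. \<Sum>h'\<in>H. if h = h' then of_nat N else 0)"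
    by (intro sum.cong refl orth)
  also have "\<dots> = of_nat N * of_nat (card H)" using fin by simp
  finally have "complex_of_real (\<Sum>j<N. (norm (\<Sum>h\<in>H. z ^ (h * j)))\<^sup>2) = complex_of_real (real N * real (card H))"
    by simp
  thus ?thesis by (simp only: of_real_eq_iff)
qed

text \<open>
  The power sum \<open>S k\<close> is unchanged when \<open>k\<close> is multiplied by a quotient of two elements of \<open>H\<close>, so that
  \<open>|S k|\<^sup>2\<close> occurs about \<open>card H / k\<close> times in Parseval's identity.
\<close>

lemma weyl_sum_bound:
  fixes N :: nat and H :: "nat set"
  assumes N: "N > 0" and H: "H \<subseteq> {..<N}" "H \<noteq> {}" and cop: "\<And>h. h \<in> H \<Longrightarrow> coprime h N"
    and closed: "\<And>a b c n. a \<in> H \<Longrightarrow> b \<in> H \<Longrightarrow> c \<in> H \<Longrightarrow> [a * n = b] (mod N) \<Longrightarrow> c * n mod N \<in> H"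
    and k: "k > 0"
  defines "z \<equiv> cis (2 * pi / real N)"
  shows "norm (\<Sum>h\<in>H. (z ^ h) ^ k) \<le> sqrt (real k * real N)"
proof -
  have fin: "finite H" using H finite_subset by blast
  have zN: "z ^ N = 1" unfolding z_def by (rule cis_root_of_unity[OF N])
  define S where "S = (\<lambda>j. \<Sum>h\<in>H. z ^ (h * j))"
  note zmod = power_mod_eq[OF zN]
  have Smod: "S (j mod N) = S j" for j
  proof -
    have "z ^ (h * (j mod N)) = z ^ (h * j)" for h
      by (metis mod_mult_right_eq zmod)
    thus ?thesis by (simp add: S_def)
  qed
  obtain a0 where a0: "a0 \<in> H" using H by blast
  have "\<exists>n<N. [a0 * n = b] (mod N)" for b
  proof -
    obtain i where i: "[a0 * i = 1] (mod N)"
      using cop[OF a0] by (metis cong_solve_coprime_nat One_nat_def)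
    have "[a0 * (i * b mod N) = b] (mod N)"
      using cong_scalar_right[OF i, of b] by (simp add: cong_def mod_mult_right_eq mult.assoc)
    thus ?thesis using N by (intro exI[of _ "i * b mod N"]) auto
  qed
  \<comment> \<open>Thus \<open>\<nu> b\<close> represents the quotient \<open>b / a0\<close> modulo
    \<open>N\<close>; as \<open>b\<close> runs through \<open>H\<close> these quotients run through
    the subgroup of which \<open>H\<close> is a coset.\<close>
  then obtain \<nu> where \<nu>: "\<And>b. \<nu> b < N" "\<And>b. [a0 * \<nu> b = b] (mod N)" by metis
  have Sinv: "S (k * \<nu> b) = S k" if b: "b \<in> H" for b
  proof -
    define h where "h = \<nu> b"
    have ch: "coprime h N"
    proof -
      have "coprime (a0 * h) N" using cop[OF b] cong_imp_coprime[OF cong_sym[OF \<nu>(2)[of b]]] by (simp add: h_def)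
      thus ?thesis by simp
    qed
    have inj: "inj_on (\<lambda>g. g * h mod N) H"
    proof (rule inj_onI)
      fix a b assume ab: "a \<in> H" "b \<in> H" "a * h mod N = b * h mod N"
      hence "[a = b] (mod N)" using ch by (simp add: cong_def[symmetric] cong_mult_rcancel_nat)
      thus "a = b" using ab H by (auto intro: cong_less_modulus_unique_nat)
    qed
    have im: "(\<lambda>g. g * h mod N) ` H = H"
      by (rule endo_inj_surj[OF fin _ inj]) (use closed[OF a0 b _ \<nu>(2)] in \<open>auto simp: h_def\<close>)
    have "S k = (\<Sum>g\<in>(\<lambda>g. g * h mod N) ` H. z ^ (g * k))" by (simp add: S_def im)
    also have "\<dots> = (\<Sum>g\<in>H. z ^ ((g * h mod N) * k))" by (subst sum.reindex[OF inj]) simp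
    also have "\<dots> = S (k * h)" unfolding S_def
    proof (rule sum.cong)
      fix g
      have "z ^ ((g * h mod N) * k) = z ^ (g * h * k)" by (simp only: power_mult zmod)
      thus "z ^ ((g * h mod N) * k) = z ^ (g * (k * h))" by (simp add: mult_ac)
    qed simp
    finally show ?thesis by (simp add: h_def)
  qed
  have inj\<nu>: "inj_on \<nu> H"
  proof (rule inj_onI)
    fix a b assume ab: "a \<in> H" "b \<in> H" "\<nu> a = \<nu> b"
    hence "[a = b] (mod N)" using \<nu>(2)[of a] \<nu>(2)[of b] by (metis cong_sym cong_trans)
    thus "a = b" using ab H by (auto intro: cong_less_modulus_unique_nat)
  qed
  define G where "G = \<nu> ` H"
  have G: "G \<subseteq> {..<N}" "card G = card H" using \<nu>(1) card_image[OF inj\<nu>] by (auto simp: G_def)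
  \<comment> \<open>Several multipliers \<open>h\<close> may give the same residue of
    \<open>k h\<close>. Recording the quotient of \<open>k h\<close> by \<open>N\<close>, which is
    less than \<open>k\<close>, separates them: each residue is counted at most \<open>k\<close>
    times.\<close>
  define g where "g = (\<lambda>h. (k * h mod N, k * h div N))"
  have injg: "inj_on g G"
  proof (rule inj_onI)
    fix a b assume "a \<in> G" "b \<in> G" "g a = g b"
    hence "k * a = k * b" unfolding g_def by (metis Pair_inject div_mult_mod_eq)
    thus "a = b" using k by simp
  qed
  have gsub: "g ` G \<subseteq> {..<N} \<times> {..<k}"
  proof (rule image_subsetI)
    fix h assume "h \<in> G"
    hence "k * h < k * N" using G k by auto
    hence "k * h div N < k" by (simp add: less_mult_imp_div_less)
    thus "g h \<in> {..<N} \<times> {..<k}" using N by (simp add: g_def)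
  qed
  have "real (card H) * (norm (S k))\<^sup>2 = (\<Sum>h\<in>G. (norm (S (k * h)))\<^sup>2)"
    unfolding G_def sum.reindex[OF inj\<nu>] using Sinv by simp
  also have "\<dots> = (\<Sum>h\<in>G. (norm (S (fst (g h))))\<^sup>2)" by (simp add: g_def Smod)
  also have "\<dots> = (\<Sum>p\<in>g ` G. (norm (S (fst p)))\<^sup>2)" by (simp add: sum.reindex[OF injg])
  also have "\<dots> \<le> (\<Sum>p\<in>{..<N} \<times> {..<k}. (norm (S (fst p)))\<^sup>2)"
    by (rule sum_mono2[OF _ gsub]) auto
  also have "\<dots> = (\<Sum>j<N. \<Sum>q<k. (norm (S j))\<^sup>2)"
    by (simp only: sum.cartesian_product case_prod_unfold fst_conv)
  also have "\<dots> = real k * (\<Sum>j<N. (norm (S j))\<^sup>2)" by (simp add: sum_distrib_left)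
  also have "\<dots> = real k * (real N * real (card H))"
    unfolding S_def using parseval_roots_of_unity[OF N H(1) z_def[THEN meta_eq_to_obj_eq]] by simp
  finally have "real (card H) * (norm (S k))\<^sup>2 \<le> real (card H) * (real k * real N)" by (simp add: mult_ac)
  moreover have "card H > 0" using H fin by (simp add: card_gt_0_iff)
  ultimately have "(norm (S k))\<^sup>2 \<le> real k * real N" by simp
  hence "norm (S k) \<le> sqrt (real k * real N)" by (rule real_le_rsqrt)
  thus ?thesis by (simp add: S_def power_mult)
qed

text \<open>Removing the largest element gives a telescoping product: the largest of
  \<open>n + 1\<close> distinct integers that are at least 2 is at least
  \<open>n + 2\<close>.\<close>

lemma prod_one_minus_inverse_ge:
  assumes "finite A" "\<And>p. p \<in> A \<Longrightarrow> p \<ge> (2::nat)"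
  shows "(\<Prod>p\<in>A. 1 - 1 / real p) \<ge> 1 / (real (card A) + 1)"
  using assms
proof (induction "card A" arbitrary: A)
  case 0
  then show ?case by simp
next
  case (Suc n)
  define m where "m = Max A"
  have ne: "A \<noteq> {}" using Suc by auto
  have m: "m \<in> A" unfolding m_def using Suc ne by (intro Max_in) auto
  have cA: "card (A - {m}) = n" using Suc m by simp
  have "A \<subseteq> {2..m}" using Suc by (auto simp: m_def)
  hence "card A \<le> card {2..m}" by (rule card_mono[rotated]) simp
  hence mn: "m \<ge> n + 2" using Suc(2) by simp
  have IH: "(\<Prod>p\<in>A-{m}. 1 - 1 / real p) \<ge> 1 / (real n + 1)"
    using Suc(1)[of "A - {m}"] cA Suc by auto
  have "(\<Prod>p\<in>A. 1 - 1 / real p) = (1 - 1 / real m) * (\<Prod>p\<in>A-{m}. 1 - 1 / real p)"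
    using Suc m by (simp add: prod.remove)
  also have "\<dots> \<ge> (1 - 1 / (real n + 2)) * (1 / (real n + 1))"
  proof (rule mult_mono[OF _ IH])
    show "1 - 1 / (real n + 2) \<le> 1 - 1 / real m" using mn by (simp add: frac_le)
    show "0 \<le> 1 - 1 / real m" using mn by simp
  qed simp
  also have "(1 - 1 / (real n + 2)) * (1 / (real n + 1)) = 1 / (real (card A) + 1)"
    unfolding Suc(2)[symmetric] by (simp add: divide_simps) (simp add: algebra_simps)
  finally show ?case .
qed

text \<open>The prime factors multiply to at most \<open>N\<close> and are at least 2, so there are
  at most \<open>log 2 N\<close> of them. The logarithmic loss is harmless, since all error terms
  are of order at most \<open>N^(3/4)\<close> up to logarithms.\<close>

lemma totient_ge:
  assumes "N > 0"
  shows "real (totient N) \<ge> real N / (log 2 (real N) + 1)"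
proof -
  define A where "A = prime_factors N"
  have fin: "finite A" and p2: "p \<ge> 2" if "p \<in> A" for p
    using that by (auto simp: A_def in_prime_factors_iff prime_ge_2_nat)
  have finA: "finite A" by (simp add: A_def)
  have "2 ^ card A = (\<Prod>p\<in>A. 2::nat)" by simp
  also have "\<dots> \<le> (\<Prod>p\<in>A. p)" using p2 by (intro prod_mono) auto
  also have "\<dots> \<le> N"
  proof (rule dvd_imp_le[OF _ assms])
    have "(\<Prod>p\<in>A. p) dvd (\<Prod>p\<in>A. p ^ multiplicity p N)"
      by (intro prod_dvd_prod dvd_power) (auto simp: A_def prime_factors_multiplicity)
    also have "\<dots> = N" unfolding A_def using assms by (simp add: prime_factorization_nat[symmetric])
    finally show "(\<Prod>p\<in>A. p) dvd N" .
  qed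
  finally have "2 ^ card A \<le> N" .
  hence "real (card A) \<le> log 2 (real N)"
    using assms by (simp add: le_log_iff powr_realpow)
  hence "real N / (log 2 (real N) + 1) \<le> real N * (1 / (real (card A) + 1))"
    by (simp add: frac_le)
  also have "\<dots> \<le> real N * (\<Prod>p\<in>A. 1 - 1 / real p)"
    using prod_one_minus_inverse_ge[OF finA p2] by (intro mult_left_mono) auto
  also have "\<dots> = real (totient N)" unfolding A_def by (rule totient_formula2[symmetric])
  finally show ?thesis .
qed

text \<open>The last condition says that \<open>H\<close> is a coset of a subgroup of the units modulo \<open>N\<close>.\<close>

definition galois_orbit :: "nat \<Rightarrow> nat set \<Rightarrow> bool" where
  "galois_orbit N H \<longleftrightarrow> N > 0 \<and> H \<subseteq> {..<N} \<and> H \<noteq> {} \<and> (\<forall>h\<in>H. coprime h N) \<and>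
     (\<forall>a\<in>H. \<forall>b\<in>H. \<forall>c\<in>H. \<forall>n. [a * n = b] (mod N) \<longrightarrow> c * n mod N \<in> H)"

abbreviation unity_root :: "nat \<Rightarrow> complex" where "unity_root N \<equiv> cis (2 * pi / real N)"

lemma unity_root_power: "unity_root N ^ h = cis (2 * pi * real h / real N)"
  using Complex.DeMoivre[of "2 * pi / real N" h] by (simp add: field_simps)

text \<open>In the power series of the logarithm the coefficient of \<open>y^n\<close> is a power
  sum over \<open>H\<close>, at most \<open>sqrt (n N)\<close>, divided by \<open>n\<close>. The
  factor \<open>sqrt n / n\<close> is at most 1, and a geometric series remains.\<close>

lemma log_sum_bound:
  assumes H: "galois_orbit N H" and y: "norm y < 1"
  shows "\<bar>\<Sum>h\<in>H. ln (norm (1 - unity_root N ^ h * y))\<bar> \<le> sqrt (real N) / (1 - norm y)"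
proof -
  define z where "z = unity_root N"
  have fin: "finite H" using H finite_subset by (auto simp: galois_orbit_def)
  have zy: "norm (z ^ h * y) < 1" for h using y by (simp add: z_def norm_mult norm_power)
  define t where "t = (\<lambda>n. \<Sum>h\<in>H. (-1) ^ Suc n / of_nat n * (- (z ^ h * y)) ^ n)"
  have sums: "t sums (\<Sum>h\<in>H. Ln (1 + - (z ^ h * y)))"
    unfolding t_def by (rule sums_sum) (rule Ln_series, use zy in simp)
  have t: "norm (t n) \<le> sqrt (real N) * norm y ^ n" for n
  proof (cases "n = 0")
    case False
    have "t n = - (y ^ n / of_nat n) * (\<Sum>h\<in>H. (z ^ h) ^ n)"
      unfolding t_def sum_distrib_left
    proof (rule sum.cong)
      fix h
      have "(-1) ^ Suc n * (- (z ^ h * y)) ^ n = - ((-1) ^ n * (-1) ^ n) * ((z ^ h) ^ n * y ^ n)"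
        by (simp add: power_mult_distrib power_minus[of "z ^ h * y"])
      also have "(-1) ^ n * (-1) ^ n = (1::complex)" by (simp flip: power_mult_distrib)
      finally show "(-1) ^ Suc n / of_nat n * (- (z ^ h * y)) ^ n = - (y ^ n / of_nat n) * (z ^ h) ^ n"
        by (simp add: mult_ac)
    qed simp
    hence "norm (t n) = norm y ^ n / real n * norm (\<Sum>h\<in>H. (z ^ h) ^ n)"
      by (simp add: norm_mult norm_divide norm_power)
    also have "\<dots> \<le> norm y ^ n / real n * sqrt (real n * real N)"
      using H False unfolding z_def by (intro mult_left_mono weyl_sum_bound) (auto simp: galois_orbit_def)
    also have "\<dots> = sqrt (real N) * norm y ^ n * (sqrt (real n) / real n)"
      by (simp add: real_sqrt_mult)
    also have "\<dots> \<le> sqrt (real N) * norm y ^ n * 1"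
    proof (rule mult_left_mono)
      have "sqrt (real n) \<le> real n" using False by (intro real_le_lsqrt) (auto simp: power2_eq_square)
      thus "sqrt (real n) / real n \<le> 1" using False by simp
    qed simp
    finally show ?thesis by simp
  qed (simp add: t_def)
  have geo: "(\<lambda>n. sqrt (real N) * norm y ^ n) sums (sqrt (real N) * (1 / (1 - norm y)))"
    by (intro sums_mult geometric_sums) (use y in simp)
  have "norm (\<Sum>h\<in>H. Ln (1 + - (z ^ h * y))) \<le> sqrt (real N) * (1 / (1 - norm y))"
    unfolding sums_unique[OF sums] sums_unique[OF geo]
    by (rule norm_suminf_le) (use t geo in \<open>auto simp: sums_iff\<close>)
  moreover have "Re (\<Sum>h\<in>H. Ln (1 + - (z ^ h * y))) = (\<Sum>h\<in>H. ln (norm (1 - z ^ h * y)))"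
    unfolding Re_sum
  proof (rule sum.cong)
    fix h
    have "1 - z ^ h * y \<noteq> 0" using zy[of h] by auto
    thus "Re (Ln (1 + - (z ^ h * y))) = ln (norm (1 - z ^ h * y))" by (simp add: Re_Ln)
  qed simp
  ultimately show ?thesis using abs_Re_le_cmod[of "\<Sum>h\<in>H. Ln (1 + - (z ^ h * y))"] by (simp add: z_def)
qed

section \<open>Roots of unity close to a point of the unit circle\<close>

lemma norm_unit_minus:
  assumes "norm u = 1"
  shows "norm (u - y) = norm (1 - u * cnj y)"
proof -
  have "u * cnj u = 1" using complex_norm_square[of u] assms by simp
  hence "1 - u * cnj y = u * cnj (u - y)" by (simp add: algebra_simps)
  thus ?thesis using assms by (simp add: norm_mult flip: complex_cnj_diff)
qed

lemma sin_ge_third: 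
  assumes "0 \<le> x" "x \<le> 2"
  shows "x / 3 \<le> sin (x::real)"
proof -
  have "\<bar>sin x - (\<Sum>m<3. sin_coeff m * x ^ m)\<bar> \<le> inverse (fact 3) * \<bar>x\<bar> ^ 3"
    by (rule Maclaurin_sin_bound)
  hence "\<bar>sin x - x\<bar> \<le> x ^ 3 / 6"
    using assms by (simp add: eval_nat_numeral sin_coeff_def)
  moreover have "x ^ 3 \<le> 4 * x"
  proof -
    have "x * x \<le> 2 * 2" using assms by (intro mult_mono) auto
    hence "x * (x * x) \<le> x * 4" using assms by (intro mult_left_mono) auto
    thus ?thesis by (simp add: power3_eq_cube mult.commute)
  qed
  ultimately show ?thesis by linarith
qed

lemma norm_unity_minus_1_ge:
  assumes "d \<le> N" "N > 0"
  shows "2 * real (min d (N - d)) / real N \<le> norm (cis (2 * pi * real d / real N) - 1)"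
proof -
  define x where "x = pi * real d / real N"
  have eq: "norm (cis (2 * pi * real d / real N) - 1) = 2 * \<bar>sin x\<bar>"
    using dist_exp_i_1[of "2 * pi * real d / real N"] by (simp add: cis_conv_exp x_def)
  define m where "m = real (min d (N - d))"
  have m: "0 \<le> m" "m \<le> real N / 2" using assms by (auto simp: m_def min_def)
  have "sin x = sin (pi * m / real N)"
  proof (cases "d \<le> N - d")
    case False
    have "sin x = sin (pi - x)" by simp
    also have "pi - x = pi * m / real N" using False assms by (simp add: x_def m_def field_simps of_nat_diff min_def)
    finally show ?thesis .
  qed (simp add: x_def m_def min_def)
  moreover have "pi * m / real N / 3 \<le> sin (pi * m / real N)"
  proof (rule sin_ge_third)
    have "pi * m / real N \<le> pi * (real N / 2) / real N" using m by (intro divide_right_mono mult_left_mono) auto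
    also have "\<dots> \<le> 2" using pi_less_4 assms by simp
    finally show "pi * m / real N \<le> 2" .
  qed (use m in simp)
  moreover have "m / real N \<le> pi * m / real N / 3"
    using mult_left_mono[of 3 pi m] pi_gt3 m assms by (simp add: field_simps)
  ultimately show ?thesis unfolding eq m_def[symmetric] by (simp add: field_simps)
qed

text \<open>Two points of the disc are less than \<open>2 \<rho>\<close> apart, so their exponents
  differ cyclically by less than \<open>\<rho> N\<close>. Everything is measured from the smallest
  exponent.\<close>

lemma card_near_bound:
  assumes N: "N > 0" and r: "\<rho> \<ge> 0"
  shows "real (card {h\<in>{..<N}. norm (unity_root N ^ h - b) < \<rho>}) \<le> 2 * (\<rho> * real N + 1)"
proof (cases "{h\<in>{..<N}. norm (unity_root N ^ h - b) < \<rho>} = {}")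
  case False
  define A where "A = {h\<in>{..<N}. norm (unity_root N ^ h - b) < \<rho>}"
  have fin: "finite A" and ne: "A \<noteq> {}" using False by (auto simp: A_def)
  define h0 where "h0 = Min A"
  have h0: "h0 \<in> A" "\<And>h. h \<in> A \<Longrightarrow> h0 \<le> h" unfolding h0_def using fin ne by auto
  define K where "K = nat \<lceil>\<rho> * real N\<rceil>"
  have K: "\<rho> * real N \<le> real K" "real K \<le> \<rho> * real N + 1" using r unfolding K_def by (simp_all add: of_nat_ceiling) 
  \<comment> \<open>The second set accounts for exponents that precede \<open>h0\<close> cyclically:
    as \<open>h0\<close> is smallest, they appear as slightly less than
    \<open>h0 + N\<close>.\<close>
  have "A \<subseteq> (\<lambda>d. h0 + d) ` {..<K} \<union> (\<lambda>d. h0 + N - Suc d) ` {..<K}"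
  proof
    fix h assume h: "h \<in> A"
    define d where "d = h - h0"
    have d: "h = h0 + d" "d < N" using h0(2)[OF h] h by (auto simp: d_def A_def)
    have "unity_root N ^ h - unity_root N ^ h0 = unity_root N ^ h0 * (unity_root N ^ d - 1)"
      by (simp add: d(1) power_add algebra_simps)
    hence "norm (unity_root N ^ d - 1) = norm (unity_root N ^ h - unity_root N ^ h0)"
      by (simp add: norm_mult norm_power)
    also have "\<dots> \<le> norm (unity_root N ^ h - b) + norm (unity_root N ^ h0 - b)"
      by (metis norm_minus_commute norm_triangle_sub dist_norm dist_triangle2)
    also have "\<dots> < 2 * \<rho>" using h h0(1) by (simp add: A_def)
    finally have "2 * real (min d (N - d)) / real N < 2 * \<rho>"
      using norm_unity_minus_1_ge[of d N] d N unfolding unity_root_power by linarith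
    hence "real (min d (N - d)) < \<rho> * real N" using N by (simp add: field_simps)
    hence "min d (N - d) < K" using K by linarith
    thus "h \<in> (\<lambda>d. h0 + d) ` {..<K} \<union> (\<lambda>d. h0 + N - Suc d) ` {..<K}"
    proof (cases "d < K")
      case False
      hence "N - d < K" using \<open>min d (N - d) < K\<close> by simp
      hence "h = h0 + N - Suc (N - d - 1)" "N - d - 1 < K" using d by auto
      thus ?thesis by blast
    qed (use d in auto)
  qed
  hence "card A \<le> card ((\<lambda>d. h0 + d) ` {..<K} \<union> (\<lambda>d. h0 + N - Suc d) ` {..<K})" by (intro card_mono) auto
  also have "\<dots> \<le> card ((\<lambda>d. h0 + d) ` {..<K}) + card ((\<lambda>d. h0 + N - Suc d) ` {..<K})" by (rule card_Un_le)
  also have "\<dots> \<le> K + K" by (intro add_mono order_trans[OF card_image_le]) auto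
  finally have "real (card A) \<le> 2 * real K" by linarith
  also have "\<dots> \<le> 2 * (\<rho> * real N + 1)" using K by simp
  finally show ?thesis unfolding A_def .
next
  case True
  show ?thesis unfolding True using r by simp
qed

lemma abs_ln_diff_far:
  fixes e f d M :: real
  assumes "\<bar>e - f\<bar> \<le> d" "d > 0" "M \<ge> 2" "M * d \<le> e" "f > 0"
  shows "\<bar>ln e - ln f\<bar> \<le> 1 / (M - 1)"
proof -
  have e: "e > 0" using assms mult_pos_pos[of M d] by linarith
  have "(M - 1) * d \<le> f" using assms by (simp add: algebra_simps abs_le_iff)
  have "ln e - ln f \<le> (e - f) / f"
    using ln_le_minus_one[of "e / f"] e assms by (simp add: ln_div field_simps)
  also have "\<dots> \<le> d / f" using assms by (intro divide_right_mono) auto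
  also have "\<dots> \<le> d / ((M - 1) * d)" using \<open>(M - 1) * d \<le> f\<close> assms by (intro divide_left_mono) auto
  also have "\<dots> = 1 / (M - 1)" using assms by simp
  finally have 1: "ln e - ln f \<le> 1 / (M - 1)" .
  have "ln f - ln e \<le> (f - e) / e"
    using ln_le_minus_one[of "f / e"] e assms by (simp add: ln_div field_simps)
  also have "\<dots> \<le> d / e" using assms e by (intro divide_right_mono) auto
  also have "\<dots> \<le> d / ((M - 1) * d)"
  proof (rule divide_left_mono)
    have "(M - 1) * d \<le> M * d" using assms by (intro mult_right_mono) auto
    thus "(M - 1) * d \<le> e" using assms by linarith
  qed (use assms e in auto)
  also have "\<dots> = 1 / (M - 1)" using assms by simp
  finally show ?thesis using 1 by linarith
qed

text \<open>The point \<open>b\<close> is moved inwards to \<open>(1 - d) b\<close>. The three terms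
  are the sum at the new point, the change at conjugates farther than \<open>M d\<close> from
  \<open>b\<close>, which is at most \<open>1 / (M - 1)\<close> each, and the change at the few
  closer ones, where both logarithms are at most \<open>E\<close> in absolute value. The upper side
  of the latter needs only \<open>E \<ge> 1\<close>, because the distances are at most 2.\<close>

lemma log_average_unit_circle_bound:
  assumes H: "galois_orbit N H" and b: "norm b = 1" and d: "0 < d" "d < 1" and M: "M \<ge> 2" and E: "E \<ge> 1"
    and near: "\<And>h. h \<in> H \<Longrightarrow> exp (- E) \<le> norm (unity_root N ^ h - b)" and dE: "exp (- E) \<le> d"
  shows "\<bar>\<Sum>h\<in>H. ln (norm (unity_root N ^ h - b))\<bar> \<le>
     sqrt (real N) / d + real (card H) / (M - 1) + 2 * (M * d * real N + 1) * (2 * E)"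
proof -
  have N: "N > 0" and HN: "H \<subseteq> {..<N}" using H by (auto simp: galois_orbit_def)
  have fin: "finite H" using HN finite_subset by blast
  define e where "e = (\<lambda>h. norm (unity_root N ^ h - b))"
  define f where "f = (\<lambda>h. norm (unity_root N ^ h - of_real (1 - d) * b))"
  have nu: "norm (unity_root N ^ h) = 1" for h by (simp add: norm_power)
  have nrb: "norm (of_real (1 - d) * b) = 1 - d" using d b by (simp add: norm_mult del: of_real_diff)
  have ef: "\<bar>e h - f h\<bar> \<le> d" for h
  proof -
    have "\<bar>e h - f h\<bar> \<le> norm ((unity_root N ^ h - b) - (unity_root N ^ h - of_real (1 - d) * b))"
      unfolding e_def f_def by (rule norm_triangle_ineq3)
    also have "(unity_root N ^ h - b) - (unity_root N ^ h - of_real (1 - d) * b) = - of_real d * b" by (simp add: algebra_simps)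
    also have "norm \<dots> = d" using d b by (simp add: norm_mult)
    finally show ?thesis .
  qed
  have fd: "f h \<ge> d" for h
    using norm_triangle_ineq2[of "unity_root N ^ h" "of_real (1 - d) * b"] nu[of h] nrb by (simp add: f_def)
  have f2: "f h \<le> 2" for h
    using norm_triangle_ineq4[of "unity_root N ^ h" "of_real (1 - d) * b"] nu[of h] nrb d by (simp add: f_def)
  have e2: "e h \<le> 2" for h
    using norm_triangle_ineq4[of "unity_root N ^ h" b] nu[of h] b by (simp add: e_def)
  have eE: "exp (- E) \<le> e h" if "h \<in> H" for h using near[OF that] by (simp add: e_def)
  have absln: "\<bar>ln t\<bar> \<le> E" if "exp (- E) \<le> t" "t \<le> 2" for t :: real
  proof -
    have t: "t > 0" using that(1) exp_gt_zero[of "- E"] by linarith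
    have "ln (exp (- E)) \<le> ln t" using that t by (subst ln_le_cancel_iff) auto
    moreover have "ln t \<le> t - 1" using t by (rule ln_le_minus_one)
    ultimately show ?thesis using that E by simp
  qed
  define A where "A = {h\<in>H. e h < M * d}"
  define C where "C = {h\<in>H. \<not> e h < M * d}"
  have finAC: "finite A" "finite C" using fin by (simp_all add: A_def C_def)
  have AC: "H = A \<union> C" "A \<inter> C = {}" by (auto simp: A_def C_def)
  have "\<bar>\<Sum>h\<in>H. ln (e h) - ln (f h)\<bar> \<le> (\<Sum>h\<in>H. \<bar>ln (e h) - ln (f h)\<bar>)" by (rule sum_abs)
  also have "\<dots> = (\<Sum>h\<in>A. \<bar>ln (e h) - ln (f h)\<bar>) + (\<Sum>h\<in>C. \<bar>ln (e h) - ln (f h)\<bar>)"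
    by (subst AC(1), rule sum.union_disjoint[OF finAC AC(2)])
  also have "(\<Sum>h\<in>A. \<bar>ln (e h) - ln (f h)\<bar>) \<le> (\<Sum>h\<in>A. 2 * E)"
  proof (rule sum_mono)
    fix h assume "h \<in> A"
    hence "\<bar>ln (e h)\<bar> \<le> E" using eE e2 by (intro absln) (auto simp: A_def)
    moreover have "\<bar>ln (f h)\<bar> \<le> E" using fd[of h] f2[of h] dE by (intro absln) auto
    ultimately show "\<bar>ln (e h) - ln (f h)\<bar> \<le> 2 * E" by linarith
  qed
  also have "(\<Sum>h\<in>A. 2 * E) \<le> 2 * (M * d * real N + 1) * (2 * E)"
  proof -
    have "A \<subseteq> {h\<in>{..<N}. norm (unity_root N ^ h - b) < M * d}" using HN by (auto simp: A_def e_def)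
    hence "card A \<le> card {h\<in>{..<N}. norm (unity_root N ^ h - b) < M * d}" by (intro card_mono) auto
    hence "real (card A) \<le> 2 * (M * d * real N + 1)"
      using card_near_bound[OF N, of "M * d" b] d M by (smt (verit) of_nat_le_iff zero_le_mult_iff)
    hence "real (card A) * (2 * E) \<le> 2 * (M * d * real N + 1) * (2 * E)" using E by (intro mult_right_mono) auto
    thus ?thesis by simp
  qed
  also have "(\<Sum>h\<in>C. \<bar>ln (e h) - ln (f h)\<bar>) \<le> (\<Sum>h\<in>C. 1 / (M - 1))"
  proof (rule sum_mono)
    fix h assume "h \<in> C"
    thus "\<bar>ln (e h) - ln (f h)\<bar> \<le> 1 / (M - 1)"
      using ef[of h] d M fd[of h] by (intro abs_ln_diff_far[of _ _ d]) (auto simp: C_def)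
  qed
  also have "\<dots> \<le> real (card H) / (M - 1)"
  proof -
    have "card C \<le> card H" using fin by (intro card_mono) (auto simp: C_def)
    thus ?thesis using M by (simp add: divide_right_mono)
  qed
  finally have 1: "\<bar>\<Sum>h\<in>H. ln (e h) - ln (f h)\<bar> \<le> 2 * (M * d * real N + 1) * (2 * E) + real (card H) / (M - 1)"
    by simp
  have "(\<Sum>h\<in>H. ln (f h)) = (\<Sum>h\<in>H. ln (norm (1 - unity_root N ^ h * cnj (of_real (1 - d) * b))))"
    unfolding f_def using norm_unit_minus[OF nu] by simp
  hence "\<bar>\<Sum>h\<in>H. ln (f h)\<bar> \<le> sqrt (real N) / (1 - norm (cnj (of_real (1 - d) * b)))"
    using log_sum_bound[OF H, of "cnj (of_real (1 - d) * b)"] nrb d by (simp del: complex_cnj_mult)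
  hence 2: "\<bar>\<Sum>h\<in>H. ln (f h)\<bar> \<le> sqrt (real N) / d" using nrb by (simp del: complex_cnj_mult)
  have "(\<Sum>h\<in>H. ln (e h)) = (\<Sum>h\<in>H. ln (e h) - ln (f h)) + (\<Sum>h\<in>H. ln (f h))"
    by (simp add: sum_subtractf)
  thus ?thesis using 1 2 unfolding e_def by linarith
qed

text \<open>Off the unit circle the power series applies directly, after taking out the factor
  \<open>b\<close> if \<open>|b| > 1\<close>, and leaves an error of order \<open>sqrt N\<close>. On
  the circle \<open>d = N^(-1/4)\<close> makes the errors at the shifted point and at the close
  conjugates \<open>O (N^(3/4) (log N)^4)\<close>, which is negligible against
  \<open>N / log N\<close>. The far conjugates are handled by \<open>M\<close>, whose choice makes
  \<open>1 / (M - 1)\<close> at most \<open>\<epsilon> / 2\<close>.\<close>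

lemma log_average:
  fixes b :: complex
  assumes alg: "f0 \<noteq> 0" "poly (cpoly f0) b = 0" and nr: "\<And>n. n > 0 \<Longrightarrow> b ^ n \<noteq> 1" and c: "c > 0" and \<epsilon>: "\<epsilon> > 0"
  shows "\<exists>N0. \<forall>N\<ge>N0. \<forall>H. galois_orbit N H \<longrightarrow> c * (real N / (log 2 (real N) + 1)) \<le> real (card H) \<longrightarrow>
     \<bar>(\<Sum>h\<in>H. ln (norm (unity_root N ^ h - b))) - real (card H) * max 0 (ln (norm b))\<bar> \<le> \<epsilon> * real (card H)"
proof -
  consider "norm b < 1" | "norm b > 1" | "norm b = 1" by linarith
  then show ?thesis
  proof cases
    case 1
    define K where "K = 1 / (1 - norm b) / (\<epsilon> * c)"
    have "eventually (\<lambda>N::nat. K * sqrt (real N) \<le> real N / (log 2 (real N) + 1)) sequentially"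
      by (rule eventually_le_if_ratio_tendsto_0; real_asymp)
    then obtain N0 where N0: "\<And>N. N \<ge> N0 \<Longrightarrow> K * sqrt (real N) \<le> real N / (log 2 (real N) + 1)"
      unfolding eventually_sequentially by blast
    show ?thesis
    proof (intro exI allI impI)
      fix N H assume N: "N \<ge> N0" and H: "galois_orbit N H" and cH: "c * (real N / (log 2 (real N) + 1)) \<le> real (card H)"
      have nu: "norm (unity_root N ^ h) = 1" for h by (simp add: norm_power)
      have "sqrt (real N) / (1 - norm b) = \<epsilon> * (c * (K * sqrt (real N)))" using c \<epsilon> by (simp add: K_def)
      also have "\<dots> \<le> \<epsilon> * (c * (real N / (log 2 (real N) + 1)))" using N0[OF N] c \<epsilon> by (intro mult_left_mono) auto
      also have "\<dots> \<le> \<epsilon> * real (card H)" using cH \<epsilon> by (intro mult_left_mono) auto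
      finally have "\<bar>\<Sum>h\<in>H. ln (norm (1 - unity_root N ^ h * cnj b))\<bar> \<le> \<epsilon> * real (card H)"
        using log_sum_bound[OF H, of "cnj b"] 1 by simp
      moreover have "max 0 (ln (norm b)) = 0" using 1 by (cases "b = 0") (auto simp: max_def)
      ultimately show "\<bar>(\<Sum>h\<in>H. ln (norm (unity_root N ^ h - b))) - real (card H) * max 0 (ln (norm b))\<bar> \<le> \<epsilon> * real (card H)"
        using norm_unit_minus[OF nu, of _ b] by simp
    qed
  next
    case 2
    define K where "K = 1 / (1 - norm (inverse b)) / (\<epsilon> * c)"
    have b1: "norm (inverse b) < 1" using 2 by (simp add: norm_inverse inverse_less_1_iff)
    have b0: "b \<noteq> 0" using 2 by auto
    have "eventually (\<lambda>N::nat. K * sqrt (real N) \<le> real N / (log 2 (real N) + 1)) sequentially"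
      by (rule eventually_le_if_ratio_tendsto_0; real_asymp)
    then obtain N0 where N0: "\<And>N. N \<ge> N0 \<Longrightarrow> K * sqrt (real N) \<le> real N / (log 2 (real N) + 1)"
      unfolding eventually_sequentially by blast
    show ?thesis
    proof (intro exI allI impI)
      fix N H assume N: "N \<ge> N0" and H: "galois_orbit N H" and cH: "c * (real N / (log 2 (real N) + 1)) \<le> real (card H)"
      have nu: "norm (unity_root N ^ h) = 1" for h by (simp add: norm_power)
      have "sqrt (real N) / (1 - norm (inverse b)) = \<epsilon> * (c * (K * sqrt (real N)))" using c \<epsilon> by (simp add: K_def)
      also have "\<dots> \<le> \<epsilon> * (c * (real N / (log 2 (real N) + 1)))" using N0[OF N] c \<epsilon> by (intro mult_left_mono) auto
      also have "\<dots> \<le> \<epsilon> * real (card H)" using cH \<epsilon> by (intro mult_left_mono) auto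
      finally have le: "\<bar>\<Sum>h\<in>H. ln (norm (1 - unity_root N ^ h * inverse b))\<bar> \<le> \<epsilon> * real (card H)"
        using log_sum_bound[OF H b1] by linarith
      have "ln (norm (unity_root N ^ h - b)) = ln (norm (1 - unity_root N ^ h * inverse b)) + ln (norm b)" for h
      proof -
        have "unity_root N ^ h - b = - (b * (1 - unity_root N ^ h * inverse b))" using b0 by (simp add: algebra_simps)
        hence "norm (unity_root N ^ h - b) = norm b * norm (1 - unity_root N ^ h * inverse b)"
          by (simp only: norm_minus_cancel norm_mult)
        moreover have "unity_root N ^ h * inverse b \<noteq> 1"
        proof
          assume "unity_root N ^ h * inverse b = 1"
          hence "norm (unity_root N ^ h * inverse b) = 1" by simp
          thus False using b1 nu[of h] by (simp only: norm_mult)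
        qed
        ultimately show ?thesis using b0 by (simp add: ln_mult)
      qed
      moreover have "max 0 (ln (norm b)) = ln (norm b)" using 2 by (simp add: max_def)
      ultimately show "\<bar>(\<Sum>h\<in>H. ln (norm (unity_root N ^ h - b))) - real (card H) * max 0 (ln (norm b))\<bar> \<le> \<epsilon> * real (card H)"
        using le by (simp add: sum.distrib)
    qed
  next
    case 3
    obtain C N1 where gelf: "\<And>N k. N \<ge> N1 \<Longrightarrow> k < N \<Longrightarrow> coprime k N \<Longrightarrow>
        exp (- C * ln (real N) ^ 4) \<le> norm (b - cis (2 * pi * real k / real N))"
      using gelfond_bound[OF alg 3 nr] by blast
    \<comment> \<open>No sign of \<open>C\<close> is known; this choice dominates it and ensures
      \<open>E \<ge> 1\<close> and \<open>E \<ge> log N\<close>, the latter giving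
      \<open>exp (- E) \<le> d\<close>.\<close>
    define C' where "C' = \<bar>C\<bar> + 1"
    define M where "M = 2 + 2 / \<epsilon>"
    define K where "K = (1 + 4 * C' * (M + 1)) * (2 / (\<epsilon> * c))"
    have "eventually (\<lambda>N::nat. K * (real N powr (3/4) * ln (real N) ^ 4) \<le> real N / (log 2 (real N) + 1)) sequentially"
      by (rule eventually_le_if_ratio_tendsto_0; real_asymp)
    moreover have "eventually (\<lambda>N::nat. ln (real N) \<ge> 1) sequentially" by real_asymp
    moreover have "eventually (\<lambda>N::nat. real N > 1) sequentially" by real_asymp
    moreover have "eventually (\<lambda>N::nat. N \<ge> N1) sequentially" by (rule eventually_ge_at_top)
    ultimately have "eventually (\<lambda>N::nat. K * (real N powr (3/4) * ln (real N) ^ 4) \<le> real N / (log 2 (real N) + 1) \<and>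
        ln (real N) \<ge> 1 \<and> real N > 1 \<and> N \<ge> N1) sequentially"
      by (intro eventually_conj)
    then obtain N0 where N0: "\<And>N. N \<ge> N0 \<Longrightarrow> K * (real N powr (3/4) * ln (real N) ^ 4) \<le> real N / (log 2 (real N) + 1) \<and>
        ln (real N) \<ge> 1 \<and> real N > 1 \<and> N \<ge> N1"
      unfolding eventually_sequentially by blast
    show ?thesis
    proof (intro exI allI impI)
      fix N H assume N: "N \<ge> N0" and H: "galois_orbit N H" and cH: "c * (real N / (log 2 (real N) + 1)) \<le> real (card H)"
      have n: "K * (real N powr (3/4) * ln (real N) ^ 4) \<le> real N / (log 2 (real N) + 1)"
        "ln (real N) \<ge> 1" "real N > 1" "N \<ge> N1" using N0[OF N] by auto
      define d where "d = real N powr (-1/4)"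
      define E where "E = C' * ln (real N) ^ 4"
      have "2 / \<epsilon> \<le> M - 1" by (simp add: M_def)
      hence "1 / (M - 1) \<le> 1 / (2 / \<epsilon>)" using \<epsilon> by (intro frac_le) auto
      hence M2: "M \<ge> 2" "1 / (M - 1) \<le> \<epsilon> / 2" using \<epsilon> by (simp_all add: M_def)
      have ln4: "1 \<le> ln (real N) ^ 4" "ln (real N) \<le> ln (real N) ^ 4"
        using n(2) by (auto simp: one_le_power self_le_power)
      have E1: "E \<ge> 1" "E \<ge> ln (real N)" using ln4 n(2) mult_mono[of 1 C' 1 "ln (real N) ^ 4"]
        mult_mono[of 1 C' "ln (real N)" "ln (real N) ^ 4"] by (auto simp: E_def C'_def)
      have d: "0 < d" "d < 1" using n(3) by (auto simp: d_def powr_less_one)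
      have dE: "exp (- E) \<le> d"
      proof -
        have "d = exp (- (1/4) * ln (real N))" using n(3) by (simp add: d_def powr_def)
        moreover have "- E \<le> - (1/4) * ln (real N)" using E1 n(2) by simp
        ultimately show ?thesis by simp
      qed
      have near: "exp (- E) \<le> norm (unity_root N ^ h - b)" if "h \<in> H" for h
      proof -
        have "C * ln (real N) ^ 4 \<le> E" unfolding E_def C'_def using ln4 by (intro mult_right_mono) auto
        hence "exp (- E) \<le> exp (- C * ln (real N) ^ 4)" by simp
        also have "\<dots> \<le> norm (b - cis (2 * pi * real h / real N))"
          by (rule gelf[OF n(4)]) (use H that in \<open>auto simp: galois_orbit_def\<close>)
        finally show ?thesis by (simp add: unity_root_power norm_minus_commute)
      qed
      have "\<bar>\<Sum>h\<in>H. ln (norm (unity_root N ^ h - b))\<bar> \<le>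
         sqrt (real N) / d + real (card H) / (M - 1) + 2 * (M * d * real N + 1) * (2 * E)"
        by (rule log_average_unit_circle_bound[OF H 3 d M2(1) E1(1) near dE])
      also have "real (card H) / (M - 1) \<le> \<epsilon> / 2 * real (card H)"
        using mult_right_mono[OF M2(2), of "real (card H)"] by simp
      also have "sqrt (real N) / d + \<epsilon> / 2 * real (card H) + 2 * (M * d * real N + 1) * (2 * E) \<le> \<epsilon> * real (card H)"
      proof -
        define q where "q = real N powr (3/4)"
        have q1: "q \<ge> 1" using n(3) by (simp add: q_def ge_one_powr_ge_zero)
        have dN: "d * real N = q"
        proof -
          have "d * real N = real N powr (-1/4) * real N powr 1" using n(3) by (simp add: d_def)
          also have "\<dots> = real N powr (-1/4 + 1)" by (rule powr_add[symmetric])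
          finally show ?thesis by (simp add: q_def)
        qed
        have sd: "sqrt (real N) / d = q"
        proof -
          have "sqrt (real N) / d = real N powr (1/2) / real N powr (-1/4)" using n(3) by (simp add: d_def powr_half_sqrt)
          also have "\<dots> = real N powr (1/2 - (-1/4))" by (rule powr_diff[symmetric])
          finally show ?thesis by (simp add: q_def)
        qed
        have "sqrt (real N) / d + 2 * (M * d * real N + 1) * (2 * E) = q + 4 * (M * q + 1) * E"
          unfolding sd using dN by (simp add: mult.assoc)
        also have "\<dots> \<le> q * ln (real N) ^ 4 + 4 * (M * q + q) * E"
          using q1 ln4 E1 by (intro add_mono mult_right_mono mult_left_mono) (auto simp: mult_le_cancel_left1)
        also have "\<dots> = (1 + 4 * C' * (M + 1)) * (q * ln (real N) ^ 4)" by (simp add: E_def algebra_simps)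
        also have "\<dots> = \<epsilon> / 2 * (c * (K * (q * ln (real N) ^ 4)))" using \<epsilon> c by (simp add: K_def)
        also have "\<dots> \<le> \<epsilon> / 2 * (c * (real N / (log 2 (real N) + 1)))"
          using n(1) \<epsilon> c by (intro mult_left_mono) (auto simp: q_def)
        also have "\<dots> \<le> \<epsilon> / 2 * real (card H)" using cH \<epsilon> by (intro mult_left_mono) auto
        finally have le: "sqrt (real N) / d + 2 * (M * d * real N + 1) * (2 * E) \<le> \<epsilon> / 2 * real (card H)" .
        have aux: "p + r + q \<le> s" if "p + q \<le> r" "s = r + r" for p q r s :: real
          using that by linarith
        show ?thesis by (rule aux[OF le]) simp
      qed
      finally show "\<bar>(\<Sum>h\<in>H. ln (norm (unity_root N ^ h - b))) - real (card H) * max 0 (ln (norm b))\<bar> \<le> \<epsilon> * real (card H)"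
        using 3 by simp
    qed
  qed
qed

subsection \<open>Chebyshev polynomials and absolute values\<close>

lemma cheb_rec: "cheb (Suc (Suc n)) = [:0, 1:] * cheb (Suc n) - cheb n"
  by (cases n) (auto simp: numeral_poly)

declare cheb.simps(3,4) [simp del]

lemma poly_cheb:
  fixes z y :: "'a :: comm_ring_1"
  assumes "z * y = 1"
  shows "poly (cheb n) (z + y) = z ^ n + y ^ n"
proof -
  have "poly (cheb n) (z + y) = z ^ n + y ^ n \<and> poly (cheb (Suc n)) (z + y) = z ^ Suc n + y ^ Suc n"
  proof (induction n)
    case (Suc n)
    have "(z + y) * (z ^ Suc n + y ^ Suc n) - (z ^ n + y ^ n) =
          z ^ Suc (Suc n) + y ^ Suc (Suc n) + ((z * y) * z ^ n + (z * y) * y ^ n - (z ^ n + y ^ n))"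
      by (simp add: algebra_simps)
    with Suc assms show ?case by (simp add: cheb_rec)
  qed simp
  thus ?thesis by simp
qed

lemma map_poly_cheb:
  assumes "comm_ring_hom j"
  shows "map_poly j (cheb n) = cheb n"
proof -
  interpret h: comm_ring_hom j by fact
  interpret ph: map_poly_comm_ring_hom j ..
  have "map_poly j (cheb n) = cheb n \<and> map_poly j (cheb (Suc n)) = cheb (Suc n)"
    by (induction n) (auto simp: cheb_rec hom_distribs simp del: mult_pCons_left)
  thus ?thesis by simp
qed

lemma degree_cheb: "degree (cheb (Suc n) :: 'a :: idom poly) = Suc n \<and> lead_coeff (cheb (Suc n) :: 'a poly) = 1"
proof (induction n rule: less_induct)
  case (less n)
  show ?case
  proof (cases n)
    case (Suc k)
    have deg: "degree ([:0, 1:] * cheb (Suc k) :: 'a poly) = Suc (Suc k)"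
      using less[of k] Suc by (subst degree_mult_eq) auto
    have "degree (cheb k :: 'a poly) < Suc (Suc k)"
      using less[of "k - 1"] Suc by (cases k) auto
    hence low: "degree (- cheb k :: 'a poly) < degree ([:0, 1:] * cheb (Suc k) :: 'a poly)" using deg by simp
    have eq: "cheb (Suc (Suc k)) = [:0, 1:] * cheb (Suc k) + - (cheb k :: 'a poly)" by (simp add: cheb_rec)
    have d: "degree (cheb (Suc (Suc k)) :: 'a poly) = Suc (Suc k)"
      unfolding eq degree_add_eq_left[OF low] by (rule deg)
    have "coeff (- cheb k :: 'a poly) (Suc (Suc k)) = 0" using low unfolding deg by (rule coeff_eq_0)
    moreover have "coeff (cheb (Suc k) :: 'a poly) (Suc k) = 1"
      using less[of k] Suc by (metis lessI)
    hence "coeff ([:0, 1:] * cheb (Suc k) :: 'a poly) (Suc (Suc k)) = 1" by simp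
    ultimately have "coeff (cheb (Suc (Suc k)) :: 'a poly) (Suc (Suc k)) = 1" unfolding eq coeff_add by simp
    thus ?thesis using d Suc by simp
  qed simp
qed

lemma funpow_poly_cheb:
  fixes z y :: "'a :: comm_ring_1"
  assumes zy: "z * y = 1"
  shows "(poly (cheb m) ^^ k) (z + y) = z ^ (m ^ k) + y ^ (m ^ k)"
proof (induction k)
  case (Suc k)
  have "z ^ (m ^ k) * y ^ (m ^ k) = 1" using zy by (simp flip: power_mult_distrib)
  from poly_cheb[OF this, of m] show ?case using Suc by (simp add: mult.commute flip: power_mult)
qed simp

lemma power_diff_eq_one:
  fixes z :: "'a :: field"
  assumes "z ^ a = z ^ c" "a \<noteq> c" "z \<noteq> 0"
  shows "\<exists>n>0. z ^ n = 1"
  using assms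
proof (induction a c rule: linorder_wlog)
  case (le a c)
  have "z ^ a * z ^ (c - a) = z ^ c" unfolding power_add[symmetric] using le(1) by simp
  hence "z ^ a * z ^ (c - a) = z ^ a * 1" using le by simp
  hence "z ^ (c - a) = 1" using le by simp
  thus ?case using le by (intro exI[of _ "c - a"]) auto
qed metis

lemma plus_inverse_eq_iff:
  fixes z y :: "'a :: field"
  assumes "z \<noteq> 0" "y \<noteq> 0"
  shows "z + inverse z = y + inverse y \<longleftrightarrow> z = y \<or> z * y = 1"
proof -
  have "z + inverse z = y + inverse y \<longleftrightarrow> (z - y) * (z * y - 1) = 0"
    using assms by (simp add: field_simps)
  thus ?thesis by simp
qed

text \<open>Two iterates agree if and only if \<open>z^(m^j)\<close> equals \<open>z^(m^k)\<close>
  or its inverse, and for \<open>m \<ge> 2\<close> either equation gives a nontrivial relation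
  \<open>z^n = 1\<close>. Conversely, if \<open>z\<close> has finite order, the exponents
  \<open>m^k\<close> repeat modulo that order.\<close>

lemma preperiodic_cheb_iff:
  fixes z :: "'a :: field"
  assumes z: "z \<noteq> 0" and m: "m \<ge> 2"
  shows "preperiodic (cheb m) (z + inverse z) \<longleftrightarrow> (\<exists>n>0. z ^ n = 1)"
proof
  assume "preperiodic (cheb m) (z + inverse z)"
  then obtain j k where jk: "j \<noteq> k" "z ^ (m ^ j) + inverse z ^ (m ^ j) = z ^ (m ^ k) + inverse z ^ (m ^ k)"
    using z by (auto simp: preperiodic_def funpow_poly_cheb)
  hence "z ^ (m ^ j) = z ^ (m ^ k) \<or> z ^ (m ^ j) * z ^ (m ^ k) = 1"
    using plus_inverse_eq_iff[of "z ^ (m ^ j)" "z ^ (m ^ k)"] z by (simp add: power_inverse)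
  thus "\<exists>n>0. z ^ n = 1"
  proof
    assume "z ^ (m ^ j) = z ^ (m ^ k)"
    moreover have "m ^ j \<noteq> m ^ k" using jk m by (simp add: power_inject_exp)
    ultimately show ?thesis using power_diff_eq_one z by blast
  next
    assume "z ^ (m ^ j) * z ^ (m ^ k) = 1"
    thus ?thesis using m by (intro exI[of _ "m ^ j + m ^ k"]) (auto simp: power_add)
  qed
next
  assume "\<exists>n>0. z ^ n = 1"
  then obtain n where n: "n > 0" "z ^ n = 1" by blast
  note zmod = power_mod_eq[OF n(2), symmetric]
  have "\<not> inj (\<lambda>k. m ^ k mod n)"
  proof
    assume "inj (\<lambda>k. m ^ k mod n)"
    hence "infinite (range (\<lambda>k. m ^ k mod n))" by (simp add: finite_image_iff)
    moreover have "range (\<lambda>k. m ^ k mod n) \<subseteq> {..<n}" using n by auto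
    ultimately show False using finite_subset by blast
  qed
  then obtain j k where jk: "j \<noteq> k" "m ^ j mod n = m ^ k mod n" by (auto simp: inj_def)
  have "z ^ (m ^ j) = z ^ (m ^ k)" using zmod[of "m ^ j"] zmod[of "m ^ k"] jk by simp
  hence "(poly (cheb m) ^^ j) (z + inverse z) = (poly (cheb m) ^^ k) (z + inverse z)"
    using z by (simp add: funpow_poly_cheb power_inverse)
  thus "preperiodic (cheb m) (z + inverse z)" using jk by (auto simp: preperiodic_def)
qed

lemma exists_plus_inverse:
  fixes x :: "'a :: alg_closed_field"
  obtains z where "z \<noteq> 0" "x = z + inverse z"
proof -
  obtain z where "poly [:1, - x, 1:] z = 0"
    using alg_closed_imp_poly_has_root[of "[:1, - x, 1:]"] by auto
  hence eq: "1 + z * (z - x) = 0" by simp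
  have "z \<noteq> 0" using eq by auto
  moreover have "x = z + inverse z" using eq \<open>z \<noteq> 0\<close> by (simp add: field_simps)
  ultimately show ?thesis by (rule that)
qed

lemma preperiodic_cheb_hom:
  assumes "inj_idom_hom j"
  shows "preperiodic (cheb m) (j x) \<longleftrightarrow> preperiodic (cheb m) x"
proof -
  interpret h: inj_idom_hom j by fact
  have jh: "comm_ring_hom j" ..
  have "(poly (cheb m) ^^ k) (j x) = j ((poly (cheb m) ^^ k) x)" for k
  proof (induction k)
    case (Suc k)
    have "poly (cheb m) (j y) = j (poly (cheb m) y)" for y
      using h.poly_map_poly[of "cheb m" y] by (simp add: map_poly_cheb[OF jh])
    thus ?case using Suc by simp
  qed simp
  thus ?thesis by (auto simp: preperiodic_def)
qed

text \<open>As \<open>2 = 1 + 1/1\<close>, the value 2 detects \<open>z^n = 1\<close> in terms of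
  \<open>z + 1/z\<close> alone. Vanishing of the \<open>n\<close>-th power condition thus becomes a
  polynomial equation over the prime ring, which all conjugates share.\<close>

lemma poly_cheb_eq_2_iff:
  fixes z :: "'a :: field"
  assumes "z \<noteq> 0"
  shows "poly (cheb n) (z + inverse z) = 2 \<longleftrightarrow> z ^ n = 1"
proof -
  have "poly (cheb n) (z + inverse z) = z ^ n + inverse (z ^ n)"
    using poly_cheb[of z "inverse z" n] assms by (simp add: power_inverse)
  moreover have "z ^ n + inverse (z ^ n) = 1 + inverse 1 \<longleftrightarrow> z ^ n = 1 \<or> z ^ n * 1 = 1"
    by (rule plus_inverse_eq_iff) (use assms in auto)
  ultimately show ?thesis by simp
qed

lemma finite_cheb_eq_2: "n > 0 \<Longrightarrow> finite {x :: 'a :: idom. poly (cheb n) x = 2}"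
proof -
  assume "n > 0"
  then obtain k where n: "n = Suc k" by (cases n) auto
  have "cheb n - [:2:] \<noteq> (0 :: 'a poly)"
  proof
    assume "cheb n - [:2:] = (0 :: 'a poly)"
    hence "degree (cheb n :: 'a poly) = degree [:2 :: 'a:]" by simp
    thus False using degree_cheb[of k, where 'a = 'a] n by simp
  qed
  moreover have "{x :: 'a. poly (cheb n) x = 2} = {x. poly (cheb n - [:2:]) x = 0}" by auto
  ultimately show ?thesis using poly_roots_finite by metis
qed

section \<open>Absolute values and local heights of Chebyshev maps\<close>

locale absolute_value =
  fixes w :: "'a :: field \<Rightarrow> real"
  assumes av: "abs_value w"
begin

lemma nonneg [simp]: "w x \<ge> 0"
  and eq_0_iff [simp]: "w x = 0 \<longleftrightarrow> x = 0"
  and mult: "w (x * y) = w x * w y"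
  and triangle: "w (x + y) \<le> w x + w y"
  using av by (auto simp: abs_value_def)

lemma zero [simp]: "w 0 = 0"
  by simp

lemma pos: "x \<noteq> 0 \<Longrightarrow> w x > 0"
  using nonneg[of x] eq_0_iff[of x] by linarith

lemma one [simp]: "w 1 = 1"
  using mult[of 1 1] pos[of 1] by simp

lemma minus_one: "w (- 1) = 1"
proof -
  have "w (- 1) * w (- 1) = 1" using mult[of "- 1" "- 1"] by simp
  moreover have "w (- 1) \<ge> 0" by simp
  ultimately show ?thesis by (metis abs_of_nonneg abs_square_eq_1 power2_eq_square)
qed

lemma minus [simp]: "w (- x) = w x"
  using mult[of "- 1" x] by (simp add: minus_one)

lemma power: "w (x ^ n) = w x ^ n"
  by (induction n) (auto simp: mult)

lemma inverse: "w (inverse x) = inverse (w x)"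
proof (cases "x = 0")
  case False
  have "w x * w (inverse x) = 1" using mult[of x "inverse x"] False by simp
  thus ?thesis by (metis inverse_unique)
qed auto

lemma triangle_diff: "w x - w y \<le> w (x + y)"
  using triangle[of "x + y" "- y"] by simp

lemma sum_le: "w (sum f A) \<le> (\<Sum>x\<in>A. w (f x))"
proof (induction A rule: infinite_finite_induct)
  case (insert x F)
  then show ?case using triangle[of "f x" "sum f F"] by simp
qed auto

lemma prod: "w (prod f A) = (\<Prod>x\<in>A. w (f x))"
  by (induction A rule: infinite_finite_induct) (auto simp: mult)

lemma root_of_unity: "x ^ n = 1 \<Longrightarrow> n > 0 \<Longrightarrow> w x = 1"
  by (metis nonneg one power power_eq_1_iff gr_implies_not0 real_norm_def abs_of_nonneg)

text \<open>By the symmetry between \<open>b\<close> and its inverse, \<open>w b \<ge> 1\<close> may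
  be assumed. The \<open>k\<close>-th iterate is \<open>b^(m^k)\<close> plus a term of absolute
  value at most 1, so after taking the maximum with 1 its size is within a factor 2 of
  \<open>w b^(m^k)\<close>; the resulting \<open>ln 2\<close> is divided by
  \<open>m^k\<close>.\<close>

lemma local_height_cheb:
  assumes b: "b \<noteq> 0" and m: "m \<ge> 2"
  shows "local_height w (cheb m) (b + inverse b) = \<bar>ln (w b)\<bar>"
proof -
  have *: "local_height w (cheb m) (b + inverse b) = ln (w b)" if b: "b \<noteq> 0" and c: "w b \<ge> 1" for b
  proof -
    define s where "s = (\<lambda>k. ln (max (w ((poly (cheb m) ^^ k) (b + inverse b))) 1) / real (degree (cheb m :: 'a poly)) ^ k)"
    have deg: "degree (cheb m :: 'a poly) = m" using degree_cheb[of "m - 1", where 'a = 'a] m by simp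
    have bound: "\<bar>s k - ln (w b)\<bar> \<le> ln 2 * (1 / real m) ^ k" for k
    proof -
      define M where "M = m ^ k"
      define c where "c = w b ^ M"
      have c1: "c \<ge> 1" unfolding c_def using that(2) by simp
      define v where "v = w (b ^ M + inverse b ^ M)"
      have vi: "w (inverse b ^ M) \<le> 1"
        using c1 by (simp add: power inverse power_inverse c_def inverse_le_1_iff)
      have "v \<le> c + 1" "c - 1 \<le> v"
        using triangle[of "b ^ M" "inverse b ^ M"] triangle_diff[of "b ^ M" "inverse b ^ M"] vi
        by (auto simp: v_def c_def power)
      hence v: "max v 1 \<le> 2 * c" "c / 2 \<le> max v 1" using c1 by (auto simp: max_def)
      have "ln (max v 1) \<le> ln (2 * c)" using v(1) c1 by (subst ln_le_cancel_iff) auto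
      moreover have "ln (c / 2) \<le> ln (max v 1)" using v(2) c1 by (subst ln_le_cancel_iff) auto
      ultimately have d: "\<bar>ln (max v 1) - ln c\<bar> \<le> ln 2" using c1 by (simp add: ln_mult ln_div)
      have lnc: "ln c = real M * ln (w b)" using pos[OF b] by (simp add: c_def ln_realpow)
      have sk: "s k = ln (max v 1) / real M"
        using b by (simp add: s_def v_def funpow_poly_cheb deg M_def)
      have M0: "real M > 0" using m by (simp add: M_def)
      have "s k - ln (w b) = (ln (max v 1) - ln c) / real M"
        unfolding sk lnc using M0 by (simp add: diff_divide_distrib)
      hence "\<bar>s k - ln (w b)\<bar> = \<bar>ln (max v 1) - ln c\<bar> / real M" by simp
      also have "\<dots> \<le> ln 2 / real M" using d M0 by (intro divide_right_mono) auto
      finally have "\<bar>s k - ln (w b)\<bar> \<le> ln 2 / real M" .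
      thus ?thesis by (simp add: M_def power_divide)
    qed
    have "(\<lambda>k. ln 2 * (1 / real m) ^ k) \<longlonglongrightarrow> 0"
      using m by (intro tendsto_mult_right_zero LIMSEQ_power_zero) auto
    hence "(\<lambda>k. s k - ln (w b)) \<longlonglongrightarrow> 0"
      by (rule Lim_null_comparison[rotated]) (use bound in auto)
    hence "s \<longlonglongrightarrow> ln (w b)" by (simp add: LIM_zero_iff)
    thus ?thesis unfolding local_height_def s_def[symmetric] by (rule limI)
  qed
  show ?thesis
  proof (cases "w b \<ge> 1")
    case True
    then show ?thesis using *[OF b] by simp
  next
    case False
    have "w (inverse b) \<ge> 1" using False pos[OF b] by (simp add: inverse one_le_inverse)
    hence "local_height w (cheb m) (inverse b + inverse (inverse b)) = ln (w (inverse b))"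
      using b by (intro *) auto
    thus ?thesis using False pos[OF b] by (simp add: inverse ln_inverse add.commute)
  qed
qed

end

subsection \<open>Non-archimedean absolute values\<close>

context absolute_value
begin

text \<open>Boundedness on the integers is chosen as the definition because its negation is the
  starting point of Ostrowski's argument; the ultrametric inequality is a consequence.\<close>

definition nonarch :: bool where "nonarch \<longleftrightarrow> (\<forall>n::nat. w (of_nat n) \<le> 1)"

text \<open>Binomial coefficients have absolute value at most 1, so the \<open>n\<close>-th power of
  \<open>w (x + y)\<close> exceeds that of the maximum by a factor \<open>n + 1\<close> at most.
  Such linear growth cannot compensate an exponential one.\<close>

lemma ultrametric:
  assumes na: nonarch
  shows "w (x + y) \<le> max (w x) (w y)"
proof -
  define m where "m = max (w x) (w y)"
  have m0: "m \<ge> 0" by (simp add: m_def max_def)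
  have "w (x + y) ^ n \<le> real (Suc n) * m ^ n" for n
  proof -
    have "w (x + y) ^ n = w (\<Sum>k\<le>n. of_nat (n choose k) * x ^ k * y ^ (n - k))"
      by (simp add: power[symmetric] binomial_ring)
    also have "\<dots> \<le> (\<Sum>k\<le>n. w (of_nat (n choose k) * x ^ k * y ^ (n - k)))" by (rule sum_le)
    also have "\<dots> \<le> (\<Sum>k\<le>n. m ^ n)"
    proof (rule sum_mono)
      fix k assume k: "k \<in> {..n}"
      have "w (of_nat (n choose k) * x ^ k * y ^ (n - k)) \<le> 1 * m ^ k * m ^ (n - k)"
        unfolding mult power using na m0 by (intro mult_mono power_mono) (auto simp: nonarch_def, auto simp: m_def)
      also have "\<dots> = m ^ n" using k by (simp flip: power_add)
      finally show "w (of_nat (n choose k) * x ^ k * y ^ (n - k)) \<le> m ^ n" .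
    qed
    finally show ?thesis by simp
  qed
  note pw = this
  have "w (x + y) \<le> m"
  proof (rule ccontr)
    assume "\<not> w (x + y) \<le> m"
    hence gt: "w (x + y) > m" by simp
    show False
    proof (cases "m = 0")
      case True
      hence "w (x + y) \<le> 0" using pw[of 1] by simp
      thus False using gt True by simp
    next
      case False
      define q where "q = w (x + y) / m"
      have q: "q > 1" using gt False m0 by (simp add: q_def)
      have "q ^ n \<le> real (Suc n)" for n
        using pw[of n] False m0 by (simp add: q_def power_divide divide_le_eq)
      moreover have "\<exists>n. real (Suc n) < q ^ n"
      proof -
        have "(\<lambda>n::nat. real (Suc n) / q ^ n) \<longlonglongrightarrow> 0" using q by real_asymp
        hence "eventually (\<lambda>n::nat. real (Suc n) / q ^ n < 1) sequentially" by (rule order_tendstoD) simp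
        then obtain n where "real (Suc n) / q ^ n < 1" by (auto simp: eventually_sequentially)
        thus ?thesis using q by (auto simp: divide_less_eq)
      qed
      ultimately show False by (meson not_less)
    qed
  qed
  thus ?thesis by (simp add: m_def)
qed

lemma ultrametric_eq:
  assumes na: nonarch and lt: "w x < w y"
  shows "w (x + y) = w y" "w (x - y) = w y"
proof -
  have *: "w (x + y) = w y" if "w x < w y" for x y
  proof -
    have "w y \<le> max (w (x + y)) (w (- x))" using ultrametric[OF na, of "x + y" "- x"] by simp
    thus ?thesis using ultrametric[OF na, of x y] that by auto
  qed
  show "w (x + y) = w y" using *[OF lt] .
  show "w (x - y) = w y" using *[of x "- y"] lt by simp
qed

text \<open>If \<open>p\<close> is the least positive integer with \<open>w p < 1\<close>, all
  smaller positive integers have absolute value 1, and by division with remainder so do all integers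
  not divisible by \<open>p\<close>. Hence \<open>w n\<close> is a power of \<open>w p\<close>, and
  \<open>p\<close> can be split off at most \<open>log 2 n\<close> times.\<close>

lemma nonarch_of_nat_ge:
  assumes na: nonarch and w0: "\<And>n. n > 0 \<Longrightarrow> (of_nat n :: 'a) \<noteq> 0"
  obtains q where "q > 0" "q \<le> 1" "\<And>n. n > 0 \<Longrightarrow> w (of_nat n) \<ge> q powr (log 2 (real n))"
proof (cases "\<exists>p>0. w (of_nat p) < 1")
  case False
  have "w (of_nat n) = 1" if "n > 0" for n
  proof -
    have "w (of_nat n) \<le> 1" using na by (simp add: nonarch_def)
    thus ?thesis using False that by (meson not_less order_antisym)
  qed
  thus ?thesis by (intro that[of 1]) auto
next
  case True
  define p where "p = (LEAST p. p > 0 \<and> w (of_nat p) < 1)"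
  have p: "p > 0" "w (of_nat p) < 1" using LeastI_ex[of "\<lambda>p. p > 0 \<and> w (of_nat p) < 1"] True by (auto simp: p_def)
  have least: "w (of_nat r) = 1" if "0 < r" "r < p" for r
  proof -
    have "\<not> w (of_nat r) < 1" using not_less_Least[of r "\<lambda>p. p > 0 \<and> w (of_nat p) < 1"] that by (auto simp: p_def)
    moreover have "w (of_nat r) \<le> 1" using na by (simp add: nonarch_def)
    ultimately show ?thesis by simp
  qed
  have p2: "p \<ge> 2" using p by (cases "p = 1") auto
  have coprime1: "w (of_nat n) = 1" if "\<not> p dvd n" for n
  proof -
    have r: "0 < n mod p" "n mod p < p" using that p by (auto simp: mod_eq_0_iff_dvd[symmetric])
    have "w (of_nat (p * (n div p))) = w (of_nat p) * w (of_nat (n div p))" by (simp add: mult)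
    also have "\<dots> \<le> w (of_nat p) * 1" using na by (intro mult_left_mono) (auto simp: nonarch_def)
    also have "\<dots> < w (of_nat (n mod p))" using p least[OF r] by simp
    finally have "w (of_nat (p * (n div p)) + of_nat (n mod p)) = w (of_nat (n mod p))"
      by (intro ultrametric_eq(1)[OF na])
    moreover have "(of_nat (p * (n div p)) + of_nat (n mod p) :: 'a) = of_nat n" by (simp flip: of_nat_add of_nat_mult)
    ultimately show ?thesis using least[OF r] by simp
  qed
  define q where "q = w (of_nat p)"
  have q: "q > 0" "q \<le> 1" using p w0[OF p(1)] pos by (auto simp: q_def less_imp_le)
  have "w (of_nat n) \<ge> q powr (log 2 (real n))" if n: "n > 0" for n
    using n
  proof (induction n rule: less_induct)
    case (less n)
    show ?case
    proof (cases "p dvd n")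
      case False
      have "q powr (log 2 (real n)) \<le> 1" using q less by (intro powr_le1) auto
      thus ?thesis using coprime1[OF False] by simp
    next
      case True
      then obtain k where k: "n = p * k" by blast
      have "k > 0" "k < n" using k less p2 by auto
      have "log 2 (real n) \<ge> 1 + log 2 (real k)"
      proof -
        have "log 2 (real n) = log 2 (real p) + log 2 (real k)" using k \<open>k > 0\<close> p by (simp add: log_mult)
        moreover have "log 2 (real p) \<ge> 1" using p2 by (simp add: le_log_iff)
        ultimately show ?thesis by simp
      qed
      hence "q powr (log 2 (real n)) \<le> q powr (1 + log 2 (real k))" using q by (intro powr_mono') auto
      also have "\<dots> = q * q powr (log 2 (real k))" using q by (simp add: powr_add)
      also have "\<dots> \<le> q * w (of_nat k)" using less(1)[OF \<open>k < n\<close> \<open>k > 0\<close>] q by (intro mult_left_mono) auto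
      also have "\<dots> = w (of_nat n)" using k by (simp add: mult q_def)
      finally show ?thesis .
    qed
  qed
  thus ?thesis using q by (intro that) auto
qed

text \<open>The product of all \<open>y - x^j\<close> and the sum
  \<open>1 + y + ... + y^(n-1)\<close> are monic of degree \<open>n - 1\<close> and share the
  \<open>n - 1\<close> roots \<open>x^j\<close>, so they agree; the value at 1 is taken.\<close>

lemma prod_one_minus_roots:
  fixes x :: 'a
  assumes n: "n > 0" and x: "x ^ n = 1" and prim: "\<And>k. 0 < k \<Longrightarrow> k < n \<Longrightarrow> x ^ k \<noteq> 1"
  shows "(\<Prod>j\<in>{1..<n}. 1 - x ^ j) = of_nat n"
proof -
  have x0: "x \<noteq> 0" using x n by (auto simp: power_0_left)
  have inj: "inj_on (\<lambda>j. x ^ j) {..<n}"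
  proof (rule linorder_inj_onI)
    fix i j assume "i < j" "i \<in> {..<n}" "j \<in> {..<n}"
    show "x ^ i \<noteq> x ^ j"
    proof
      assume "x ^ i = x ^ j"
      also have "x ^ j = x ^ i * x ^ (j - i)" unfolding power_add[symmetric] using \<open>i < j\<close> by simp
      finally have "x ^ (j - i) = 1" using x0 by simp
      thus False using prim[of "j - i"] \<open>i < j\<close> \<open>j \<in> {..<n}\<close> by (simp add: less_imp_diff_less)
    qed
  qed auto
  define P where "P = (\<Prod>j\<in>{1..<n}. [:- (x ^ j), 1:])"
  define S where "S = (\<Sum>j<n. monom (1::'a) j)"
  have evS: "poly S y = (\<Sum>j<n. y ^ j)" for y by (simp add: S_def poly_sum poly_monom)
  have degS: "coeff S i = (if i < n then 1 else 0)" for i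
    by (simp add: S_def coeff_sum coeff_monom if_distrib cong: if_cong)
  have degP: "degree P = n - 1" unfolding P_def by (subst degree_prod_eq_sum_degree) auto
  have lcP: "coeff P (n - 1) = 1"
  proof -
    have "lead_coeff P = 1" unfolding P_def by (simp add: lead_coeff_prod)
    thus ?thesis by (simp add: degP)
  qed
  have "S - P = 0"
  proof (rule ccontr)
    assume ne: "S - P \<noteq> 0"
    have deg: "degree (S - P) \<le> n - 1"
      by (rule degree_diff_le) (auto simp: degP degS intro!: degree_le)
    have "coeff (S - P) (n - 1) = 0" using n lcP by (simp add: degS)
    hence lt: "degree (S - P) < n - 1"
      using ne deg by (metis le_neq_implies_less leading_coeff_0_iff)
    have "poly (S - P) (x ^ j) = 0" if j: "j \<in> {1..<n}" for j
    proof -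
      have "(1 - x ^ j) * (\<Sum>i<n. (x ^ j) ^ i) = 1 - (x ^ j) ^ n" by (rule one_diff_power_eq[symmetric])
      also have "(x ^ j) ^ n = 1" by (metis power_mult mult.commute x power_one)
      finally have "(\<Sum>i<n. (x ^ j) ^ i) = 0" using prim[of j] j by auto
      moreover have "poly P (x ^ j) = 0" unfolding P_def poly_prod using j by (intro prod_zero) auto
      ultimately show ?thesis by (simp add: evS)
    qed
    hence "(\<lambda>j. x ^ j) ` {1..<n} \<subseteq> {y. poly (S - P) y = 0}" by auto
    hence "card ((\<lambda>j. x ^ j) ` {1..<n}) \<le> card {y. poly (S - P) y = 0}"
      by (intro card_mono poly_roots_finite[OF ne])
    also have "\<dots> \<le> degree (S - P)" by (rule card_poly_roots_bound[OF ne])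
    also have "card ((\<lambda>j. x ^ j) ` {1..<n}) = n - 1"
      by (subst card_image) (auto intro: inj_on_subset[OF inj])
    finally show False using lt by simp
  qed
  hence "poly S 1 = poly P 1" by simp
  thus ?thesis unfolding evS by (simp add: P_def poly_prod)
qed

text \<open>If \<open>x\<close> of exact order \<open>n\<close> is within \<open>r\<close> of 1, the
  ultrametric inequality puts all its powers within \<open>r\<close> of 1. The product formula then
  gives \<open>w n \<le> r^(n-1)\<close>, whereas \<open>w n\<close> decays at most like a power of
  \<open>n\<close>. So the order is bounded.\<close>

lemma finite_roots_near_one:
  assumes na: nonarch and w0: "\<And>n. n > 0 \<Longrightarrow> (of_nat n :: 'a) \<noteq> 0" and r: "0 < r" "r < 1"
  shows "finite {x. (\<exists>n>0. x ^ n = 1) \<and> w (1 - x) \<le> r}"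
proof -
  obtain q where q: "q > 0" "q \<le> 1" and qn: "\<And>n. n > 0 \<Longrightarrow> w (of_nat n) \<ge> q powr (log 2 (real n))"
    using nonarch_of_nat_ge[OF na w0] by blast
  have "((\<lambda>n::nat. r ^ (n - 1) / q powr (log 2 (real n))) \<longlongrightarrow> 0) sequentially"
    using r q by real_asymp
  hence "eventually (\<lambda>n::nat. r ^ (n - 1) / q powr (log 2 (real n)) < 1) sequentially"
    by (rule order_tendstoD) simp
  then obtain n0 where n0: "\<And>n. n \<ge> n0 \<Longrightarrow> r ^ (n - 1) / q powr (log 2 (real n)) < 1"
    by (auto simp: eventually_sequentially)
  have "{x. (\<exists>n>0. x ^ n = 1) \<and> w (1 - x) \<le> r} \<subseteq> (\<Union>n\<in>{1..n0}. {x. poly (monom 1 n - 1) x = 0})"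
  proof
    fix x assume "x \<in> {x. (\<exists>n>0. x ^ n = 1) \<and> w (1 - x) \<le> r}"
    hence ex: "\<exists>n>0. x ^ n = 1" and wx: "w (1 - x) \<le> r" by auto
    define n where "n = (LEAST n. n > 0 \<and> x ^ n = 1)"
    have n: "n > 0" "x ^ n = 1" using LeastI_ex[of "\<lambda>n. n > 0 \<and> x ^ n = 1"] ex by (auto simp: n_def)
    have prim: "x ^ k \<noteq> 1" if "0 < k" "k < n" for k
      using not_less_Least[of k "\<lambda>n. n > 0 \<and> x ^ n = 1"] that by (auto simp: n_def)
    have wx1: "w x = 1" using root_of_unity[OF n(2,1)] .
    have "w (1 - x ^ j) \<le> r" if "j > 0" for j
      using that
    proof (induction j)
      case (Suc j)
      show ?case
      proof (cases "j = 0")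
        case False
        have "1 - x ^ Suc j = (1 - x) + x * (1 - x ^ j)" by (simp add: algebra_simps)
        hence "w (1 - x ^ Suc j) \<le> max (w (1 - x)) (w (x * (1 - x ^ j)))" using ultrametric[OF na] by metis
        thus ?thesis using Suc False wx by (simp add: mult wx1)
      qed (use wx in simp)
    qed simp
    hence "(\<Prod>j\<in>{1..<n}. w (1 - x ^ j)) \<le> (\<Prod>j\<in>{1..<n}. r)" by (intro prod_mono) auto
    hence "w (of_nat n) \<le> r ^ (n - 1)" using prod_one_minus_roots[OF n prim] by (simp flip: prod)
    hence "q powr (log 2 (real n)) \<le> r ^ (n - 1)" using qn[OF n(1)] by linarith
    moreover have "q powr (log 2 (real n)) > 0" using q by simp
    ultimately have "n < n0" using n0[of n] by (cases "n \<ge> n0") (auto simp: divide_less_eq)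
    thus "x \<in> (\<Union>n\<in>{1..n0}. {x. poly (monom 1 n - 1) x = 0})"
      using n by (intro UN_I[of n]) (auto simp: poly_monom)
  qed
  moreover have "finite {x :: 'a. poly (monom 1 n - 1) x = 0}" if "n \<in> {1..n0}" for n
  proof (rule poly_roots_finite)
    show "monom (1::'a) n - 1 \<noteq> 0"
    proof
      assume "monom (1::'a) n - 1 = 0"
      hence "coeff (monom (1::'a) n - 1) n = 0" by simp
      thus False using that by simp
    qed
  qed
  ultimately show ?thesis by (meson finite_UN_I finite_atLeastAtMost finite_subset)
qed

text \<open>The quotient of two roots of unity within \<open>r\<close> of \<open>b\<close> is a root
  of unity within \<open>r\<close> of 1, so one of them can serve as a base point.\<close>

lemma finite_roots_near:
  assumes na: nonarch and w0: "\<And>n. n > 0 \<Longrightarrow> (of_nat n :: 'a) \<noteq> 0" and r: "0 < r" "r < 1"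
  shows "finite {x. (\<exists>n>0. x ^ n = 1) \<and> w (x - b) \<le> r}"
proof (cases "{x. (\<exists>n>0. x ^ n = 1) \<and> w (x - b) \<le> r} = {}")
  case False
  then obtain y n where y: "n > 0" "y ^ n = 1" "w (y - b) \<le> r" by blast
  have wy: "w y = 1" "y \<noteq> 0" using root_of_unity[OF y(2,1)] by auto
  have "{x. (\<exists>n>0. x ^ n = 1) \<and> w (x - b) \<le> r} \<subseteq> (\<lambda>t. y * t) ` {x. (\<exists>n>0. x ^ n = 1) \<and> w (1 - x) \<le> r}"
  proof
    fix x assume "x \<in> {x. (\<exists>n>0. x ^ n = 1) \<and> w (x - b) \<le> r}"
    then obtain k where x: "k > 0" "x ^ k = 1" "w (x - b) \<le> r" by blast
    have "(y - b) + - (x - b) = y * (1 - x / y)" using wy by (simp add: field_simps)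
    hence "w (y * (1 - x / y)) \<le> max (w (y - b)) (w (- (x - b)))" using ultrametric[OF na] by metis
    moreover have "w (- (x - b)) \<le> r" using x(3) minus[of "x - b"] by simp
    ultimately have "w (1 - x / y) \<le> r" using y(3) wy by (simp add: mult)
    moreover have "(x / y) ^ (k * n) = 1"
    proof -
      have "x ^ (k * n) = 1" by (simp add: power_mult x)
      moreover have "y ^ (k * n) = 1" by (simp add: mult.commute[of k] power_mult y)
      ultimately show ?thesis by (simp add: power_divide)
    qed
    moreover have "k * n > 0" using x y by simp
    ultimately have "w (1 - x / y) \<le> r \<and> (\<exists>n>0. (x / y) ^ n = 1)" by blast
    thus "x \<in> (\<lambda>t. y * t) ` {x. (\<exists>n>0. x ^ n = 1) \<and> w (1 - x) \<le> r}"
      using wy by (intro image_eqI[of _ _ "x / y"]) auto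
  qed
  thus ?thesis using finite_roots_near_one[OF na w0 r] finite_surj by blast
next
  case True
  show ?thesis unfolding True by simp
qed

end

subsection \<open>Minimal polynomials and embeddings\<close>

lemma poly_ideal_generator:
  fixes J :: "'a :: field poly set"
  assumes g: "g \<in> J" "g \<noteq> 0" and J: "\<And>p q r. p \<in> J \<Longrightarrow> q \<in> J \<Longrightarrow> p - r * q \<in> J"
  obtains d where "d \<in> J" "d \<noteq> 0" "\<And>q. q \<in> J \<Longrightarrow> d dvd q"
proof -
  define P where "P = (\<lambda>n. \<exists>d\<in>J. d \<noteq> 0 \<and> degree d = n)"
  have "P (degree g)" using g by (auto simp: P_def)
  hence "P (LEAST n. P n)" by (rule LeastI)
  then obtain d where d: "d \<in> J" "d \<noteq> 0" "degree d = (LEAST n. P n)" unfolding P_def by blast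
  have "d dvd q" if q: "q \<in> J" for q
  proof -
    have mem: "q mod d \<in> J" using J[OF q d(1), of "q div d"] by (simp add: minus_div_mult_eq_mod)
    have "q mod d = 0"
    proof (rule ccontr)
      assume ne: "q mod d \<noteq> 0"
      hence "degree (q mod d) < degree d" using d(2) degree_mod_less by blast
      moreover have "P (degree (q mod d))" using mem ne by (auto simp: P_def)
      ultimately show False using not_less_Least d(3) by metis
    qed
    thus ?thesis by (simp add: mod_eq_0_iff_dvd)
  qed
  thus ?thesis using d that by blast
qed

abbreviation ac_poly :: "'k :: field poly \<Rightarrow> 'k alg_closure poly" where "ac_poly \<equiv> map_poly to_ac"

interpretation to_ac: field_hom "to_ac :: 'k :: field \<Rightarrow> 'k alg_closure"
  by unfold_locales auto

text \<open>The polynomial is fixed only up to a constant factor; what matters is its degree, its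
  roots and divisibility by it.\<close>

definition is_minpoly :: "'k :: field alg_closure \<Rightarrow> 'k poly \<Rightarrow> bool" where
  "is_minpoly x g \<longleftrightarrow> g \<noteq> 0 \<and> poly (ac_poly g) x = 0 \<and> (\<forall>q. poly (ac_poly q) x = 0 \<longrightarrow> g dvd q)"

lemma minpoly_exists:
  fixes x :: "'k :: field alg_closure"
  obtains g where "is_minpoly x g"
proof -
  interpret ph: map_poly_inj_idom_hom "to_ac :: 'k \<Rightarrow> 'k alg_closure" ..
  obtain p :: "'k poly" where p: "p \<noteq> 0" "poly (map_poly to_ac p) x = 0" by (rule alg_closure_algebraic)
  obtain g where "g \<in> {q. poly (ac_poly q) x = 0}" "g \<noteq> 0" "\<And>q. q \<in> {q. poly (ac_poly q) x = 0} \<Longrightarrow> g dvd q"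
    by (rule poly_ideal_generator[of p "{q. poly (ac_poly q) x = 0}"]) (use p in \<open>auto simp: hom_distribs\<close>)
  thus ?thesis by (intro that[of g]) (auto simp: is_minpoly_def)
qed

lemma minpoly_factor_cases:
  assumes g: "is_minpoly x g" and e: "g = d * e"
  shows "g dvd d \<or> degree d = 0"
proof -
  interpret ph: map_poly_inj_idom_hom "to_ac :: 'k :: field \<Rightarrow> 'k alg_closure" ..
  have "poly (ac_poly d) x * poly (ac_poly e) x = 0" using g unfolding is_minpoly_def e by (simp add: hom_distribs)
  hence "poly (ac_poly d) x = 0 \<or> poly (ac_poly e) x = 0" by simp
  thus ?thesis
  proof
    assume "poly (ac_poly e) x = 0"
    hence "g dvd e" using g by (simp add: is_minpoly_def)
    moreover have "e \<noteq> 0" "d \<noteq> 0" using e g by (auto simp: is_minpoly_def)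
    ultimately have "degree g \<le> degree e" by (intro dvd_imp_degree_le)
    moreover have "degree g = degree d + degree e" unfolding e by (rule degree_mult_eq) fact+
    ultimately show ?thesis by simp
  qed (use g in \<open>auto simp: is_minpoly_def\<close>)
qed

text \<open>This is the means of transporting relations between conjugates. The polynomials over the
  base field that vanish at \<open>y\<close> are generated by a nonconstant divisor of
  \<open>g\<close>, which irreducibility makes an associate of \<open>g\<close>. So a relation that
  holds at one root of \<open>g\<close>, under any embedding, is a multiple of
  \<open>g\<close>.\<close>

lemma minpoly_dvd_of_common_root:
  fixes j :: "'k :: field \<Rightarrow> 'b :: field"
  assumes g: "is_minpoly x g" and j: "field_hom j"
    and y: "poly (map_poly j g) y = 0" and q: "poly (map_poly j q) y = 0"
  shows "g dvd q"
proof -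
  interpret j: field_hom j by fact
  interpret pj: map_poly_inj_idom_hom j ..
  define J where "J = {q. poly (map_poly j q) y = 0}"
  have gJ: "g \<in> J" "g \<noteq> 0" using g y by (simp_all add: is_minpoly_def J_def)
  have "p - r * q \<in> J" if "p \<in> J" "q \<in> J" for p q r using that by (simp add: J_def hom_distribs)
  then obtain d where d: "d \<in> J" "d \<noteq> 0" "\<And>q. q \<in> J \<Longrightarrow> d dvd q"
    using poly_ideal_generator[OF gJ] by metis
  have "d dvd g" "d dvd q" using d(3) y q by (simp_all add: J_def)
  then obtain e where e: "g = d * e" by blast
  have "degree d \<noteq> 0"
  proof
    assume "degree d = 0"
    then obtain c where "d = [:c:]" by (rule degree_eq_zeroE)
    thus False using d(1,2) by (simp add: J_def)
  qed
  hence "g dvd d" using minpoly_factor_cases[OF g e] by simp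
  thus ?thesis using \<open>d dvd q\<close> by (rule dvd_trans)
qed

lemma minpoly_degree_pos: "is_minpoly x g \<Longrightarrow> degree g > 0"
proof (rule ccontr)
  assume g: "is_minpoly x g" "\<not> degree g > 0"
  then obtain c where "g = [:c:]" by (auto elim: degree_eq_zeroE)
  thus False using g by (auto simp: is_minpoly_def)
qed

lemma card_roots_simple:
  fixes p :: "'a :: alg_closed_field poly"
  assumes p: "p \<noteq> 0" and simple: "\<And>y. poly p y = 0 \<Longrightarrow> poly (pderiv p) y \<noteq> 0"
  shows "card {y. poly p y = 0} = degree p"
proof -
  obtain A where A: "size A = degree p" "p = smult (lead_coeff p) (\<Prod>x\<in>#A. [:-x, 1:])"
    using alg_closed_imp_factorization[OF p] by blast
  define c where "c = lead_coeff p"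
  have c: "c \<noteq> 0" using p by (simp add: c_def)
  have roots: "{y. poly p y = 0} = set_mset A"
  proof -
    have "poly p y = c * (\<Prod>x\<in>#A. y - x)" for y
      by (subst A(2)) (simp add: c_def poly_prod_mset image_mset.compositionality o_def)
    thus ?thesis using c by (auto simp: prod_mset_zero_iff)
  qed
  have "count A y = 1" if "y \<in># A" for y
  proof (rule ccontr)
    assume "count A y \<noteq> 1"
    moreover have "count A y > 0" using that by simp
    ultimately have "count A y \<ge> 2" by linarith
    hence "{#y, y#} \<subseteq># A" by (auto simp: subseteq_mset_def)
    then obtain C where C: "A = {#y, y#} + C" by (auto simp: mset_subset_eq_exists_conv)
    define r where "r = smult c (\<Prod>x\<in>#C. [:-x, 1:])"
    have "p = [:-y, 1:] * ([:-y, 1:] * r)"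
      by (subst A(2)) (simp add: C r_def c_def del: mult_pCons_left)
    hence "poly (pderiv p) y = 0" by (simp add: pderiv_mult del: mult_pCons_left)
    moreover have "poly p y = 0" using that roots by auto
    ultimately show False using simple by blast
  qed
  hence "A = mset_set (set_mset A)"
    by (intro multiset_eqI) (auto simp: count_mset_set' not_in_iff)
  hence "card (set_mset A) = size A" by (metis size_mset_set)
  thus ?thesis by (simp add: roots A(1))
qed

text \<open>A multiple root would be shared with the derivative, so \<open>g\<close> would divide
  the derivative, which has smaller degree and is nonzero in characteristic 0.\<close>

lemma card_minpoly_roots:
  fixes j :: "'k :: field_char_0 \<Rightarrow> 'b :: alg_closed_field"
  assumes g: "is_minpoly x g" and j: "field_hom j"
  shows "card {y. poly (map_poly j g) y = 0} = degree g"
proof -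
  interpret j: field_hom j by fact
  interpret pj: map_poly_inj_idom_hom j ..
  have "card {y. poly (map_poly j g) y = 0} = degree (map_poly j g)"
  proof (rule card_roots_simple)
    show "map_poly j g \<noteq> 0" using g by (simp add: is_minpoly_def)
    fix y assume y: "poly (map_poly j g) y = 0"
    show "poly (pderiv (map_poly j g)) y \<noteq> 0"
    proof
      assume "poly (pderiv (map_poly j g)) y = 0"
      hence "g dvd pderiv g" by (intro minpoly_dvd_of_common_root[OF g j y]) (simp add: hom_distribs)
      moreover have "pderiv g \<noteq> 0" using minpoly_degree_pos[OF g] by (simp add: pderiv_eq_0_iff)
      ultimately have "degree g \<le> degree (pderiv g)" by (rule dvd_imp_degree_le)
      thus False using minpoly_degree_pos[OF g] by (simp add: degree_pderiv)
    qed
  qed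
  thus ?thesis by simp
qed

section \<open>Simple extensions, their embeddings and degrees\<close>

lemma adjoin_eq:
  fixes x :: "'k :: field alg_closure"
  shows "adjoin x = range (\<lambda>p. poly (ac_poly p) x)" (is "_ = ?R")
proof
  interpret ph: map_poly_inj_idom_hom "to_ac :: 'k \<Rightarrow> 'k alg_closure" ..
  have "is_subfield ?R"
    unfolding is_subfield_def
  proof (intro conjI ballI)
    show "1 \<in> ?R" by (rule range_eqI[of _ _ 1]) simp
    fix a assume "a \<in> ?R"
    then obtain p where p: "a = poly (ac_poly p) x" by blast
    show "inverse a \<in> ?R"
    proof (cases "a = 0")
      case True
      then show ?thesis by (intro range_eqI[of _ _ 0]) simp
    next
      case False
      \<comment> \<open>The minimal polynomial of \<open>a\<close> has nonzero constant term
        \<open>c\<close>, so the equation \<open>c + a r (a) = 0\<close> exhibits the inverse of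
        \<open>a\<close> as a polynomial in \<open>a\<close>, hence in \<open>x\<close>.\<close>
      obtain q where q: "is_minpoly a q" by (rule minpoly_exists)
      obtain c r where cr: "q = pCons c r" by (cases q)
      have eq: "to_ac c + a * poly (ac_poly r) a = 0" using q by (simp add: is_minpoly_def cr hom_distribs)
      have "c \<noteq> 0"
      proof
        assume "c = 0"
        hence "q dvd r" using eq False q by (simp add: is_minpoly_def)
        moreover have "r \<noteq> 0" using q \<open>c = 0\<close> cr by (auto simp: is_minpoly_def)
        ultimately have "degree q \<le> degree r" by (rule dvd_imp_degree_le)
        thus False using \<open>r \<noteq> 0\<close> by (simp add: cr)
      qed
      have "a * (- poly (ac_poly r) a / to_ac c) = 1" using eq \<open>c \<noteq> 0\<close> by (simp add: field_simps add_eq_0_iff)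
      hence "inverse a = - poly (ac_poly r) a / to_ac c" by (rule inverse_unique)
      also have "\<dots> = poly (ac_poly (smult (- 1 / c) (pcompose r p))) x"
        by (simp add: hom_distribs p poly_pcompose to_ac.map_poly_pcompose)
      finally show ?thesis by blast
    qed
    fix b assume "b \<in> ?R"
    then obtain q where q: "b = poly (ac_poly q) x" by blast
    show "a - b \<in> ?R" by (rule range_eqI[of _ _ "p - q"]) (simp add: hom_distribs p q)
    show "a * b \<in> ?R" by (rule range_eqI[of _ _ "p * q"]) (simp add: hom_distribs p q)
  qed
  moreover have "range to_ac \<subseteq> ?R"
  proof
    fix a :: "'k alg_closure" assume "a \<in> range to_ac"
    then obtain c where "a = to_ac c" by blast
    thus "a \<in> ?R" by (intro range_eqI[of _ _ "[:c:]"]) (simp add: hom_distribs)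
  qed
  moreover have "x \<in> ?R" by (rule range_eqI[of _ _ "[:0, 1:]"]) (simp add: hom_distribs)
  ultimately show "adjoin x \<subseteq> ?R" unfolding adjoin_def by blast
  show "?R \<subseteq> adjoin x"
    unfolding adjoin_def
  proof (intro Inter_greatest subsetI)
    fix F a assume "F \<in> {F. is_subfield F \<and> range to_ac \<subseteq> F \<and> x \<in> F}" and "a \<in> ?R"
    then obtain p where F: "is_subfield F" "range to_ac \<subseteq> F" "x \<in> F" and a: "a = poly (ac_poly p) x" by blast
    have add: "u + v \<in> F" if "u \<in> F" "v \<in> F" for u v
    proof -
      have "0 \<in> F" using F(2) to_ac_0 by (metis range_eqI subsetD)
      hence "0 - v \<in> F" using F(1) that by (auto simp: is_subfield_def)
      hence "u - (0 - v) \<in> F" using F(1) that unfolding is_subfield_def by blast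
      thus ?thesis by simp
    qed
    have "poly (ac_poly p) x \<in> F"
    proof (induction p)
      case 0
      have "to_ac 0 \<in> F" using F(2) by blast
      thus ?case by simp
    next
      case (pCons c p)
      have "to_ac c \<in> F" using F(2) by blast
      moreover have "x * poly (ac_poly p) x \<in> F" using F(1,3) pCons unfolding is_subfield_def by blast
      ultimately show ?case using add by (simp add: hom_distribs)
    qed
    thus "a \<in> F" by (simp add: a)
  qed
qed

lemma embedding_poly:
  assumes \<sigma>: "\<sigma> \<in> embeddings_over j (adjoin x)"
  shows "\<sigma> (poly (ac_poly p) x) = poly (map_poly j p) (\<sigma> x)"
proof -
  interpret ph: map_poly_inj_idom_hom "to_ac :: 'k :: field \<Rightarrow> 'k alg_closure" ..
  have hom: "\<sigma> (u + v) = \<sigma> u + \<sigma> v" "\<sigma> (u * v) = \<sigma> u * \<sigma> v" if "u \<in> adjoin x" "v \<in> adjoin x" for u v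
    using \<sigma> that by (auto simp: embeddings_over_def)
  have c: "\<sigma> (to_ac c) = j c" for c using \<sigma> by (auto simp: embeddings_over_def)
  have mem: "poly (ac_poly q) x \<in> adjoin x" for q unfolding adjoin_eq by blast
  have memc: "to_ac c \<in> adjoin x" for c using mem[of "[:c:]"] by (simp add: hom_distribs)
  have memx: "x \<in> adjoin x" using mem[of "[:0, 1:]"] by (simp add: hom_distribs)
  \<comment> \<open>Nothing is assumed about \<open>j\<close> itself; additivity is inherited from
    the embedding, which agrees with \<open>j\<close> on constants.\<close>
  have j0: "j 0 = 0"
  proof -
    have "j (0 + 0) = \<sigma> (to_ac 0 + to_ac 0)" by (simp only: c[symmetric] to_ac_add)
    also have "\<dots> = j 0 + j 0" by (simp only: hom(1)[OF memc memc] c)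
    finally have "j 0 = j 0 + j 0" by (simp only: add_0_left)
    thus ?thesis by (rule add_cancel_right_right[THEN iffD1])
  qed
  show ?thesis
  proof (induction p)
    case 0
    have "\<sigma> 0 = j 0" using c[of 0] by simp
    thus ?case using j0 by simp
  next
    case (pCons a p)
    have mx: "x * poly (ac_poly p) x \<in> adjoin x" using mem[of "[:0, 1:] * p"] by (simp add: hom_distribs)
    have "\<sigma> (poly (ac_poly (pCons a p)) x) = \<sigma> (to_ac a + x * poly (ac_poly p) x)" by (simp add: hom_distribs)
    also have "\<dots> = j a + \<sigma> x * \<sigma> (poly (ac_poly p) x)" by (simp add: hom(1)[OF memc mx] hom(2)[OF memx mem] c)
    finally show ?case using pCons by (simp add: map_poly_pCons j0)
  qed
qed

text \<open>This turns the sum over embeddings in the theorem into a sum over the roots of the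
  minimal polynomial.\<close>

lemma bij_betw_embeddings:
  fixes j :: "'k :: field \<Rightarrow> 'b :: field"
  assumes g: "is_minpoly x g" and j: "field_hom j"
  shows "bij_betw (\<lambda>\<sigma>. \<sigma> x) (embeddings_over j (adjoin x)) {y. poly (map_poly j g) y = 0}"
proof -
  interpret j: field_hom j by fact
  interpret pj: map_poly_inj_idom_hom j ..
  interpret ph: map_poly_inj_idom_hom "to_ac :: 'k \<Rightarrow> 'k alg_closure" ..
  show ?thesis unfolding bij_betw_def
  proof
    show "inj_on (\<lambda>\<sigma>. \<sigma> x) (embeddings_over j (adjoin x))"
    proof (rule inj_onI, rule ext)
      fix \<sigma> \<tau> a assume \<sigma>: "\<sigma> \<in> embeddings_over j (adjoin x)" "\<tau> \<in> embeddings_over j (adjoin x)" "\<sigma> x = \<tau> x"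
      show "\<sigma> a = \<tau> a"
      proof (cases "a \<in> adjoin x")
        case True
        then obtain p where "a = poly (ac_poly p) x" unfolding adjoin_eq by blast
        thus ?thesis using \<sigma> by (simp add: embedding_poly)
      next
        case False
        thus ?thesis using \<sigma> by (auto simp: embeddings_over_def extensional_def)
      qed
    qed
    show "(\<lambda>\<sigma>. \<sigma> x) ` embeddings_over j (adjoin x) = {y. poly (map_poly j g) y = 0}"
    proof safe
      fix \<sigma> assume \<sigma>: "\<sigma> \<in> embeddings_over j (adjoin x)"
      have "poly (map_poly j g) (\<sigma> x) = \<sigma> (poly (ac_poly g) x)" using embedding_poly[OF \<sigma>] by simp
      also have "\<dots> = \<sigma> (to_ac 0)" using g by (simp add: is_minpoly_def)
      also have "\<dots> = j 0" using \<sigma> unfolding embeddings_over_def by blast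
      also have "\<dots> = 0" by simp
      finally show "poly (map_poly j g) (\<sigma> x) = 0" .
    next
      fix y assume y: "poly (map_poly j g) y = 0"
      \<comment> \<open>The value is computed from an arbitrary polynomial representing
        \<open>a\<close>. Two representatives differ by a multiple of \<open>g\<close>, which
        vanishes at \<open>y\<close>, so the choice does not matter.\<close>
      define \<sigma> where "\<sigma> = (\<lambda>a. if a \<in> adjoin x then poly (map_poly j (SOME p. a = poly (ac_poly p) x)) y else undefined)"
      have \<sigma>: "\<sigma> (poly (ac_poly p) x) = poly (map_poly j p) y" for p
      proof -
        define q where "q = (SOME q. poly (ac_poly p) x = poly (ac_poly q) x)"
        have q: "poly (ac_poly p) x = poly (ac_poly q) x" unfolding q_def by (rule someI[of _ p]) simp
        hence "poly (ac_poly (q - p)) x = 0" by (simp add: hom_distribs)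
        hence "g dvd q - p" using g by (simp add: is_minpoly_def)
        then obtain r where "q - p = g * r" by blast
        hence "q = p + g * r" by (simp add: algebra_simps)
        hence "poly (map_poly j q) y = poly (map_poly j p) y" using y by (simp add: hom_distribs)
        thus ?thesis by (simp add: \<sigma>_def adjoin_eq q_def)
      qed
      have "\<sigma> \<in> embeddings_over j (adjoin x)"
        unfolding embeddings_over_def
      proof (intro CollectI conjI ballI allI)
        show "\<sigma> \<in> extensional (adjoin x)" by (simp add: \<sigma>_def extensional_def)
        show "\<sigma> (to_ac c) = j c" for c using \<sigma>[of "[:c:]"] by (simp add: hom_distribs)
        fix u v assume "u \<in> adjoin x" "v \<in> adjoin x"
        then obtain p q where pq: "u = poly (ac_poly p) x" "v = poly (ac_poly q) x" unfolding adjoin_eq by blast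
        show "\<sigma> (u + v) = \<sigma> u + \<sigma> v" using \<sigma>[of "p + q"] by (simp add: pq \<sigma> hom_distribs)
        show "\<sigma> (u * v) = \<sigma> u * \<sigma> v" using \<sigma>[of "p * q"] by (simp add: pq \<sigma> hom_distribs)
      qed
      moreover have "\<sigma> x = y" using \<sigma>[of "[:0, 1:]"] by (simp add: hom_distribs)
      ultimately show "y \<in> (\<lambda>\<sigma>. \<sigma> x) ` embeddings_over j (adjoin x)" by blast
    qed
  qed
qed

lemma ext_degree_adjoin:
  fixes x :: "'k :: field alg_closure"
  assumes g: "is_minpoly x g"
  shows "ext_degree (adjoin x) = degree g"
proof -
  interpret ph: map_poly_inj_idom_hom "to_ac :: 'k \<Rightarrow> 'k alg_closure" ..
  interpret vs: vector_space "\<lambda>(c::'k) y. to_ac c * y"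
    by unfold_locales (auto simp: algebra_simps)
  define d where "d = degree g"
  have zero: "p = 0" if "poly (ac_poly p) x = 0" "degree p < d" for p
  proof (rule ccontr)
    assume "p \<noteq> 0"
    moreover have "g dvd p" using g that by (simp add: is_minpoly_def)
    ultimately have "d \<le> degree p" unfolding d_def by (intro dvd_imp_degree_le)
    thus False using that by simp
  qed
  have d0: "d > 0" using minpoly_degree_pos[OF g] by (simp add: d_def)
  have lin: "f i = 0" if f: "(\<Sum>i<d. to_ac (f i) * x ^ i) = 0" and i: "i < d" for f i
  proof -
    define p where "p = (\<Sum>i<d. monom (f i) i)"
    have cp: "coeff p i = (if i < d then f i else 0)" for i
      by (simp add: p_def coeff_sum coeff_monom if_distrib cong: if_cong)
    have "degree p \<le> d - 1" by (rule degree_le) (auto simp: cp)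
    hence deg: "degree p < d" using d0 by simp
    have "poly (ac_poly p) x = (\<Sum>i<d. to_ac (coeff p i) * x ^ i)"
      using poly_as_sum[of "ac_poly p" d x] deg by simp
    also have "\<dots> = 0" using f cp by simp
    finally have "p = 0" using deg zero by blast
    thus ?thesis using cp[of i] i by simp
  qed
  \<comment> \<open>Bases are sets, so the powers must be distinct for their number to be
    \<open>d\<close>; a coincidence would be a relation of degree less than
    \<open>d\<close>.\<close>
  have inj: "inj_on (\<lambda>i. x ^ i) {..<d}"
  proof (rule inj_onI)
    fix a b assume ab: "a \<in> {..<d}" "b \<in> {..<d}" "x ^ a = x ^ b"
    show "a = b"
    proof (rule ccontr)
      assume ne: "a \<noteq> b"
      have "(\<Sum>i<d. to_ac (if i = a then 1 else if i = b then - 1 else 0) * x ^ i) =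
        (\<Sum>i<d. (if i = a then x ^ a else 0) - (if i = b then x ^ b else 0))"
        by (intro sum.cong) (use ne in auto)
      also have "\<dots> = 0" using ab by (simp add: sum_subtractf)
      finally have "(if a = a then 1 else if a = b then - 1 else 0) = (0::'k)"
        by (rule lin[where f = "\<lambda>i. if i = a then 1 else if i = b then - 1 else 0"]) (use ab in auto)
      thus False by simp
    qed
  qed
  define C where "C = (\<lambda>i. x ^ i) ` {..<d}"
  have "card C = vs.dim (adjoin x)"
  proof (rule vs.basis_card_eq_dim)
    show "C \<subseteq> adjoin x"
    proof
      fix a assume "a \<in> C"
      then obtain i where "a = x ^ i" by (auto simp: C_def)
      hence "a = poly (ac_poly (monom 1 i)) x" by (simp add: poly_monom)
      thus "a \<in> adjoin x" unfolding adjoin_eq by blast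
    qed
    show "vs.independent C"
    proof (rule vs.independent_if_scalars_zero)
      fix f a assume f: "(\<Sum>a\<in>C. to_ac (f a) * a) = 0" and "a \<in> C"
      then obtain i where i: "i < d" "a = x ^ i" by (auto simp: C_def)
      have "(\<Sum>i<d. to_ac (f (x ^ i)) * x ^ i) = 0" using f unfolding C_def by (simp add: sum.reindex[OF inj])
      thus "f a = 0" using lin[of "\<lambda>i. f (x ^ i)"] i by simp
    qed (simp add: C_def)
    show "adjoin x \<subseteq> vs.span C"
    proof
      fix a assume "a \<in> adjoin x"
      then obtain p where p: "a = poly (ac_poly p) x" unfolding adjoin_eq by blast
      define r where "r = p mod g"
      have "p = g * (p div g) + r" by (simp add: r_def)
      then obtain s where "p = g * s + r" by blast
      hence "a = poly (ac_poly r) x" using g unfolding p is_minpoly_def by (simp add: hom_distribs)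
      moreover have "degree r < d" using degree_mod_less[of g p] g d0 by (auto simp: r_def d_def is_minpoly_def)
      ultimately have "a = (\<Sum>i<d. to_ac (coeff r i) * x ^ i)" using poly_as_sum[of "ac_poly r" d x] by simp
      also have "\<dots> \<in> vs.span C"
        by (intro vs.span_sum vs.span_scale vs.span_base) (auto simp: C_def)
      finally show "a \<in> vs.span C" .
    qed
  qed
  moreover have "card C = d" unfolding C_def using card_image[OF inj] by simp
  ultimately show ?thesis by (simp add: ext_degree_def d_def)
qed

subsection \<open>Degrees of roots of unity\<close>

lemma clear_denominators:
  fixes q :: "'i \<Rightarrow> rat"
  assumes "finite I"
  shows "\<exists>c::int. c > 0 \<and> (\<forall>i\<in>I. \<exists>z::int. of_int c * q i = of_int z)"
  using assms
proof (induction I)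
  case (insert i I)
  then obtain c where c: "c > 0" "\<forall>i\<in>I. \<exists>z::int. of_int c * q i = of_int z" by blast
  obtain a b where ab: "quotient_of (q i) = (a, b)" by fastforce
  have b: "b > 0" "q i = of_int a / of_int b" using quotient_of_denom_pos[OF ab] quotient_of_div[OF ab] by auto
  have "\<exists>z::int. of_int (c * b) * q k = of_int z" if "k \<in> insert i I" for k
  proof (cases "k = i")
    case True
    have "of_int (c * b) * q k = of_int (c * a)" unfolding True b(2) using b(1) by simp
    thus ?thesis by (rule exI)
  next
    case False
    hence "k \<in> I" using that by simp
    then obtain z where "of_int c * q k = of_int z" using c(2) by (elim ballE exE) auto
    thus ?thesis by (intro exI[of _ "b * z"]) (simp add: mult_ac)
  qed
  thus ?case using c b by (intro exI[of _ "c * b"]) auto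
qed (auto intro: exI[of _ 1])

lemma vector_space_of_rat: "vector_space (\<lambda>(q::rat) (x::'a::field_char_0). of_rat q * x)"
  by unfold_locales (auto simp: algebra_simps of_rat_add of_rat_mult)

text \<open>The bound on the degree is the point: it compares the degree of a root of unity with the
  size of a spanning set of a field that contains it.\<close>

lemma algebraic_of_finite_span:
  fixes x :: "'a :: field_char_0"
  assumes T: "finite T" and span: "\<And>n. x ^ n \<in> module.span (\<lambda>(q::rat) (x::'a). of_rat q * x) T"
  shows "\<exists>f::int poly. f \<noteq> 0 \<and> degree f \<le> card T \<and> poly (map_poly of_int f) x = 0"
proof -
  interpret vq: vector_space "\<lambda>(q::rat) (x::'a). of_rat q * x" by (rule vector_space_of_rat)
  define m where "m = card T"
  show ?thesis
  \<comment> \<open>If two powers coincide, the set of powers is too small to be forced into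
    dependence, but the difference of two monomials is a relation already.\<close>
  proof (cases "inj_on (\<lambda>n. x ^ n) {..m}")
    case False
    then obtain a b where ab: "a \<le> m" "b \<le> m" "a \<noteq> b" "x ^ a = x ^ b" by (auto simp: inj_on_def)
    define f where "f = monom (1::int) a - monom 1 b"
    have "coeff f a \<noteq> 0" using ab by (simp add: f_def)
    hence "f \<noteq> 0" by auto
    moreover have "degree f \<le> card T" unfolding f_def using ab
      by (intro degree_diff_le order_trans[OF degree_monom_le]) (auto simp: m_def)
    moreover have "map_poly of_int f = monom (1::'a) a - monom 1 b"
      by (rule poly_eqI) (simp add: f_def coeff_map_poly)
    hence "poly (map_poly of_int f) x = 0" using ab by (simp add: poly_monom)
    ultimately show ?thesis by blast
  next
    case True
    define S where "S = (\<lambda>n. x ^ n) ` {..m}"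
    have "card S = m + 1" unfolding S_def using card_image[OF True] by simp
    moreover have "S \<subseteq> vq.span T" using span by (auto simp: S_def)
    ultimately have "vq.dependent S" using vq.independent_span_bound[OF T, of S] by (auto simp: m_def)
    moreover have "finite S" by (simp add: S_def)
    ultimately obtain c where c: "\<exists>v\<in>S. c v \<noteq> 0" "(\<Sum>v\<in>S. of_rat (c v) * v) = 0"
      using vq.dependent_finite by blast
    define q where "q = (\<lambda>n. c (x ^ n))"
    obtain k where k: "k \<le> m" "q k \<noteq> 0" using c(1) by (auto simp: S_def q_def)
    have q0: "(\<Sum>n\<le>m. of_rat (q n) * x ^ n) = 0"
      using c(2) unfolding S_def q_def by (simp add: sum.reindex[OF True])
    obtain e :: int where e: "e > 0" "\<forall>i\<in>{..m}. \<exists>z::int. of_int e * q i = of_int z"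
      using clear_denominators[of "{..m}" q] by auto
    then obtain z :: "nat \<Rightarrow> int" where z: "\<And>i. i \<le> m \<Longrightarrow> of_int e * q i = of_int (z i)"
      by (metis atMost_iff)
    define f where "f = (\<Sum>n\<le>m. monom (z n) n)"
    have cf: "coeff f i = (if i \<le> m then z i else 0)" for i
      by (simp add: f_def coeff_sum coeff_monom if_distrib cong: if_cong)
    have "z k \<noteq> 0" using z[OF k(1)] k e by auto
    hence "coeff f k \<noteq> 0" using k by (simp add: cf)
    hence "f \<noteq> 0" by auto
    moreover have deg: "degree f \<le> m" by (rule degree_le) (simp add: cf)
    moreover have "poly (map_poly of_int f) x = 0"
    proof -
      have d2: "degree (map_poly of_int f :: 'a poly) < Suc m" using degree_map_poly_le[of of_int f] deg by (simp add: less_Suc_eq_le)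
      have "poly (map_poly of_int f) x = (\<Sum>n<Suc m. of_int (z n) * x ^ n)"
        unfolding poly_as_sum[OF d2] by (intro sum.cong) (auto simp: coeff_map_poly cf)
      also have "\<dots> = (\<Sum>n\<le>m. of_int e * (of_rat (q n) * x ^ n))"
      proof (rule sum.cong)
        fix n assume n: "n \<in> {..m}"
        have "of_int (z n) = (of_rat (of_int e * q n) :: 'a)" using z[of n] n by simp
        thus "of_int (z n) * x ^ n = of_int e * (of_rat (q n) * x ^ n)" by (simp add: of_rat_mult)
      qed auto
      also have "\<dots> = 0" using q0 by (simp flip: sum_distrib_left)
      finally show ?thesis .
    qed
    ultimately show ?thesis by (auto simp: m_def)
  qed
qed

section \<open>Congruences modulo a prime and integral minimal polynomials\<close>

lemma freshman_dream:
  fixes x y :: "'a :: comm_ring_1"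
  assumes p: "prime p"
  shows "\<exists>c. (x + y) ^ p = x ^ p + y ^ p + of_nat p * c"
proof -
  have p0: "p > 0" using p by (simp add: prime_gt_0_nat)
  have "\<exists>d. \<forall>k\<in>{1..<p}. p choose k = p * d k"
  proof (rule bchoice, rule ballI)
    fix k assume "k \<in> {1..<p}"
    hence "p dvd p choose k" using p by (intro dvd_choose_prime) auto
    thus "\<exists>d. p choose k = p * d" by blast
  qed
  then obtain d where d: "\<And>k. k \<in> {1..<p} \<Longrightarrow> p choose k = p * d k" by blast
  have "(x + y) ^ p = (\<Sum>k\<le>p. of_nat (p choose k) * x ^ k * y ^ (p - k))" by (rule binomial_ring)
  also have "{..p} = insert 0 (insert p {1..<p})" using p0 by auto
  also have "(\<Sum>k\<in>\<dots>. of_nat (p choose k) * x ^ k * y ^ (p - k)) =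
     y ^ p + (x ^ p + (\<Sum>k\<in>{1..<p}. of_nat (p choose k) * x ^ k * y ^ (p - k)))"
    using p0 by (simp add: sum.insert)
  also have "(\<Sum>k\<in>{1..<p}. of_nat (p choose k) * x ^ k * y ^ (p - k)) = of_nat p * (\<Sum>k\<in>{1..<p}. of_nat (d k) * x ^ k * y ^ (p - k))"
    unfolding sum_distrib_left by (intro sum.cong) (auto simp: d mult_ac)
  finally have "(x + y) ^ p = x ^ p + y ^ p + of_nat p * (\<Sum>k\<in>{1..<p}. of_nat (d k) * x ^ k * y ^ (p - k))"
    by (simp only: add_ac)
  thus ?thesis by (rule exI)
qed

lemma prime_dvd_power_minus_self:
  fixes a :: int
  assumes p: "prime p"
  shows "int p dvd a ^ p - a"
proof (induction a rule: int_induct[of _ 0])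
  case base
  then show ?case using p by (simp add: power_0_left prime_gt_0_nat)
next
  case (step1 i)
  obtain c where c: "(i + 1) ^ p = i ^ p + 1 ^ p + int p * c" using freshman_dream[OF p, of i 1] by auto
  have "(i + 1) ^ p - (i + 1) = (i ^ p - i) + int p * c" unfolding c by simp
  thus ?case using step1(2) by (metis dvd_add dvd_triv_left)
next
  case (step2 i)
  obtain c where c: "((i - 1) + 1) ^ p = (i - 1) ^ p + 1 ^ p + int p * c" using freshman_dream[OF p, of "i - 1" 1] by auto
  have "(i - 1) ^ p - (i - 1) = (i ^ p - i) - int p * c" using c by simp
  thus ?case using step2 by (metis dvd_diff dvd_triv_left)
qed

lemma frobenius_int_poly:
  fixes f :: "int poly"
  assumes p: "prime p"
  shows "\<exists>h. pcompose f (monom 1 p) = f ^ p + of_nat p * h"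
proof (induction f)
  case 0
  then show ?case using p by (auto simp: power_0_left prime_gt_0_nat)
next
  case (pCons a f)
  obtain h where h: "pcompose f (monom 1 p) = f ^ p + of_nat p * h" using pCons by blast
  obtain t where t: "a = a ^ p + int p * t"
  proof -
    obtain t where "a ^ p - a = int p * t" using prime_dvd_power_minus_self[OF p] by blast
    hence "a = a ^ p + int p * (- t)" by (simp add: algebra_simps)
    thus ?thesis by (rule that)
  qed
  obtain c where c: "([:a:] + [:0, 1:] * f) ^ p = [:a:] ^ p + ([:0, 1:] * f) ^ p + of_nat p * c"
    using freshman_dream[OF p] by blast
  have pc: "pCons a f = [:a:] + [:0, 1:] * f" by simp
  have "pcompose (pCons a f) (monom 1 p) = [:a:] + monom 1 p * (f ^ p + of_nat p * h)"
    by (simp add: pcompose_pCons h)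
  also have "[:a:] = [:a:] ^ p + of_nat p * [:t:]"
  proof -
    have "[:a:] ^ p = [:a ^ p:]" by (simp add: poly_const_pow)
    moreover have "of_nat p * [:t:] = [:int p * t:]" by (simp add: of_nat_poly)
    ultimately show ?thesis using t by simp
  qed
  also have "\<dots> + monom 1 p * (f ^ p + of_nat p * h) = (pCons a f) ^ p + of_nat p * ([:t:] + monom 1 p * h - c)"
  proof -
    have "monom 1 p = [:0, 1::int:] ^ p" by (simp add: monom_altdef)
    thus ?thesis unfolding pc c by (simp add: algebra_simps power_mult_distrib del: mult_pCons_left mult_pCons_right)
  qed
  finally show ?case by blast
qed

lemma monic_division:
  fixes f p :: "int poly"
  assumes "lead_coeff f = 1"
  shows "\<exists>q r. p = f * q + r \<and> (r = 0 \<or> degree r < degree f)"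
proof -
  have f: "f \<noteq> 0" using assms by auto
  obtain q r where qr: "pseudo_divmod p f = (q, r)" by fastforce
  from pseudo_divmod[OF f qr] show ?thesis using assms by auto
qed

text \<open>This is Gauss's lemma. Pseudo-division of \<open>M\<close> by the primitive part
  \<open>f\<close> leaves no remainder by minimality, so \<open>c M = f q\<close>. Comparing
  contents shows that \<open>c\<close> divides \<open>q\<close>; hence \<open>f\<close> divides
  \<open>M\<close> over the integers, and its leading coefficient divides 1.\<close>

lemma minimal_monic:
  fixes y :: complex
  assumes M: "lead_coeff M = 1" "poly (cpoly M) y = 0"
  obtains f where "int_minimal f y" "lead_coeff f = 1"
proof -
  interpret h: inj_idom_hom "of_int :: int \<Rightarrow> complex" by unfold_locales auto
  interpret ph: map_poly_inj_idom_hom "of_int :: int \<Rightarrow> complex" ..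
  have "M \<noteq> 0" using M by auto
  obtain f0 where f0: "int_minimal f0 y" using int_minimal_exists[OF \<open>M \<noteq> 0\<close> M(2)] by blast
  define f where "f = primitive_part f0"
  have f00: "f0 \<noteq> 0" using f0 by (simp add: int_minimal_def)
  have cf: "content f = 1" using f00 by (simp add: f_def)
  have f0f: "f0 = smult (content f0) f" by (simp add: f_def)
  have f0': "f \<noteq> 0" using f00 by (simp add: f_def)
  have deg: "degree f = degree f0" by (simp add: f_def)
  have rf: "poly (cpoly f) y = 0"
  proof -
    have "poly (cpoly (smult (content f0) f)) y = 0" using f0 f0f by (simp add: int_minimal_def)
    thus ?thesis using f00 by (simp add: hom_distribs)
  qed
  have fm: "int_minimal f y" using f0 f0' rf deg by (simp add: int_minimal_def)
  obtain q r where qr: "pseudo_divmod M f = (q, r)" by fastforce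
  define c where "c = lead_coeff f ^ (Suc (degree M) - degree f)"
  have eq: "smult c M = f * q + r" "r = 0 \<or> degree r < degree f"
    using pseudo_divmod[OF f0' qr] by (auto simp: c_def)
  have c0: "c \<noteq> 0" using f0' by (simp add: c_def)
  have "poly (cpoly (smult c M)) y = 0" using M by (simp add: hom_distribs)
  hence "poly (cpoly r) y = 0" using rf unfolding eq by (simp add: hom_distribs)
  hence "r = 0" using fm eq(2) by (auto simp: int_minimal_def)
  hence eq': "smult c M = f * q" using eq by simp
  have "content M = 1"
  proof -
    have "content M dvd lead_coeff M" by (rule content_dvd_coeff)
    thus ?thesis using M(1) by (metis is_unit_content_iff)
  qed
  hence "content q = normalize c"
    using arg_cong[OF eq', of content] cf by (simp add: content_mult)
  then obtain q' where "q = smult c q'"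
  proof -
    have "c dvd content q" using \<open>content q = normalize c\<close> by simp
    hence "[:c:] dvd q" by (simp add: const_poly_dvd_iff_dvd_content)
    then obtain q' where "q = [:c:] * q'" by blast
    thus ?thesis by (intro that[of q']) simp
  qed
  hence "M = f * q'" using eq' c0 by (simp add: smult_cancel)
  hence "lead_coeff f * lead_coeff q' = 1" using M(1) by (simp add: lead_coeff_mult)
  hence "lead_coeff f = 1 \<or> lead_coeff f = - 1" using zmult_eq_1_iff by blast
  thus ?thesis
  proof
    assume "lead_coeff f = 1"
    thus ?thesis using fm that by blast
  next
    assume "lead_coeff f = - 1"
    hence "lead_coeff (- f) = 1" by simp
    moreover have "int_minimal (- f) y" using fm by (simp add: int_minimal_def hom_distribs)
    ultimately show ?thesis using that by blast
  qed
qed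

text \<open>
  Landau's argument: \<open>f (u\<^sup>p) \<equiv> f (u)\<^sup>p\<close> modulo \<open>p\<close>, while \<open>f (u\<^sup>j)\<close> takes only finitely many values, so
  \<open>f (u\<^sup>p) = 0\<close> for every prime \<open>p\<close> exceeding their coefficients. Every residue class coprime to \<open>N\<close>
  contains a product of such primes.
\<close>

lemma degree_root_of_unity:
  fixes u :: complex
  assumes N: "N > 0" and u: "u ^ N = 1" and prim: "\<And>k. 0 < k \<Longrightarrow> k < N \<Longrightarrow> u ^ k \<noteq> 1"
    and F: "F \<noteq> 0" "poly (cpoly F) u = 0"
  shows "totient N \<le> degree F"
proof -
  interpret h: inj_idom_hom "of_int :: int \<Rightarrow> complex" by unfold_locales auto
  interpret ph: map_poly_inj_idom_hom "of_int :: int \<Rightarrow> complex" ..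
  have evc: "poly (cpoly (pcompose f (monom 1 k))) v = poly (cpoly f) (v ^ k)" for f k v
    by (simp add: hom_distribs poly_pcompose poly_monom)
  define M where "M = monom (1::int) N - 1"
  have dM: "degree M = N"
  proof -
    have "degree (monom (1::int) N + - 1) = degree (monom (1::int) N)"
      by (rule degree_add_eq_left) (use N in \<open>simp add: degree_monom_eq\<close>)
    thus ?thesis by (simp add: M_def degree_monom_eq)
  qed
  obtain f where f: "int_minimal f u" and lc: "lead_coeff f = 1"
  proof (rule minimal_monic)
    show "lead_coeff M = 1" using dM N by (simp add: M_def)
    show "poly (cpoly M) u = 0" using u by (simp add: M_def hom_distribs poly_monom)
  qed
  have f0: "f \<noteq> 0" "poly (cpoly f) u = 0" using f by (auto simp: int_minimal_def)
  have "degree f \<le> degree F" using f F by (meson int_minimal_def not_le)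
  moreover have "totient N \<le> degree f"
  proof -
    \<comment> \<open>Here \<open>r j\<close> is the remainder of \<open>f (X^j)\<close> modulo the
      monic \<open>f\<close>. It depends only on the value of \<open>f\<close> at
      \<open>u^j\<close>, hence only on \<open>j\<close> modulo \<open>N\<close>.\<close>
    have "\<forall>j. \<exists>r. (r = 0 \<or> degree r < degree f) \<and> poly (cpoly r) u = poly (cpoly f) (u ^ j)"
    proof
      fix j
      obtain q r where qr: "pcompose f (monom 1 j) = f * q + r" "r = 0 \<or> degree r < degree f"
        using monic_division[OF lc] by blast
      have "poly (cpoly f) (u ^ j) = poly (cpoly (f * q + r)) u" using evc[of f j u] qr(1) by simp
      also have "\<dots> = poly (cpoly r) u" using f0 by (simp add: hom_distribs)
      finally show "\<exists>r. (r = 0 \<or> degree r < degree f) \<and> poly (cpoly r) u = poly (cpoly f) (u ^ j)" using qr(2) by metis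
    qed
    then obtain r where r: "\<And>j. r j = 0 \<or> degree (r j) < degree f" "\<And>j. poly (cpoly (r j)) u = poly (cpoly f) (u ^ j)"
      by metis
    define A where "A = (\<Sum>j<N. poly_length (r j))"
    have coeffA: "\<bar>coeff (r j) i\<bar> \<le> A" if "j < N" for i j
    proof -
      have "\<bar>coeff (r j) i\<bar> \<le> poly_length (r j)" using poly_length_ge_sum[of "{i}" "r j"] by simp
      also have "\<dots> \<le> A" unfolding A_def by (rule member_le_sum) (use that in auto)
      finally show ?thesis .
    qed
    note umod = power_mod_eq[OF u]
    have diff0: "a = b" if "poly (cpoly a) u = poly (cpoly b) u" "a = 0 \<or> degree a < degree f" "b = 0 \<or> degree b < degree f" for a b
    proof (rule ccontr)
      assume "a \<noteq> b"
      have "poly (cpoly (a - b)) u = 0" using that by (simp add: hom_distribs)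
      moreover have "degree (a - b) < degree f"
      proof -
        have "degree f > 0"
        proof (rule ccontr)
          assume "\<not> degree f > 0"
          then obtain c where "f = [:c:]" by (auto elim: degree_eq_zeroE)
          thus False using f0 by simp
        qed
        hence "degree a < degree f" "degree b < degree f" using that by auto
        thus ?thesis by (rule degree_diff_less)
      qed
      ultimately have "a - b = 0" using f unfolding int_minimal_def by blast
      thus False using \<open>a \<noteq> b\<close> by simp
    qed
    have prime_step: "poly (cpoly f) (u ^ p) = 0" if p: "prime p" "int p > A" for p
    proof -
      obtain g where g: "pcompose f (monom 1 p) = f ^ p + of_nat p * g" using frobenius_int_poly[OF p(1)] by blast
      obtain q s where qs: "g = f * q + s" "s = 0 \<or> degree s < degree f" using monic_division[OF lc] by blast
      have "poly (cpoly f) (u ^ p) = poly (cpoly (f ^ p + of_nat p * g)) u" using evc[of f p u] g by simp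
      also have "\<dots> = of_nat p * poly (cpoly s) u"
        using f0 p(1) prime_gt_0_nat[OF p(1)] by (simp add: hom_distribs qs power_0_left)
      also have "\<dots> = poly (cpoly (smult (int p) s)) u" by (simp add: hom_distribs)
      finally have "poly (cpoly (r (p mod N))) u = poly (cpoly (smult (int p) s)) u"
        by (simp add: r(2) umod)
      \<comment> \<open>A polynomial of degree less than that of \<open>f\<close> is determined by
        its value at \<open>u\<close>. So this remainder is divisible by \<open>p\<close>, although
        its coefficients are at most \<open>A < p\<close>; it must be 0.\<close>
      hence eq: "r (p mod N) = smult (int p) s"
        by (rule diff0) (use r(1) qs(2) in \<open>auto intro: le_less_trans[OF degree_smult_le]\<close>)
      have "coeff s i = 0" for i
      proof (rule ccontr)
        assume "coeff s i \<noteq> 0"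
        hence "1 \<le> \<bar>coeff s i\<bar>" by linarith
        hence "int p \<le> int p * \<bar>coeff s i\<bar>" by (simp add: mult_le_cancel_left1)
        also have "\<dots> = \<bar>coeff (r (p mod N)) i\<bar>" by (simp add: eq abs_mult)
        also have "\<dots> \<le> A" using coeffA[of "p mod N" i] N by simp
        finally show False using p by simp
      qed
      hence "s = 0" by (intro poly_eqI) simp
      hence "r (p mod N) = 0" using eq by simp
      thus ?thesis using r(2)[of "p mod N"] by (simp add: umod)
    qed
    \<comment> \<open>Vanishing at \<open>u^p\<close> means that \<open>f\<close> divides
      \<open>f (X^p)\<close>, so raising to the \<open>p\<close>-th power preserves all roots of
      \<open>f\<close>, and the step can be iterated.\<close>
    have prime_step': "poly (cpoly f) (v ^ p) = 0" if p: "prime p" "int p > A" and v: "poly (cpoly f) v = 0" for p v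
    proof -
      obtain q s where qs: "pcompose f (monom 1 p) = f * q + s" "s = 0 \<or> degree s < degree f"
        using monic_division[OF lc] by blast
      have "poly (cpoly (f * q + s)) u = 0" using evc[of f p u] prime_step[OF p] qs(1) by simp
      hence "poly (cpoly s) u = 0" using f0 by (simp add: hom_distribs)
      hence "s = 0" using qs(2) f by (auto simp: int_minimal_def)
      hence "poly (cpoly (f * q)) v = poly (cpoly f) (v ^ p)" using evc[of f p v] qs(1) by simp
      thus ?thesis using v by (simp add: hom_distribs)
    qed
    have prods: "poly (cpoly f) (u ^ k) = 0" if "k > 0" "\<And>p. prime p \<Longrightarrow> p dvd k \<Longrightarrow> int p > A" for k
      using that
    proof (induction k rule: less_induct)
      case (less k)
      show ?case
      proof (cases "k = 1")
        case False
        then obtain p where p: "prime p" "p dvd k" using prime_factor_nat by blast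
        then obtain l where l: "k = p * l" by blast
        have "l > 0" using l less(2) by (cases "l = 0") auto
        hence "l < k" using l prime_gt_1_nat[OF p(1)] by simp
        note \<open>l > 0\<close> this
        hence "poly (cpoly f) (u ^ l) = 0" using less l by (intro less(1)) auto
        hence "poly (cpoly f) ((u ^ l) ^ p) = 0" by (rule prime_step'[OF p(1) less(3)[OF p]])
        thus ?thesis using l by (simp add: mult.commute flip: power_mult)
      qed (use f0 in simp)
    qed
    have root: "poly (cpoly f) (u ^ t) = 0" if t: "t \<in> totatives N" for t
    proof -
      have tc: "coprime t N" "t > 0" using t by (auto simp: in_totatives_iff)
      define Q where "Q = {q. prime q \<and> int q \<le> A \<and> \<not> q dvd t}"
      have finQ: "finite Q" by (rule finite_subset[of _ "{..nat A}"]) (auto simp: Q_def)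
      \<comment> \<open>This is congruent to \<open>t\<close> modulo \<open>N\<close> and has no
        prime factor up to \<open>A\<close>. Such a prime either divides \<open>t\<close>, and then
        neither \<open>N\<close> nor the product, or it divides the product and not
        \<open>t\<close>.\<close>
      define k where "k = t + N * \<Prod>Q"
      have "int p > A" if p: "prime p" "p dvd k" for p
      proof (rule ccontr)
        assume pA: "\<not> int p > A"
        show False
        proof (cases "p dvd t")
          case True
          hence "p dvd N * \<Prod>Q" using p(2) unfolding k_def by (simp add: dvd_add_right_iff)
          moreover have "\<not> p dvd N" 
          proof
            assume "p dvd N"
            hence "p dvd gcd t N" using True by simp
            also have "gcd t N = 1" using tc(1) by (rule coprime_imp_gcd_eq_1)
            finally show False using p(1) by (metis not_prime_unit)
          qed
          ultimately have "p dvd \<Prod>Q" using p(1) by (simp add: prime_dvd_mult_iff)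
          then obtain q where "q \<in> Q" "p dvd q" using p(1) finQ by (auto simp: prime_dvd_prod_iff)
          hence "p = q" using p(1) by (auto simp: Q_def primes_dvd_imp_eq)
          thus False using \<open>q \<in> Q\<close> True by (simp add: Q_def)
        next
          case False
          hence "p \<in> Q" using p pA by (simp add: Q_def)
          hence "p dvd N * \<Prod>Q" using finQ by (intro dvd_mult dvd_prodI[of Q p id, simplified])
          hence "p dvd t" using p(2) unfolding k_def by (simp add: dvd_add_left_iff)
          thus False using False by simp
        qed
      qed
      hence "poly (cpoly f) (u ^ k) = 0" using tc by (intro prods) (auto simp: k_def)
      moreover have "u ^ k = u ^ t" by (simp add: k_def power_add power_mult u)
      ultimately show ?thesis by simp
    qed
    have u0: "u \<noteq> 0" using u N by (auto simp: power_0_left)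
    have inj: "inj_on (\<lambda>t. u ^ t) (totatives N)"
    proof (rule linorder_inj_onI)
      fix i j assume ij: "i < j" "i \<in> totatives N" "j \<in> totatives N"
      show "u ^ i \<noteq> u ^ j"
      proof
        assume "u ^ i = u ^ j"
        also have "u ^ j = u ^ i * u ^ (j - i)" unfolding power_add[symmetric] using ij by simp
        finally have "u ^ (j - i) = 1" using u0 by simp
        moreover have "0 < j - i" "j - i < N" using ij by (auto simp: in_totatives_iff)
        ultimately show False using prim by blast
      qed
    qed auto
    have "totient N = card ((\<lambda>t. u ^ t) ` totatives N)" using card_image[OF inj] by (simp add: totient_def)
    also have "\<dots> \<le> card {v. poly (cpoly f) v = 0}"
      by (rule card_mono) (use root f0 poly_roots_finite[of "cpoly f"] in auto)
    also have "\<dots> \<le> degree (cpoly f)" using f0 by (intro card_poly_roots_bound) auto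
    finally show ?thesis by simp
  qed
  ultimately show ?thesis by linarith
qed

section \<open>Conjugates over a number field\<close>

lemma number_field_basis:
  assumes "number_field TYPE('k :: field_char_0)"
  obtains Bs :: "'k :: field_char_0 set" where "finite Bs" "module.span (\<lambda>(q::rat) (x::'k). of_rat q * x) Bs = UNIV"
proof -
  obtain Bs where "finite_dimensional_vector_space (\<lambda>(q::rat) (x::'k). of_rat q * x) Bs"
    using assms unfolding number_field_def by blast
  then interpret fd: finite_dimensional_vector_space "\<lambda>(q::rat) (x::'k). of_rat q * x" Bs .
  show ?thesis by (rule that[of Bs]) (use fd.finite_Basis fd.span_Basis in auto)
qed

lemma number_field_algebraic:
  assumes "number_field TYPE('k :: field_char_0)"
  shows "\<exists>f::int poly. f \<noteq> 0 \<and> poly (map_poly of_int f) (x::'k :: field_char_0) = 0"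
proof -
  obtain Bs :: "'k set" where "finite Bs" "module.span (\<lambda>(q::rat) (x::'k). of_rat q * x) Bs = UNIV"
    using number_field_basis[OF assms] .
  thus ?thesis using algebraic_of_finite_span[of Bs x] by auto
qed

lemma field_hom_of_rat:
  fixes j :: "'k :: field_char_0 \<Rightarrow> 'b :: field_char_0"
  assumes j: "field_hom j"
  shows "j (of_rat q) = of_rat q"
proof -
  interpret j: field_hom j by fact
  obtain a b where ab: "quotient_of q = (a, b)" by fastforce
  have q: "q = of_int a / of_int b" by (rule quotient_of_div[OF ab])
  show ?thesis unfolding q by (simp add: of_rat_divide hom_distribs)
qed

text \<open>Modulo \<open>g\<close> every polynomial in \<open>y\<close> reduces to degree less than
  \<open>d\<close>, and \<open>u\<close> is quadratic over the field generated by \<open>y\<close>,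
  as \<open>u^2 = y u - 1\<close>. So all powers of \<open>u\<close> lie in the rational span of the
  \<open>2 d * card Bs\<close> products of basis elements, powers of \<open>y\<close>, and 1 or
  \<open>u\<close>.\<close>

lemma totient_le_degree:
  fixes \<kappa> :: "'k :: field_char_0 \<Rightarrow> complex"
  assumes Bs: "finite Bs" "module.span (\<lambda>(q::rat) (x::'k). of_rat q * x) Bs = UNIV" and k: "field_hom \<kappa>"
    and N: "N > 0" and u: "u ^ N = 1" and prim: "\<And>k. 0 < k \<Longrightarrow> k < N \<Longrightarrow> u ^ k \<noteq> 1"
    and g: "degree g > 0" "poly (map_poly \<kappa> g) (u + inverse u) = 0"
  shows "totient N \<le> 2 * degree g * card Bs"
proof -
  interpret k: field_hom \<kappa> by fact
  interpret pk: map_poly_inj_idom_hom \<kappa> ..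
  interpret vq: vector_space "\<lambda>(q::rat) (x::complex). of_rat q * x" by (rule vector_space_of_rat)
  interpret vk: vector_space "\<lambda>(q::rat) (x::'k). of_rat q * x" by (rule vector_space_of_rat)
  define y where "y = u + inverse u"
  define d where "d = degree g"
  have u0: "u \<noteq> 0" using u N by (auto simp: power_0_left)
  have g0: "g \<noteq> 0" using g by auto
  define T where "T = (\<lambda>(c, i, e). \<kappa> c * y ^ i * u ^ e) ` (Bs \<times> {..<d} \<times> {..<2::nat})"
  have finT: "finite T" using Bs by (simp add: T_def)
  have cT: "card T \<le> 2 * d * card Bs"
    unfolding T_def using card_image_le[of "Bs \<times> {..<d} \<times> {..<2::nat}" "\<lambda>(c, i, e). \<kappa> c * y ^ i * u ^ e"] Bs
    by (simp add: card_cartesian_product mult_ac)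
  have mono: "\<kappa> c * y ^ i * u ^ e \<in> vq.span T" if "i < d" "e < 2" for c i e
  proof -
    have "c \<in> vk.span Bs" using Bs(2) by simp
    thus ?thesis
    proof (induction rule: vk.span_induct_alt)
      case base
      then show ?case by (simp add: vq.span_zero)
    next
      case (step q b x)
      have "\<kappa> (of_rat q * b + x) * y ^ i * u ^ e = of_rat q * (\<kappa> b * y ^ i * u ^ e) + \<kappa> x * y ^ i * u ^ e"
        by (simp add: hom_distribs field_hom_of_rat[OF k] algebra_simps)
      moreover have "\<kappa> b * y ^ i * u ^ e \<in> T" using step(1) that by (force simp: T_def)
      ultimately show ?case using step(2) by (simp add: vq.span_add vq.span_scale vq.span_base)
    qed
  qed
  have pol: "poly (map_poly \<kappa> p) y * u ^ e \<in> vq.span T" if "e < 2" for p e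
  proof -
    define r where "r = p mod g"
    have "p = g * (p div g) + r" by (simp add: r_def)
    then obtain s where "p = g * s + r" by blast
    hence "poly (map_poly \<kappa> p) y = poly (map_poly \<kappa> r) y" using g by (simp add: hom_distribs y_def)
    moreover have "degree r < d" using degree_mod_less[of g p] g0 g by (auto simp: r_def d_def)
    ultimately have "poly (map_poly \<kappa> p) y * u ^ e = (\<Sum>i<d. \<kappa> (coeff r i) * y ^ i * u ^ e)"
      using poly_as_sum[of "map_poly \<kappa> r" d y] by (simp add: sum_distrib_right)
    also have "\<dots> \<in> vq.span T" by (intro vq.span_sum mono) (use that in auto)
    finally show ?thesis .
  qed
  have "\<exists>p q. u ^ n = poly (map_poly \<kappa> p) y + poly (map_poly \<kappa> q) y * u" for n
  proof (induction n)
    case 0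
    show ?case by (rule exI[of _ 1], rule exI[of _ 0]) simp
  next
    case (Suc n)
    then obtain p q where pq: "u ^ n = poly (map_poly \<kappa> p) y + poly (map_poly \<kappa> q) y * u" by blast
    have uu: "u * u = y * u - 1" using u0 by (simp add: y_def algebra_simps)
    have "u ^ Suc n = poly (map_poly \<kappa> p) y * u + poly (map_poly \<kappa> q) y * (u * u)" by (simp add: pq algebra_simps)
    also have "\<dots> = poly (map_poly \<kappa> (- q)) y + poly (map_poly \<kappa> (p + [:0, 1:] * q)) y * u"
      unfolding uu by (simp add: hom_distribs algebra_simps)
    finally show ?case by blast
  qed
  hence span: "u ^ n \<in> vq.span T" for n
    using pol[of 0] pol[of 1] by (metis mult.right_neutral one_less_numeral_iff power_0 power_one_right semiring_norm(76) vq.span_add zero_less_numeral)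
  obtain F :: "int poly" where F: "F \<noteq> 0" "degree F \<le> card T" "poly (cpoly F) u = 0"
    using algebraic_of_finite_span[OF finT span] by blast
  have "totient N \<le> degree F" by (rule degree_root_of_unity[OF N u prim F(1,3)])
  thus ?thesis using F(2) cT by (simp add: d_def)
qed

lemma cis_primitive_power:
  assumes u: "u ^ N = (1::complex)" and N: "N > 0"
  shows "\<exists>h<N. u = unity_root N ^ h"
proof -
  have "u \<in> (\<lambda>k. cis (2 * pi * real k / real N)) ` {..<N}"
    using Complex.bij_betw_roots_unity[OF N] u by (auto simp: bij_betw_def)
  thus ?thesis by (auto simp: unity_root_power)
qed

text \<open>Since \<open>u^n = 1\<close> is expressed by \<open>P_n = 2\<close>, a polynomial
  equation over the base field, all conjugates come from roots of unity of the same exact order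
  \<open>N\<close>. The exponents that give conjugates form \<open>H\<close>. For
  \<open>N \<ge> 3\<close> every conjugate arises from exactly two exponents, those of
  \<open>u\<close> and of its inverse, hence the factor 2.\<close>

lemma conjugate_exponents:
  fixes \<kappa> :: "'k :: field_char_0 \<Rightarrow> complex"
  assumes g: "is_minpoly x g" and k: "field_hom \<kappa>" and m: "m \<ge> 2" and x: "preperiodic (cheb m) x"
    and Bs: "finite Bs" "module.span (\<lambda>(q::rat) (x::'k). of_rat q * x) Bs = UNIV"
  obtains N H where "galois_orbit N H" "poly (cheb N) x = 2" "totient N \<le> 2 * degree g * card Bs"
    "\<And>F :: complex \<Rightarrow> real. N \<ge> 3 \<Longrightarrow> (\<Sum>h\<in>H. F (unity_root N ^ h + inverse (unity_root N ^ h))) = 2 * (\<Sum>y | poly (map_poly \<kappa> g) y = 0. F y)"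
proof -
  interpret k: field_hom \<kappa> by fact
  interpret pk: map_poly_inj_idom_hom \<kappa> ..
  interpret ph: map_poly_inj_idom_hom "to_ac :: 'k \<Rightarrow> 'k alg_closure" ..
  have kh: "comm_ring_hom \<kappa>" ..
  have th: "comm_ring_hom (to_ac :: 'k \<Rightarrow> 'k alg_closure)" ..
  define Y where "Y = {y. poly (map_poly \<kappa> g) y = 0}"
  have finY: "finite Y" unfolding Y_def using g by (intro poly_roots_finite) (simp add: is_minpoly_def)
  have dg: "degree g > 0" by (rule minpoly_degree_pos[OF g])
  have conj: "poly (map_poly \<kappa> q) y' = 0" "poly (ac_poly q) x = 0" if "y \<in> Y" "y' \<in> Y" "poly (map_poly \<kappa> q) y = 0" for q y y'
  proof -
    have "g dvd q" using that by (intro minpoly_dvd_of_common_root[OF g k]) (auto simp: Y_def)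
    then obtain e where "q = g * e" by blast
    thus "poly (map_poly \<kappa> q) y' = 0" "poly (ac_poly q) x = 0" using that g by (auto simp: Y_def hom_distribs is_minpoly_def)
  qed
  have "card Y = degree g" unfolding Y_def by (rule card_minpoly_roots[OF g k])
  hence "Y \<noteq> {}" using dg by auto
  obtain z where z: "z \<noteq> 0" "x = z + inverse z" by (rule exists_plus_inverse)
  then obtain n0 where n0: "n0 > 0" "z ^ n0 = 1" using x preperiodic_cheb_iff[OF z(1) m] by auto
  have cheb_eval: "poly (map_poly \<kappa> (cheb n - 2)) y = poly (cheb n) y - 2" for n y
    by (simp add: hom_distribs map_poly_cheb[OF kh])
  have cheb_eval_ac: "poly (ac_poly (cheb n - 2)) x = poly (cheb n) x - 2" for n
    by (simp add: hom_distribs map_poly_cheb[OF th])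
  have n0Y: "poly (cheb n0) y = 2" if "y \<in> Y" for y
  proof -
    have "poly (ac_poly (cheb n0 - 2)) x = 0"
      unfolding cheb_eval_ac using poly_cheb_eq_2_iff[OF z(1), of n0] n0 z(2) by simp
    hence "g dvd cheb n0 - 2" using g by (simp add: is_minpoly_def)
    then obtain e where "cheb n0 - 2 = g * e" by blast
    hence "poly (map_poly \<kappa> (cheb n0 - 2)) y = 0" using that by (simp add: Y_def hom_distribs)
    thus ?thesis unfolding cheb_eval by simp
  qed
  obtain y0 where y0: "y0 \<in> Y" using \<open>Y \<noteq> {}\<close> by blast
  obtain u0 where u0: "u0 \<noteq> 0" "y0 = u0 + inverse u0" by (rule exists_plus_inverse)
  define N where "N = (LEAST n. n > 0 \<and> u0 ^ n = 1)"
  have "n0 > 0 \<and> u0 ^ n0 = 1" using n0Y[OF y0] poly_cheb_eq_2_iff[OF u0(1), of n0] n0 u0(2) by simp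
  hence N: "N > 0" "u0 ^ N = 1" using LeastI[of "\<lambda>n. n > 0 \<and> u0 ^ n = 1" n0] by (auto simp: N_def)
  have prim0: "u0 ^ k \<noteq> 1" if "0 < k" "k < N" for k
    using not_less_Least[of k "\<lambda>n. n > 0 \<and> u0 ^ n = 1"] that by (auto simp: N_def)
  have same_order: "u ^ n = 1 \<longleftrightarrow> u0 ^ n = 1" if u: "u \<noteq> 0" "u + inverse u \<in> Y" for u n
  proof -
    have "poly (cheb n) (u + inverse u) = 2 \<longleftrightarrow> poly (cheb n) y0 = 2"
      using conj(1)[of "u + inverse u" y0 "cheb n - 2"] conj(1)[of y0 "u + inverse u" "cheb n - 2"] u y0 by (auto simp: cheb_eval)
    thus ?thesis using poly_cheb_eq_2_iff[OF u(1)] poly_cheb_eq_2_iff[OF u0(1)] u0(2) by simp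
  qed
  define z where "z = unity_root N"
  define H where "H = {h\<in>{..<N}. z ^ h + inverse (z ^ h) \<in> Y}"
  have z0: "z \<noteq> 0" by (simp add: z_def)
  have zN: "z ^ N = 1" unfolding z_def by (rule cis_root_of_unity[OF N(1)])
  note zmod = power_mod_eq[OF zN]
  have zh: "\<exists>h\<in>H. u = z ^ h" if u: "u \<noteq> 0" "u + inverse u \<in> Y" for u
  proof -
    have "u ^ N = 1" using same_order[OF u] N by simp
    then obtain h where "h < N" "u = z ^ h" using cis_primitive_power[OF _ N(1)] unfolding z_def by blast
    thus ?thesis using u by (auto simp: H_def)
  qed
  have Hcop: "coprime h N" if h: "h \<in> H" for h
  proof (rule ccontr)
    assume "\<not> coprime h N"
    hence "gcd h N \<noteq> 1" using gcd_eq_1_imp_coprime by blast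
    then obtain p where "prime p" "p dvd gcd h N" using prime_factor_nat by blast
    \<comment> \<open>A common prime factor would make the order of \<open>z^h\<close> a divisor of
      \<open>N / p\<close>, against the fact that all conjugates share the order
      \<open>N\<close>.\<close>
    hence p: "prime p" "p dvd h" "p dvd N" by auto
    then obtain a b where ab: "h = p * a" "N = p * b" by (auto elim!: dvdE)
    have "b > 0" using ab N by (cases "b = 0") auto
    hence b: "0 < b" "b < N" using ab prime_gt_1_nat[OF p(1)] by auto
    have "(z ^ h) ^ b = 1"
    proof -
      have "h * b = N * a" using ab by simp
      thus ?thesis by (metis power_mult zN power_one)
    qed
    hence "u0 ^ b = 1" using same_order[of "z ^ h" b] h z0 by (auto simp: H_def)
    thus False using prim0 b by blast
  qed
  have Hmult: "c * n mod N \<in> H" if h: "a \<in> H" "b \<in> H" "c \<in> H" and abn: "[a * n = b] (mod N)" for a b c n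
  proof -
    \<comment> \<open>The polynomial \<open>P_n\<close> multiplies exponents by \<open>n\<close>. If
      it carries one conjugate to a conjugate, then \<open>g\<close> composed with
      \<open>P_n\<close> vanishes at that conjugate, hence at all of them; this is the coset
      property.\<close>
    have ev: "poly (map_poly \<kappa> (pcompose g (cheb n))) (z ^ i + inverse (z ^ i)) = poly (map_poly \<kappa> g) (z ^ (i * n) + inverse (z ^ (i * n)))" for n i
    proof -
      have "poly (cheb n) (z ^ i + inverse (z ^ i)) = (z ^ i) ^ n + inverse (z ^ i) ^ n"
        by (rule poly_cheb) (use z0 in simp)
      thus ?thesis by (simp add: hom_distribs poly_pcompose map_poly_cheb[OF kh] power_inverse flip: power_mult)
    qed
    have "z ^ (a * n) = z ^ b" using abn by (metis cong_def zmod)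
    hence ra: "poly (map_poly \<kappa> (pcompose g (cheb n))) (z ^ a + inverse (z ^ a)) = 0"
      using ev[of n a] h(2) by (simp add: H_def Y_def)
    have "poly (map_poly \<kappa> (pcompose g (cheb n))) (z ^ c + inverse (z ^ c)) = 0"
      by (rule conj(1)[OF _ _ ra]) (use h in \<open>auto simp: H_def\<close>)
    thus ?thesis using N ev[of n c] zmod[of "c * n"] by (simp add: H_def Y_def)
  qed
  obtain h0 where h0: "h0 \<in> H" using zh[of u0] u0 y0 by blast
  have orbit: "galois_orbit N H"
    unfolding galois_orbit_def using N h0 Hcop Hmult by (auto simp: H_def)
  have "poly (ac_poly (cheb N - 2)) x = 0"
    by (rule conj(2)[OF y0 y0]) (use poly_cheb_eq_2_iff[OF u0(1), of N] N u0(2) in \<open>simp add: cheb_eval\<close>)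
  hence chx: "poly (cheb N) x = 2" by (simp add: cheb_eval_ac)
  have tot: "totient N \<le> 2 * degree g * card Bs"
    by (rule totient_le_degree[OF Bs k N prim0 dg]) (use y0 u0 in \<open>auto simp: Y_def\<close>)
  have sum: "(\<Sum>h\<in>H. F (z ^ h + inverse (z ^ h))) = 2 * (\<Sum>y\<in>Y. F y)" if N3: "N \<ge> 3" for F :: "complex \<Rightarrow> real"
  proof -
    have finH: "finite H" by (simp add: H_def)
    have "(\<Sum>h\<in>H. F (z ^ h + inverse (z ^ h))) = (\<Sum>y\<in>Y. \<Sum>h\<in>{h\<in>H. z ^ h + inverse (z ^ h) = y}. F (z ^ h + inverse (z ^ h)))"
      by (rule sum.group[symmetric]) (use finH finY in \<open>auto simp: H_def\<close>)
    also have "\<dots> = (\<Sum>y\<in>Y. 2 * F y)"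
    proof (rule sum.cong)
      fix y assume y: "y \<in> Y"
      obtain u where u: "u \<noteq> 0" "y = u + inverse u" by (rule exists_plus_inverse)
      obtain a where a: "a \<in> H" "u = z ^ a" using zh[of u] u y by blast
      obtain b where b: "b \<in> H" "inverse u = z ^ b" using zh[of "inverse u"] u y by (auto simp: add.commute)
      have "a \<noteq> b"
      proof
        assume "a = b"
        hence "inverse u = u" using a b by simp
        hence "u ^ 2 = 1" using u(1) by (simp add: power2_eq_square field_simps)
        hence "u0 ^ 2 = 1" using same_order[of u 2] u y by simp
        thus False using prim0[of 2] N3 by simp
      qed
      have injz: "i = k" if "z ^ i = z ^ k" "i \<in> H" "k \<in> H" for i k
      proof -
        have "inj_on (\<lambda>k. z ^ k) {..<N}"
          using Complex.bij_betw_roots_unity[OF N(1)] unfolding z_def unity_root_power by (simp add: bij_betw_def)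
        thus ?thesis using that by (auto simp: inj_on_def H_def)
      qed
      have "{h\<in>H. z ^ h + inverse (z ^ h) = y} = {a, b}"
      proof (intro equalityI subsetI)
        fix h assume "h \<in> {h\<in>H. z ^ h + inverse (z ^ h) = y}"
        hence h: "h \<in> H" "z ^ h + inverse (z ^ h) = u + inverse u" using u by auto
        hence "z ^ h = u \<or> z ^ h * u = 1" using plus_inverse_eq_iff[of "z ^ h" u] z0 u(1) by simp
        hence "z ^ h = u \<or> z ^ h = inverse u" using inverse_unique[of u "z ^ h"] by (auto simp: mult.commute)
        hence "z ^ h = z ^ a \<or> z ^ h = z ^ b" using a(2) b(2) by metis
        thus "h \<in> {a, b}" using injz[of h a] injz[of h b] h a b by auto
      next
        fix h assume "h \<in> {a, b}"
        thus "h \<in> {h\<in>H. z ^ h + inverse (z ^ h) = y}"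
          using a b u by (auto simp: add.commute simp flip: a(2) b(2))
      qed
      hence "(\<Sum>h\<in>{h\<in>H. z ^ h + inverse (z ^ h) = y}. F (z ^ h + inverse (z ^ h))) = (\<Sum>h\<in>{h\<in>H. z ^ h + inverse (z ^ h) = y}. F y)"
        by (intro sum.cong) auto
      thus "(\<Sum>h\<in>{h\<in>H. z ^ h + inverse (z ^ h) = y}. F (z ^ h + inverse (z ^ h))) = 2 * F y"
        using \<open>{h\<in>H. z ^ h + inverse (z ^ h) = y} = {a, b}\<close> \<open>a \<noteq> b\<close> by simp
    qed simp
    finally show ?thesis by (simp add: sum_distrib_left)
  qed
  show ?thesis
    by (rule that[OF orbit chx tot]) (use sum in \<open>simp add: z_def Y_def\<close>)
qed

subsection \<open>Archimedean absolute values\<close>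

lemma exp_gt_linear:
  fixes q c d :: real
  assumes "q > 1"
  shows "\<exists>k::nat. c * real k + d < q ^ k"
proof -
  have "(\<lambda>k::nat. (c * real k + d) / q ^ k) \<longlonglongrightarrow> 0"
  proof -
    have 1: "(\<lambda>k::nat. real k / q ^ k) \<longlonglongrightarrow> 0" "(\<lambda>k::nat. 1 / q ^ k) \<longlonglongrightarrow> 0" using assms by real_asymp+
    have "(\<lambda>k::nat. c * (real k / q ^ k) + d * (1 / q ^ k)) \<longlonglongrightarrow> c * 0 + d * 0"
      by (intro tendsto_add tendsto_mult tendsto_const 1)
    thus ?thesis by (simp add: add_divide_distrib)
  qed
  hence "eventually (\<lambda>k::nat. (c * real k + d) / q ^ k < 1) sequentially" by (rule order_tendstoD) simp
  then obtain k where "(c * real k + d) / q ^ k < 1" by (auto simp: eventually_sequentially)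
  thus ?thesis using assms by (intro exI[of _ k]) (auto simp: divide_less_eq)
qed

section \<open>Ostrowski's theorem\<close>

context absolute_value
begin

lemma of_nat_le: "w (of_nat n) \<le> real n"
proof (induction n)
  case (Suc n)
  have "w (of_nat (Suc n)) \<le> w 1 + w (of_nat n)" using triangle[of 1 "of_nat n"] by simp
  thus ?case using Suc by simp
qed simp

text \<open>This follows the digits of \<open>M\<close> in base \<open>n\<close>: there are at most
  \<open>log n M + 1\<close> of them, each of absolute value at most \<open>n\<close>, and the
  powers of \<open>n\<close> are bounded by the last factor.\<close>

lemma base_expansion_bound:
  assumes n: "n \<ge> 2" and M: "M > 0"
  shows "w (of_nat M) \<le> real n * (log (real n) (real M) + 1) * max 1 (w (of_nat n)) powr log (real n) (real M)"
  using M
proof (induction M rule: less_induct)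
  case (less M)
  define mx where "mx = max 1 (w (of_nat n))"
  have X1: "mx \<ge> 1" by (simp add: mx_def)
  have n1: "real n > 1" using n by simp
  have l0: "log (real n) (real M) \<ge> 0" using less n1 by (simp add: zero_le_log_cancel_iff)
  have Xp: "1 \<le> mx powr log (real n) (real M)" using X1 l0 by (simp add: ge_one_powr_ge_zero)
  show ?case
  proof (cases "M < n")
    case True
    have "w (of_nat M) \<le> real n * 1 * 1" using of_nat_le[of M] True by simp
    also have "\<dots> \<le> real n * (log (real n) (real M) + 1) * mx powr log (real n) (real M)"
      using l0 Xp by (intro mult_mono) auto
    finally show ?thesis by (simp add: mx_def)
  next
    case False
    define q r where "q = M div n" and "r = M mod n"
    have q: "q > 0" "q < M" using False n less by (auto simp: q_def div_greater_zero_iff)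
    have Mqr: "M = n * q + r" "r < n" using n by (auto simp: q_def r_def)
    define L where "L = log (real n) (real q)"
    have L0: "L \<ge> 0" using q n1 by (simp add: L_def zero_le_log_cancel_iff)
    have LM: "L + 1 \<le> log (real n) (real M)"
    proof -
      have "L + 1 = log (real n) (real (n * q))" using q n1 by (simp add: L_def log_mult)
      also have "\<dots> \<le> log (real n) (real M)" 
      proof (rule log_mono)
        show "real (n * q) \<le> real M" using Mqr(1) by (simp only: of_nat_le_iff)
        show "0 < real (n * q)" using q n by simp
      qed (rule n1)
      finally show ?thesis .
    qed
    have "w (of_nat M) \<le> w (of_nat n) * w (of_nat q) + w (of_nat r)"
      using triangle[of "of_nat n * of_nat q" "of_nat r"] by (subst Mqr(1)) (simp add: mult)
    also have "\<dots> \<le> mx * (real n * (L + 1) * mx powr L) + real n"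
      using less(1)[OF q(2,1)] of_nat_le[of r] Mqr(2) X1
      by (intro add_mono mult_mono) (auto simp: mx_def L_def)
    also have "\<dots> = real n * (L + 1) * mx powr (L + 1) + real n * 1" using X1 by (simp add: powr_add)
    also have "\<dots> \<le> real n * (L + 1) * mx powr log (real n) (real M) + real n * mx powr log (real n) (real M)"
      using LM X1 L0 Xp by (intro add_mono mult_left_mono powr_mono) auto
    also have "\<dots> = real n * ((L + 1) + 1) * mx powr log (real n) (real M)" by (simp add: algebra_simps)
    also have "\<dots> \<le> real n * (log (real n) (real M) + 1) * mx powr log (real n) (real M)"
      using LM by (intro mult_right_mono mult_left_mono) auto
    finally show ?thesis by (simp add: mx_def)
  qed
qed

text \<open>The expansion bound is applied to \<open>m^k\<close>. The factor in front grows only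
  linearly in \<open>k\<close>, so it disappears in comparison with \<open>k\<close>-th
  powers.\<close>

lemma of_nat_le_powr_log:
  assumes n: "n \<ge> 2" and m: "m > 0"
  shows "w (of_nat m) \<le> max 1 (w (of_nat n)) powr log (real n) (real m)"
proof (rule ccontr)
  define Y where "Y = max 1 (w (of_nat n)) powr log (real n) (real m)"
  have n1: "real n > 1" using n by simp
  have Y: "Y > 0" by (simp add: Y_def)
  assume "\<not> ?thesis"
  hence gt: "w (of_nat m) > Y" by (simp add: Y_def)
  define q where "q = w (of_nat m) / Y"
  have q: "q > 1" using gt Y by (simp add: q_def)
  obtain k :: nat where k: "(real n * log (real n) (real m)) * real k + real n < q ^ k" using exp_gt_linear[OF q] by blast
  have "w (of_nat m) ^ k = w (of_nat (m ^ k))" by (simp add: power)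
  also have "\<dots> \<le> real n * (log (real n) (real (m ^ k)) + 1) * max 1 (w (of_nat n)) powr log (real n) (real (m ^ k))"
    using m by (intro base_expansion_bound[OF n]) auto
  also have "log (real n) (real (m ^ k)) = real k * log (real n) (real m)" using m n1 by (simp add: log_nat_power)
  also have "max 1 (w (of_nat n)) powr (real k * log (real n) (real m)) = Y ^ k"
    unfolding Y_def by (simp add: powr_powr mult.commute flip: powr_realpow)
  finally have "q ^ k \<le> real n * (real k * log (real n) (real m) + 1)"
    using Y by (simp add: q_def power_divide divide_le_eq)
  also have "\<dots> = (real n * log (real n) (real m)) * real k + real n" by (simp add: algebra_simps)
  finally show False using k by simp
qed

text \<open>The previous inequality with the roles of \<open>m\<close> and \<open>n\<close>
  exchanged shows that \<open>ln (w n) / ln n\<close> is constant; the constant is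
  \<open>s\<close>.\<close>

lemma ostrowski_archimedean:
  assumes "\<not> nonarch"
  obtains s where "s > 0" "\<And>n. w (of_nat n) = real n powr s"
proof -
  obtain m0 where m0: "w (of_nat m0) > 1" using assms by (auto simp: nonarch_def not_le)
  have m02: "m0 \<ge> 2"
  proof (rule ccontr)
    assume "\<not> m0 \<ge> 2"
    hence "real m0 \<le> 1" by simp
    thus False using of_nat_le[of m0] m0 by linarith
  qed
  have gt: "w (of_nat n) > 1" if n: "n \<ge> 2" for n
  proof (rule ccontr)
    assume "\<not> w (of_nat n) > 1"
    hence "max 1 (w (of_nat n)) = 1" by simp
    thus False using of_nat_le_powr_log[OF n, of m0] m0 m02 by simp
  qed
  have le: "ln (w (of_nat m)) / ln (real m) \<le> ln (w (of_nat n)) / ln (real n)" if mn: "m \<ge> 2" "n \<ge> 2" for m n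
  proof -
    have "w (of_nat m) \<le> w (of_nat n) powr log (real n) (real m)"
      using of_nat_le_powr_log[OF mn(2), of m] gt[OF mn(2)] mn by (simp add: max_def)
    hence "ln (w (of_nat m)) \<le> ln (w (of_nat n) powr log (real n) (real m))"
      using gt[OF mn(1)] gt[OF mn(2)] by (subst ln_le_cancel_iff) auto
    also have "\<dots> = ln (w (of_nat n)) * (ln (real m) / ln (real n))"
      using gt[OF mn(2)] by (simp add: ln_powr log_def)
    finally show ?thesis using mn by (simp add: field_simps)
  qed
  define s where "s = ln (w (of_nat 2)) / ln 2"
  have s0: "s > 0" using gt[of 2] by (simp add: s_def)
  have "w (of_nat n) = real n powr s" for n
  proof (cases "n \<ge> 2")
    case True
    have "ln (w (of_nat n)) / ln (real n) = s" using le[OF True, of 2] le[of 2 n] True by (simp add: s_def)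
    hence "ln (w (of_nat n)) = s * ln (real n)" using True by (simp add: field_simps)
    hence "exp (ln (w (of_nat n))) = real n powr s" using True by (simp add: powr_def)
    thus ?thesis using gt[OF True] by simp
  next
    case False
    hence "n = 0 \<or> n = 1" by auto
    thus ?thesis using s0 by auto
  qed
  thus ?thesis using s0 that by blast
qed

end

text \<open>The exponent \<open>s\<close> is carried along because the absolute value may be any
  representative of its class, so that it is only a power of the usual one on the rationals.\<close>

locale archimedean_complete = absolute_value a for a :: "'c :: field \<Rightarrow> real" +
  fixes s :: real
  assumes s0: "s > 0" and a_of_nat: "\<And>n. a (of_nat n) = real n powr s"
    and complete: "\<And>u::nat \<Rightarrow> 'c. (\<forall>e>0. \<exists>N. \<forall>i\<ge>N. \<forall>j\<ge>N. a (u i - u j) < e) \<Longrightarrow> \<exists>l. (\<lambda>i. a (u i - l)) \<longlonglongrightarrow> 0"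
begin

lemma a_of_int: "a (of_int k) = \<bar>real_of_int k\<bar> powr s"
proof (cases "k \<ge> 0")
  case True
  thus ?thesis using a_of_nat[of "nat k"] by simp
next
  case False
  hence "(of_int k :: 'c) = - of_nat (nat (- k))" by simp
  thus ?thesis using a_of_nat[of "nat (- k)"] False by simp
qed

lemma of_int_ne_0: "k \<noteq> 0 \<Longrightarrow> (of_int k :: 'c) \<noteq> 0"
  using a_of_int[of k] by auto

text \<open>The type of the completion is that of an arbitrary field. Characteristic 0 is a
  consequence of \<open>a_of_nat\<close>, so the rationals are embedded through their reduced
  fractions.\<close>

definition rat_embed :: "rat \<Rightarrow> 'c" where
  "rat_embed q = of_int (fst (quotient_of q)) / of_int (snd (quotient_of q))"

lemma rat_embed_frac:
  assumes "k \<noteq> 0"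
  shows "rat_embed (of_int p / of_int k) = of_int p / of_int k"
proof -
  obtain p' k' where q: "quotient_of (of_int p / of_int k) = (p', k')" by fastforce
  have k': "k' > 0" using quotient_of_denom_pos[OF q] .
  have "(of_int p / of_int k :: rat) = of_int p' / of_int k'" using quotient_of_div[OF q] .
  hence "(of_int (p * k') :: rat) = of_int (p' * k)" using assms k' by (simp add: field_simps)
  hence "p * k' = p' * k" by (simp only: of_int_eq_iff)
  hence "(of_int p * of_int k' :: 'c) = of_int p' * of_int k" by (simp flip: of_int_mult)
  thus ?thesis unfolding rat_embed_def q using of_int_ne_0[of k] of_int_ne_0[of k'] assms k' by (simp add: frac_eq_eq)
qed

lemma rat_cases:
  fixes q :: rat
  obtains p k where "k \<noteq> 0" "q = of_int p / of_int k"
  using quotient_of_div[of q] quotient_of_denom_pos[of q] by (metis less_irrefl prod.collapse)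

lemma rat_embed_add: "rat_embed (x + y) = rat_embed x + rat_embed y" and rat_embed_mult: "rat_embed (x * y) = rat_embed x * rat_embed y"
proof -
  obtain p k where x: "k \<noteq> 0" "x = of_int p / of_int k" by (rule rat_cases)
  obtain p' k' where y: "k' \<noteq> 0" "y = of_int p' / of_int k'" by (rule rat_cases)
  have eq: "x + y = of_int (p * k' + p' * k) / of_int (k * k')" using x y by (simp add: field_simps)
  have "rat_embed (x + y) = of_int (p * k' + p' * k) / of_int (k * k')" unfolding eq by (rule rat_embed_frac) (use x y in simp)
  thus "rat_embed (x + y) = rat_embed x + rat_embed y" using x y rat_embed_frac[OF x(1)] rat_embed_frac[OF y(1)] of_int_ne_0[OF x(1)] of_int_ne_0[OF y(1)]
    by (simp add: add_frac_eq)
  have eq: "x * y = of_int (p * p') / of_int (k * k')" using x y by simp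
  have "rat_embed (x * y) = of_int (p * p') / of_int (k * k')" unfolding eq by (rule rat_embed_frac) (use x y in simp)
  thus "rat_embed (x * y) = rat_embed x * rat_embed y" using x y rat_embed_frac[OF x(1)] rat_embed_frac[OF y(1)] by simp
qed

lemma rat_embed_1: "rat_embed 1 = 1" using rat_embed_frac[of 1 1] by simp

lemma rat_embed_minus: "rat_embed (- x) = - rat_embed x"
proof -
  have "rat_embed 0 = 0" using rat_embed_frac[of 1 0] by simp
  thus ?thesis using rat_embed_add[of x "- x"] by (simp add: eq_neg_iff_add_eq_0 add.commute)
qed

lemma rat_embed_diff: "rat_embed (x - y) = rat_embed x - rat_embed y"
  using rat_embed_add[of x "- y"] by (simp add: rat_embed_minus)

lemma a_rat_embed: "a (rat_embed q) = \<bar>real_of_rat q\<bar> powr s"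
proof -
  obtain p k where q: "k \<noteq> 0" "q = of_int p / of_int k" by (rule rat_cases)
  have "a (rat_embed q) = a (of_int p / of_int k)" unfolding q(2) rat_embed_frac[OF q(1)] ..
  also have "\<dots> = a (of_int p) * inverse (a (of_int k))" by (simp add: divide_inverse mult inverse)
  also have "\<dots> = \<bar>real_of_rat q\<bar> powr s"
    unfolding q(2) by (simp add: a_of_int of_rat_divide powr_divide divide_inverse[symmetric])
  finally show ?thesis .
qed

lemma a_rat_embed_tendsto_0:
  assumes "(\<lambda>n. real_of_rat (x n)) \<longlonglongrightarrow> 0"
  shows "(\<lambda>n. a (rat_embed (x n))) \<longlonglongrightarrow> 0"
proof -
  have "(\<lambda>n. \<bar>real_of_rat (x n)\<bar> powr s) \<longlonglongrightarrow> 0 powr s"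
    by (intro tendsto_powr' tendsto_const tendsto_rabs_zero assms) (use s0 in auto)
  thus ?thesis using s0 by (simp add: a_rat_embed)
qed

lemma limit_unique:
  assumes "(\<lambda>n::nat. a (x n - l)) \<longlonglongrightarrow> 0" "(\<lambda>n. a (x n - l')) \<longlonglongrightarrow> 0"
  shows "l = l'"
proof -
  have "(\<lambda>n. a (x n - l) + a (x n - l')) \<longlonglongrightarrow> 0 + 0" by (intro tendsto_add assms)
  moreover have "a (l - l') \<le> a (x n - l) + a (x n - l')" for n
    using triangle[of "- (x n - l)" "x n - l'"] minus[of "x n - l"] by simp
  ultimately have "a (l - l') \<le> 0 + 0"
    by (intro tendsto_lowerbound[of "\<lambda>n. a (x n - l) + a (x n - l')" _ sequentially]) auto
  hence "a (l - l') = 0" using nonneg[of "l - l'"] by linarith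
  thus ?thesis by simp
qed

definition dyadic :: "real \<Rightarrow> nat \<Rightarrow> rat" where "dyadic r n = of_int \<lfloor>r * 2 ^ n\<rfloor> / 2 ^ n"

lemma dyadic_tendsto: "(\<lambda>n. real_of_rat (dyadic r n)) \<longlonglongrightarrow> r"
proof -
  have "\<bar>real_of_rat (dyadic r n) - r\<bar> \<le> (1 / 2) ^ n" for n
  proof -
    have "real_of_rat (dyadic r n) - r = (real_of_int \<lfloor>r * 2 ^ n\<rfloor> - r * 2 ^ n) / 2 ^ n"
      by (simp add: dyadic_def of_rat_divide of_rat_power diff_divide_distrib)
    hence "\<bar>real_of_rat (dyadic r n) - r\<bar> = \<bar>real_of_int \<lfloor>r * 2 ^ n\<rfloor> - r * 2 ^ n\<bar> / 2 ^ n" by simp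
    also have "\<dots> \<le> 1 / 2 ^ n" by (intro divide_right_mono) (linarith, simp)
    finally show ?thesis by (simp add: power_divide)
  qed
  moreover have "(\<lambda>n. (1 / 2 :: real) ^ n) \<longlonglongrightarrow> 0" by (rule LIMSEQ_power_zero) simp
  ultimately have "(\<lambda>n. real_of_rat (dyadic r n) - r) \<longlonglongrightarrow> 0" by - (rule Lim_null_comparison[of _ "\<lambda>n. (1 / 2 :: real) ^ n"], auto)
  thus ?thesis by (simp add: LIM_zero_iff)
qed

lemma dyadic_limit_exists: "\<exists>l. (\<lambda>n. a (rat_embed (dyadic r n) - l)) \<longlonglongrightarrow> 0"
proof (rule complete, intro allI impI)
  fix e :: real assume e: "e > 0"
  have "Cauchy (\<lambda>n. real_of_rat (dyadic r n))" using dyadic_tendsto by (rule LIMSEQ_imp_Cauchy)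
  moreover have "e powr (1 / s) > 0" using e by simp
  ultimately obtain N where N: "\<And>i j. i \<ge> N \<Longrightarrow> j \<ge> N \<Longrightarrow> dist (real_of_rat (dyadic r i)) (real_of_rat (dyadic r j)) < e powr (1 / s)"
    unfolding Cauchy_def by blast
  show "\<exists>N. \<forall>i\<ge>N. \<forall>j\<ge>N. a (rat_embed (dyadic r i) - rat_embed (dyadic r j)) < e"
  proof (intro exI allI impI)
    fix i j assume ij: "N \<le> i" "N \<le> j"
    have "a (rat_embed (dyadic r i) - rat_embed (dyadic r j)) = \<bar>real_of_rat (dyadic r i) - real_of_rat (dyadic r j)\<bar> powr s"
      by (simp add: rat_embed_diff[symmetric] a_rat_embed of_rat_diff)
    also have "\<dots> < (e powr (1 / s)) powr s" using N[OF ij] s0 by (intro powr_less_mono2) (auto simp: dist_real_def)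
    also have "\<dots> = e" using e s0 by (simp add: powr_powr)
    finally show "a (rat_embed (dyadic r i) - rat_embed (dyadic r j)) < e" .
  qed
qed

text \<open>This extends \<open>rat_embed\<close> to the reals by continuity, with the binary
  truncations as a fixed approximating sequence.\<close>

definition \<rho> :: "real \<Rightarrow> 'c" where "\<rho> r = (SOME l. (\<lambda>n. a (rat_embed (dyadic r n) - l)) \<longlonglongrightarrow> 0)"

text \<open>Independence of the sequence is what makes addition and multiplication pass to the
  limit: sums and products of truncations are not truncations themselves.\<close>

lemma rho_limit:
  assumes "(\<lambda>n. real_of_rat (x n)) \<longlonglongrightarrow> r"
  shows "(\<lambda>n. a (rat_embed (x n) - \<rho> r)) \<longlonglongrightarrow> 0"
proof -
  have 1: "(\<lambda>n. a (rat_embed (dyadic r n) - \<rho> r)) \<longlonglongrightarrow> 0" unfolding \<rho>_def by (rule someI_ex[OF dyadic_limit_exists])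
  have "(\<lambda>n. real_of_rat (x n - dyadic r n)) \<longlonglongrightarrow> r - r" unfolding of_rat_diff by (intro tendsto_diff assms dyadic_tendsto)
  hence "(\<lambda>n. a (rat_embed (x n - dyadic r n))) \<longlonglongrightarrow> 0" by (intro a_rat_embed_tendsto_0) simp
  hence "(\<lambda>n. a (rat_embed (x n - dyadic r n)) + a (rat_embed (dyadic r n) - \<rho> r)) \<longlonglongrightarrow> 0 + 0" using 1 by (rule tendsto_add)
  moreover have "a (rat_embed (x n) - \<rho> r) \<le> a (rat_embed (x n - dyadic r n)) + a (rat_embed (dyadic r n) - \<rho> r)" for n
    using triangle[of "rat_embed (x n - dyadic r n)" "rat_embed (dyadic r n) - \<rho> r"] by (simp add: rat_embed_diff)
  ultimately show ?thesis by - (rule Lim_null_comparison[of _ "\<lambda>n. a (rat_embed (x n - dyadic r n)) + a (rat_embed (dyadic r n) - \<rho> r)"], auto)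
qed

lemma rho_add: "\<rho> (r + t) = \<rho> r + \<rho> t"
proof (rule limit_unique)
  show "(\<lambda>n. a (rat_embed (dyadic r n + dyadic t n) - \<rho> (r + t))) \<longlonglongrightarrow> 0"
    by (rule rho_limit) (unfold of_rat_add, intro tendsto_add dyadic_tendsto)
  have "(\<lambda>n. a (rat_embed (dyadic r n) - \<rho> r) + a (rat_embed (dyadic t n) - \<rho> t)) \<longlonglongrightarrow> 0 + 0"
    by (intro tendsto_add rho_limit dyadic_tendsto)
  moreover have "a (rat_embed (dyadic r n + dyadic t n) - (\<rho> r + \<rho> t)) \<le> a (rat_embed (dyadic r n) - \<rho> r) + a (rat_embed (dyadic t n) - \<rho> t)" for n
    using triangle[of "rat_embed (dyadic r n) - \<rho> r" "rat_embed (dyadic t n) - \<rho> t"] by (simp add: rat_embed_add algebra_simps)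
  ultimately show "(\<lambda>n. a (rat_embed (dyadic r n + dyadic t n) - (\<rho> r + \<rho> t))) \<longlonglongrightarrow> 0"
    by - (rule Lim_null_comparison[of _ "\<lambda>n. a (rat_embed (dyadic r n) - \<rho> r) + a (rat_embed (dyadic t n) - \<rho> t)"], auto)
qed

lemma a_rat_embed_qs_tendsto: "(\<lambda>n. a (rat_embed (dyadic r n))) \<longlonglongrightarrow> \<bar>r\<bar> powr s"
  unfolding a_rat_embed by (intro tendsto_powr' tendsto_const tendsto_rabs dyadic_tendsto) (use s0 in auto)

lemma rho_mult: "\<rho> (r * t) = \<rho> r * \<rho> t"
proof (rule limit_unique)
  show "(\<lambda>n. a (rat_embed (dyadic r n * dyadic t n) - \<rho> (r * t))) \<longlonglongrightarrow> 0"
    by (rule rho_limit) (unfold of_rat_mult, intro tendsto_mult dyadic_tendsto)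
  have "(\<lambda>n. a (rat_embed (dyadic r n)) * a (rat_embed (dyadic t n) - \<rho> t) + a (rat_embed (dyadic r n) - \<rho> r) * a (\<rho> t)) \<longlonglongrightarrow> \<bar>r\<bar> powr s * 0 + 0 * a (\<rho> t)"
    by (intro tendsto_add tendsto_mult tendsto_const rho_limit dyadic_tendsto a_rat_embed_qs_tendsto)
  moreover have "a (rat_embed (dyadic r n * dyadic t n) - \<rho> r * \<rho> t) \<le> a (rat_embed (dyadic r n)) * a (rat_embed (dyadic t n) - \<rho> t) + a (rat_embed (dyadic r n) - \<rho> r) * a (\<rho> t)" for n
    using triangle[of "rat_embed (dyadic r n) * (rat_embed (dyadic t n) - \<rho> t)" "(rat_embed (dyadic r n) - \<rho> r) * \<rho> t"]
    by (simp add: rat_embed_mult mult[symmetric]) (simp add: algebra_simps)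
  ultimately show "(\<lambda>n. a (rat_embed (dyadic r n * dyadic t n) - \<rho> r * \<rho> t)) \<longlonglongrightarrow> 0"
    by - (rule Lim_null_comparison[of _ "\<lambda>n. a (rat_embed (dyadic r n)) * a (rat_embed (dyadic t n) - \<rho> t) + a (rat_embed (dyadic r n) - \<rho> r) * a (\<rho> t)"], auto)
qed

lemma rho_1: "\<rho> 1 = 1"
proof (rule limit_unique)
  show "(\<lambda>n::nat. a (rat_embed 1 - \<rho> 1)) \<longlonglongrightarrow> 0" by (rule rho_limit) simp
  show "(\<lambda>n::nat. a (rat_embed 1 - 1)) \<longlonglongrightarrow> 0" by (simp add: rat_embed_1)
qed

lemma a_rho: "a (\<rho> r) = \<bar>r\<bar> powr s"
proof -
  have "\<bar>a (rat_embed (dyadic r n)) - a (\<rho> r)\<bar> \<le> a (rat_embed (dyadic r n) - \<rho> r)" for n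
    using triangle[of "rat_embed (dyadic r n) - \<rho> r" "\<rho> r"] triangle[of "- (rat_embed (dyadic r n) - \<rho> r)" "rat_embed (dyadic r n)"] minus[of "rat_embed (dyadic r n) - \<rho> r"]
    by (simp add: abs_le_iff)
  hence "(\<lambda>n. a (rat_embed (dyadic r n)) - a (\<rho> r)) \<longlonglongrightarrow> 0"
    by - (rule Lim_null_comparison[OF _ rho_limit[OF dyadic_tendsto[of r]]], auto)
  hence "(\<lambda>n. a (rat_embed (dyadic r n))) \<longlonglongrightarrow> a (\<rho> r)" by (simp add: LIM_zero_iff)
  thus ?thesis using a_rat_embed_qs_tendsto LIMSEQ_unique by blast
qed

text \<open>Adjoining a square root of \<open>-1\<close> extends \<rho> to the complex numbers. On
  the unit circle the transported absolute value is at most 2; as powers stay on the circle, it is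
  at most 1 there, and by passing to inverses equal to 1. Polar decomposition then gives all
  values.\<close>

lemma complex_embedding:
  fixes w :: "'c alg_closure \<Rightarrow> real"
  assumes w: "abs_value w" and wa: "\<And>y. w (to_ac y) = a y"
  obtains \<tau> :: "complex \<Rightarrow> 'c alg_closure" where "field_hom \<tau>" "\<And>z. w (\<tau> z) = norm z powr s"
proof -
  interpret w: absolute_value w by unfold_locales fact
  obtain I :: "'c alg_closure" where "poly [:1, 0, 1:] I = 0"
    using alg_closed_imp_poly_has_root[of "[:1, 0, 1 :: 'c alg_closure:]"] by auto
  hence I: "I * I = - 1" by (simp add: eq_neg_iff_add_eq_0 add.commute)
  have wI: "w I = 1" by (rule w.root_of_unity[of _ 4]) (simp_all add: power4_eq_xxxx I mult.assoc)
  define \<tau> where "\<tau> = (\<lambda>z. to_ac (\<rho> (Re z)) + I * to_ac (\<rho> (Im z)))"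
  have "\<rho> 0 = \<rho> 0 + \<rho> 0" using rho_add[of 0 0] by (simp only: add_0_left)
  hence rho_0: "\<rho> 0 = 0" by (rule add_cancel_right_right[THEN iffD1])
  have rho_minus: "\<rho> (- r) = - \<rho> r" for r using rho_add[of r "- r"] by (simp add: rho_0 eq_neg_iff_add_eq_0 add.commute)
  have rho_diff: "\<rho> (r - t) = \<rho> r - \<rho> t" for r t using rho_add[of r "- t"] by (simp add: rho_minus)
  have add: "\<tau> (x + y) = \<tau> x + \<tau> y" for x y by (simp add: \<tau>_def rho_add algebra_simps)
  have mul: "\<tau> (x * y) = \<tau> x * \<tau> y" for x y
  proof -
    have "\<tau> x * \<tau> y = to_ac (\<rho> (Re x)) * to_ac (\<rho> (Re y)) + (I * I) * to_ac (\<rho> (Im x)) * to_ac (\<rho> (Im y)) +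
        I * (to_ac (\<rho> (Re x)) * to_ac (\<rho> (Im y)) + to_ac (\<rho> (Im x)) * to_ac (\<rho> (Re y)))"
      by (simp add: \<tau>_def algebra_simps)
    also have "\<dots> = \<tau> (x * y)" unfolding I by (simp add: \<tau>_def rho_add rho_diff rho_mult)
    finally show ?thesis ..
  qed
  have one: "\<tau> 1 = 1" by (simp add: \<tau>_def rho_0 rho_1)
  have zero: "\<tau> 0 = 0" by (simp add: \<tau>_def rho_0)
  have hom: "field_hom \<tau>" by unfold_locales (auto simp: add mul one zero)
  interpret t: field_hom \<tau> by fact
  have circle: "w (\<tau> z) \<le> 1" if z: "norm z = 1" for z
  proof (rule ccontr)
    assume "\<not> w (\<tau> z) \<le> 1"
    hence q: "w (\<tau> z) > 1" by simp
    obtain k :: nat where k: "0 * real k + 2 < w (\<tau> z) ^ k" using exp_gt_linear[OF q] by blast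
    define y where "y = z ^ k"
    have ny: "norm y = 1" by (simp add: y_def norm_power z)
    have "w (\<tau> z) ^ k = w (\<tau> y)" by (simp add: y_def w.power[symmetric] hom_distribs)
    also have "\<dots> \<le> w (to_ac (\<rho> (Re y))) + w (I * to_ac (\<rho> (Im y)))" unfolding \<tau>_def by (rule w.triangle)
    also have "\<dots> = \<bar>Re y\<bar> powr s + \<bar>Im y\<bar> powr s" by (simp add: w.mult wI wa a_rho)
    also have "\<dots> \<le> 1 + 1"
      using abs_Re_le_cmod[of y] abs_Im_le_cmod[of y] ny s0 by (intro add_mono powr_le1) auto
    finally show False using k by simp
  qed
  have circle1: "w (\<tau> z) = 1" if z: "norm z = 1" for z
  proof -
    have "z \<noteq> 0" using z by auto
    have "w (\<tau> (inverse z)) \<le> 1" using z by (intro circle) (simp add: norm_inverse)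
    moreover have "w (\<tau> z) * w (\<tau> (inverse z)) = 1"
    proof -
      have "\<tau> z * \<tau> (inverse z) = 1" using \<open>z \<noteq> 0\<close> by (simp add: mul[symmetric] one)
      thus ?thesis by (simp flip: w.mult)
    qed
    ultimately show ?thesis using circle[OF z] w.nonneg[of "\<tau> z"]
      by (smt (verit) mult_le_cancel_left1 mult_left_le)
  qed
  have "w (\<tau> z) = norm z powr s" for z
  proof (cases "z = 0")
    case False
    have "z = of_real (norm z) * sgn z" using False by (simp add: sgn_eq)
    hence "w (\<tau> z) = w (\<tau> (of_real (norm z))) * w (\<tau> (sgn z))" by (metis mul w.mult)
    also have "w (\<tau> (sgn z)) = 1" using False by (intro circle1) (simp add: norm_sgn)
    also have "w (\<tau> (of_real (norm z))) = norm z powr s" by (simp add: \<tau>_def rho_0 wa a_rho)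
    finally show ?thesis by simp
  qed (use s0 in \<open>simp add: zero\<close>)
  thus ?thesis using hom that by blast
qed

end

subsection \<open>The limit formula\<close>

text \<open>A polynomial over the complex numbers splits there already, so its image has no roots
  other than the images of its complex roots.\<close>

lemma root_in_range:
  fixes \<tau> :: "complex \<Rightarrow> 'b :: field"
  assumes t: "field_hom \<tau>" and p: "p \<noteq> 0" "poly (map_poly \<tau> p) y = 0"
  shows "\<exists>z. y = \<tau> z \<and> poly p z = 0"
proof -
  interpret t: field_hom \<tau> by fact
  interpret pt: map_poly_inj_idom_hom \<tau> ..
  show ?thesis using p
  proof (induction "degree p" arbitrary: p rule: less_induct)
    case (less p)
    have "degree p > 0"
    proof (rule ccontr)
      assume "\<not> degree p > 0"
      then obtain c where "p = [:c:]" by (auto elim: degree_eq_zeroE)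
      thus False using less by simp
    qed
    then obtain z where z: "poly p z = 0" using alg_closed_imp_poly_has_root[of p] by blast
    then obtain q where q: "p = [:- z, 1:] * q" by (auto simp: poly_eq_0_iff_dvd)
    have q0: "q \<noteq> 0" using q less by auto
    have dq: "degree q < degree p" unfolding q using q0 by (subst degree_mult_eq) auto
    have "(y - \<tau> z) * poly (map_poly \<tau> q) y = 0"
      using less(3) unfolding q by (simp add: hom_distribs algebra_simps)
    hence "y = \<tau> z \<or> poly (map_poly \<tau> q) y = 0" by auto
    thus ?case
    proof
      assume "poly (map_poly \<tau> q) y = 0"
      then obtain z' where "y = \<tau> z'" "poly q z' = 0" using less(1)[OF dq q0] by blast
      thus ?thesis unfolding q by auto
    qed (use z in blast)
  qed
qed

lemma conjugate_root_of_unity: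
  fixes j :: "'k :: field \<Rightarrow> 'b :: field"
  assumes g: "is_minpoly x g" and j: "field_hom j" and m: "m \<ge> 2" and x: "preperiodic (cheb m) x"
    and y: "poly (map_poly j g) (u + inverse u) = 0" and u: "u \<noteq> 0"
  shows "\<exists>n>0. u ^ n = 1" "\<And>N. u ^ N = 1 \<Longrightarrow> poly (cheb N) x = 2"
proof -
  interpret j: field_hom j by fact
  interpret pj: map_poly_inj_idom_hom j ..
  interpret ph: map_poly_inj_idom_hom "to_ac :: 'k \<Rightarrow> 'k alg_closure" ..
  have jh: "comm_ring_hom j" ..
  have th: "comm_ring_hom (to_ac :: 'k \<Rightarrow> 'k alg_closure)" ..
  have ej: "poly (map_poly j (cheb n - 2)) v = poly (cheb n) v - 2" for n v
    by (simp add: hom_distribs map_poly_cheb[OF jh])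
  have ea: "poly (ac_poly (cheb n - 2)) x = poly (cheb n) x - 2" for n
    by (simp add: hom_distribs map_poly_cheb[OF th])
  show "poly (cheb N) x = 2" if "u ^ N = 1" for N
  proof -
    have "poly (map_poly j (cheb N - 2)) (u + inverse u) = 0"
      unfolding ej using poly_cheb_eq_2_iff[OF u] that by simp
    hence "g dvd cheb N - 2" by (rule minpoly_dvd_of_common_root[OF g j y])
    then obtain e where "cheb N - 2 = g * e" by blast
    hence "poly (ac_poly (cheb N - 2)) x = 0" using g by (simp add: hom_distribs is_minpoly_def)
    thus ?thesis unfolding ea by simp
  qed
  obtain z where z: "z \<noteq> 0" "x = z + inverse z" by (rule exists_plus_inverse)
  then obtain n where n: "n > 0" "z ^ n = 1" using x preperiodic_cheb_iff[OF z(1) m] by auto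
  have "poly (ac_poly (cheb n - 2)) x = 0"
    unfolding ea using poly_cheb_eq_2_iff[OF z(1), of n] n z(2) by simp
  hence "g dvd cheb n - 2" using g by (simp add: is_minpoly_def)
  then obtain e where "cheb n - 2 = g * e" by blast
  hence "poly (map_poly j (cheb n - 2)) (u + inverse u) = 0" using y by (simp add: hom_distribs)
  hence "u ^ n = 1" unfolding ej using poly_cheb_eq_2_iff[OF u, of n] by simp
  thus "\<exists>n>0. u ^ n = 1" using n by blast
qed

text \<open>This is where nonrepetition enters: the points with a given order are finitely many, so
  a given order occurs at finitely many indices only.\<close>

lemma finite_cheb_index:
  fixes x :: "nat \<Rightarrow> 'a :: idom"
  assumes "inj x" "N > 0"
  shows "finite {n. poly (cheb N) (x n) = 2}"
  using finite_vimageI[OF finite_cheb_eq_2[OF assms(2)] assms(1)] by (simp add: vimage_def)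

lemma average_near:
  fixes f :: "'a \<Rightarrow> real"
  assumes "finite Y" "Y \<noteq> {}" "\<And>y. y \<in> Y \<Longrightarrow> \<bar>f y - c\<bar> \<le> \<epsilon>"
  shows "\<bar>1 / real (card Y) * (\<Sum>y\<in>Y. f y) - c\<bar> \<le> \<epsilon>"
proof -
  have d: "real (card Y) > 0" using assms by (simp add: card_gt_0_iff)
  have "\<bar>\<Sum>y\<in>Y. f y - c\<bar> \<le> (\<Sum>y\<in>Y. \<bar>f y - c\<bar>)" by (rule sum_abs)
  also have "\<dots> \<le> (\<Sum>y\<in>Y. \<epsilon>)" by (rule sum_mono) (use assms in auto)
  finally have "\<bar>(\<Sum>y\<in>Y. f y) - real (card Y) * c\<bar> \<le> real (card Y) * \<epsilon>" by (simp add: sum_subtractf)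
  moreover have "1 / real (card Y) * (\<Sum>y\<in>Y. f y) - c = ((\<Sum>y\<in>Y. f y) - real (card Y) * c) / real (card Y)"
    using d by (simp add: diff_divide_distrib)
  ultimately show ?thesis using d by (simp add: divide_le_eq mult.commute)
qed

lemma plus_inverse_diff:
  fixes u b :: "'a :: field"
  assumes "u \<noteq> 0" "b \<noteq> 0"
  shows "(u + inverse u) - (b + inverse b) = inverse u * ((u - b) * (u - inverse b))"
  using assms by (simp add: field_simps)

lemma (in absolute_value) ln_plus_inverse_diff:
  assumes u: "u ^ n = 1" "n > 0" and b: "b \<noteq> 0" "\<And>n. n > 0 \<Longrightarrow> b ^ n \<noteq> 1"
  shows "ln (w ((u + inverse u) - (b + inverse b))) = ln (w (u - b)) + ln (w (u - inverse b))"
proof -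
  have u0: "u \<noteq> 0" using u by (auto simp: power_0_left)
  have "u \<noteq> b" using u b by auto
  moreover have "u \<noteq> inverse b" using u b(2)[OF u(2)] by (auto simp: power_inverse)
  moreover have "w (inverse u) = 1" by (simp add: inverse root_of_unity[OF u])
  ultimately show ?thesis unfolding plus_inverse_diff[OF u0 b(1)] mult
    using pos[of "u - b"] pos[of "u - inverse b"] by (simp add: ln_mult)
qed

text \<open>The estimate holds for every conjugate separately, hence for the average. If
  \<open>w b\<close> differs from 1, the ultrametric inequality gives equality for all
  \<open>n\<close>. Otherwise both factors are at most 1, and only finitely many roots of unity are
  close to \<open>b\<close> or its inverse; their orders are avoided from some index on.\<close>

lemma (in absolute_value) nonarch_case:
  fixes x :: "nat \<Rightarrow> 'k :: field_char_0 alg_closure" and j :: "'k \<Rightarrow> 'a"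
  assumes na: nonarch and w0: "\<And>n. n > 0 \<Longrightarrow> (of_nat n :: 'a) \<noteq> 0" and j: "field_hom j" and m: "m \<ge> 2"
    and x: "inj x" "\<And>n. preperiodic (cheb m) (x n)" and g: "\<And>n. is_minpoly (x n) (g n)"
    and b: "b \<noteq> 0" "\<And>n. n > 0 \<Longrightarrow> b ^ n \<noteq> 1" and \<epsilon>: "\<epsilon> > 0"
  shows "eventually (\<lambda>n. \<forall>u. u \<noteq> 0 \<longrightarrow> poly (map_poly j (g n)) (u + inverse u) = 0 \<longrightarrow>
            \<bar>ln (w ((u + inverse u) - (b + inverse b))) - \<bar>ln (w b)\<bar>\<bar> \<le> \<epsilon>) sequentially"
proof (cases "w b = 1")
  case False
  have "\<bar>ln (w ((u + inverse u) - (b + inverse b))) - \<bar>ln (w b)\<bar>\<bar> \<le> \<epsilon>" if u: "u \<noteq> 0" "poly (map_poly j (g n)) (u + inverse u) = 0" for u n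
  proof -
    obtain N where N: "N > 0" "u ^ N = 1" using conjugate_root_of_unity(1)[OF g j m x(2) u(2,1)] by blast
    have wu: "w u = 1" using root_of_unity[OF N(2,1)] .
    have far: "ln (w (u - c)) = max 0 (ln (w c))" if c: "c \<noteq> 0" "w c \<noteq> 1" for c
    proof (cases "w c < 1")
      case True
      have "w (c - u) = w u" by (rule ultrametric_eq(2)[OF na]) (simp add: wu True)
      hence "w (u - c) = 1" using minus[of "u - c"] wu by simp
      thus ?thesis using True pos[OF c(1)] by simp
    next
      case False
      hence "w c > 1" using c by simp
      moreover from this have "w (u - c) = w c" by (intro ultrametric_eq(2)[OF na]) (simp add: wu)
      ultimately show ?thesis by simp
    qed
    have "ln (w ((u + inverse u) - (b + inverse b))) = ln (w (u - b)) + ln (w (u - inverse b))"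
      by (rule ln_plus_inverse_diff[OF N(2,1) b])
    also have "ln (w (u - b)) = max 0 (ln (w b))" by (rule far[OF b(1) False])
    also have "ln (w (u - inverse b)) = max 0 (ln (w (inverse b)))"
      by (rule far) (use b(1) False in \<open>auto simp: inverse\<close>)
    also have "ln (w (inverse b)) = - ln (w b)" using pos[OF b(1)] by (simp add: inverse ln_inverse)
    also have "max 0 (ln (w b)) + max 0 (- ln (w b)) = \<bar>ln (w b)\<bar>" by (simp add: max_def)
    finally show ?thesis using \<epsilon> by simp
  qed
  thus ?thesis by auto
next
  case True
  \<comment> \<open>Each of the two factors may lower the logarithm by at most
    \<open>\<epsilon> / 2\<close>.\<close>
  define r where "r = exp (- \<epsilon> / 2)"
  have r: "0 < r" "r < 1" using \<epsilon> by (auto simp: r_def)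
  define Xi where "Xi = {u. (\<exists>n>0. u ^ n = 1) \<and> w (u - b) \<le> r} \<union> {u. (\<exists>n>0. u ^ n = 1) \<and> w (u - inverse b) \<le> r}"
  have finXi: "finite Xi" unfolding Xi_def using finite_roots_near[OF na w0 r] by blast
  have "\<forall>u\<in>Xi. \<exists>N. N > 0 \<and> u ^ N = 1" by (auto simp: Xi_def)
  then obtain N where N: "\<And>u. u \<in> Xi \<Longrightarrow> N u > 0 \<and> u ^ N u = 1" by metis
  define bad where "bad = (\<Union>u\<in>Xi. {n. poly (cheb (N u)) (x n) = 2})"
  have "finite bad" unfolding bad_def using finXi N finite_cheb_index[OF x(1)] by blast
  then obtain n0 where n0: "\<And>n. n \<in> bad \<Longrightarrow> n < n0" using finite_nat_set_iff_bounded by auto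
  show ?thesis unfolding eventually_sequentially
  proof (intro exI allI impI)
    fix n u assume n: "n \<ge> n0" and u: "u \<noteq> 0" "poly (map_poly j (g n)) (u + inverse u) = 0"
    obtain M where M: "M > 0" "u ^ M = 1" using conjugate_root_of_unity(1)[OF g j m x(2) u(2,1)] by blast
    have wu: "w u = 1" using root_of_unity[OF M(2,1)] .
    have "u \<notin> Xi"
    proof
      assume uX: "u \<in> Xi"
      have "poly (cheb (N u)) (x n) = 2"
        by (rule conjugate_root_of_unity(2)[OF g j m x(2) u(2,1)]) (use N[OF uX] in simp)
      hence "n \<in> bad" using uX by (auto simp: bad_def)
      thus False using n0 n by (meson not_less)
    qed
    moreover have "\<exists>n>0. u ^ n = 1" using M by blast
    ultimately have gt: "w (u - b) > r" "w (u - inverse b) > r" unfolding Xi_def by (simp_all add: not_le)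
    have le1: "w (u - c) \<le> 1" if "w c = 1" for c
      using ultrametric[OF na, of u "- c"] wu that by simp
    have bound: "- (\<epsilon> / 2) \<le> ln t \<and> ln t \<le> 0" if "t > r" "t \<le> 1" for t
    proof -
      have "ln r \<le> ln t" using that r by (subst ln_le_cancel_iff) auto
      moreover have "t > 0" using that(1) r(1) by linarith
      hence "ln t \<le> 0" using that(2) by simp
      ultimately show ?thesis by (simp add: r_def)
    qed
    have "w (inverse b) = 1" using True by (simp add: inverse)
    hence "- (\<epsilon> / 2) \<le> ln (w (u - b)) \<and> ln (w (u - b)) \<le> 0" "- (\<epsilon> / 2) \<le> ln (w (u - inverse b)) \<and> ln (w (u - inverse b)) \<le> 0"
      using bound gt le1 True by blast+
    moreover have "ln (w ((u + inverse u) - (b + inverse b))) = ln (w (u - b)) + ln (w (u - inverse b))"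
      by (rule ln_plus_inverse_diff[OF M(2,1) b])
    ultimately show "\<bar>ln (w ((u + inverse u) - (b + inverse b))) - \<bar>ln (w b)\<bar>\<bar> \<le> \<epsilon>"
      unfolding True by (simp add: abs_le_iff)
  qed
qed

text \<open>The polynomial is \<open>X^D f (X + 1/X)\<close> with \<open>D\<close> the degree of
  \<open>f\<close>. It is nonzero because every complex number has the form \<open>y + 1/y\<close>,
  so its vanishing would make \<open>f\<close> vanish everywhere.\<close>

lemma int_poly_plus_inverse:
  fixes f :: "int poly"
  assumes f: "f \<noteq> 0" "poly (cpoly f) (b + inverse b) = 0" and b: "b \<noteq> 0"
  obtains F :: "int poly" where "F \<noteq> 0" "poly (cpoly F) b = 0" "poly (cpoly F) (inverse b) = 0"
proof -
  interpret h: inj_idom_hom "of_int :: int \<Rightarrow> complex" by unfold_locales auto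
  interpret ph: map_poly_inj_idom_hom "of_int :: int \<Rightarrow> complex" ..
  define D where "D = degree f"
  define F where "F = (\<Sum>i\<le>D. smult (coeff f i) ([:1, 0, 1:] ^ i * monom 1 (D - i)))"
  have ev: "poly (cpoly F) y = y ^ D * poly (cpoly f) (y + inverse y)" if y: "y \<noteq> 0" for y
  proof -
    have "poly (cpoly F) y = (\<Sum>i\<le>D. of_int (coeff f i) * ((1 + y * y) ^ i * y ^ (D - i)))"
      by (simp add: F_def hom_distribs poly_sum poly_monom)
    also have "\<dots> = (\<Sum>i\<le>D. y ^ D * (of_int (coeff f i) * (y + inverse y) ^ i))"
    proof (rule sum.cong)
      fix i assume i: "i \<in> {..D}"
      have "1 + y * y = y * (y + inverse y)" using y by (simp add: algebra_simps)
      hence "(1 + y * y) ^ i * y ^ (D - i) = (y ^ i * y ^ (D - i)) * (y + inverse y) ^ i"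
        by (simp add: power_mult_distrib)
      also have "y ^ i * y ^ (D - i) = y ^ D" unfolding power_add[symmetric] using i by simp
      finally show "of_int (coeff f i) * ((1 + y * y) ^ i * y ^ (D - i)) = y ^ D * (of_int (coeff f i) * (y + inverse y) ^ i)"
        by simp
    qed simp
    also have "\<dots> = y ^ D * poly (cpoly f) (y + inverse y)" by (simp add: poly_altdef D_def sum_distrib_left)
    finally show ?thesis .
  qed
  have "F \<noteq> 0"
  proof
    assume F0: "F = 0"
    have "poly (cpoly f) t = 0" for t
    proof -
      obtain y where y: "y \<noteq> 0" "t = y + inverse y" by (rule exists_plus_inverse)
      thus ?thesis using ev[OF y(1)] F0 by simp
    qed
    hence "cpoly f = 0" using poly_all_0_iff_0[of "cpoly f"] by blast
    thus False using f(1) by simp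
  qed
  moreover have "poly (cpoly F) b = 0" using ev[OF b] f by simp
  moreover have "poly (cpoly F) (inverse b) = 0" using ev[of "inverse b"] b f by (simp add: add.commute)
  ultimately show ?thesis by (rule that)
qed

lemma arch_case:
  fixes x :: "nat \<Rightarrow> 'k :: field_char_0 alg_closure" and \<kappa> :: "'k \<Rightarrow> complex"
  assumes nf: "number_field TYPE('k)" and k: "field_hom \<kappa>" and m: "m \<ge> 2"
    and x: "inj x" "\<And>n. preperiodic (cheb m) (x n)" and g: "\<And>n. is_minpoly (x n) (g n)"
    and b: "b \<noteq> 0" "\<And>n. n > 0 \<Longrightarrow> b ^ n \<noteq> 1" "\<kappa> \<alpha> = b + inverse b"
  shows "(\<lambda>n. 1 / real (degree (g n)) * (\<Sum>y | poly (map_poly \<kappa> (g n)) y = 0. ln (norm (y - \<kappa> \<alpha>)))) \<longlonglongrightarrow> \<bar>ln (norm b)\<bar>"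
proof (rule LIMSEQ_I)
  fix e :: real assume e: "e > 0"
  interpret k: field_hom \<kappa> by fact
  interpret pk: map_poly_inj_idom_hom \<kappa> ..
  define \<epsilon> where "\<epsilon> = e / 4"
  have \<epsilon>: "\<epsilon> > 0" using e by (simp add: \<epsilon>_def)
  obtain Bs :: "'k set" where Bs: "finite Bs" "module.span (\<lambda>(q::rat) (x::'k). of_rat q * x) Bs = UNIV"
    using number_field_basis[OF nf] .
  obtain f :: "int poly" where f: "f \<noteq> 0" "poly (map_poly of_int f) \<alpha> = 0" using number_field_algebraic[OF nf] by blast
  have "poly (cpoly f) (\<kappa> \<alpha>) = 0"
  proof -
    have "cpoly f = map_poly \<kappa> (map_poly of_int f)" by (rule poly_eqI) (simp add: coeff_map_poly hom_distribs)
    thus ?thesis using f(2) by simp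
  qed
  then obtain F where F: "F \<noteq> 0" "poly (cpoly F) b = 0" "poly (cpoly F) (inverse b) = 0"
    using int_poly_plus_inverse[OF f(1) _ b(1)] b(3) by metis
  \<comment> \<open>The totient of \<open>N\<close> is at most \<open>card Bs\<close> times
    \<open>card H\<close>, so the orbit has at least the proportion \<open>c\<close> of all
    units.\<close>
  define c where "c = 1 / (real (card Bs) + 1)"
  have c: "c > 0" by (simp add: c_def)
  have ib: "inverse b ^ n \<noteq> 1" if "n > 0" for n using b(2)[OF that] by (simp add: power_inverse)
  obtain N1 where N1: "\<And>N H. N \<ge> N1 \<Longrightarrow> galois_orbit N H \<Longrightarrow> c * (real N / (log 2 (real N) + 1)) \<le> real (card H) \<Longrightarrow>
     \<bar>(\<Sum>h\<in>H. ln (norm (unity_root N ^ h - b))) - real (card H) * max 0 (ln (norm b))\<bar> \<le> \<epsilon> * real (card H)"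
    using log_average[OF F(1,2) b(2) c \<epsilon>] by blast
  obtain N2 where N2: "\<And>N H. N \<ge> N2 \<Longrightarrow> galois_orbit N H \<Longrightarrow> c * (real N / (log 2 (real N) + 1)) \<le> real (card H) \<Longrightarrow>
     \<bar>(\<Sum>h\<in>H. ln (norm (unity_root N ^ h - inverse b))) - real (card H) * max 0 (ln (norm (inverse b)))\<bar> \<le> \<epsilon> * real (card H)"
    using log_average[OF F(1,3) ib c \<epsilon>] by blast
  \<comment> \<open>The bound 3 is for the two-to-one correspondence between exponents and
    conjugates, the others for the two averages, over \<open>u - b\<close> and over
    \<open>u - 1/b\<close>.\<close>
  define N0 where "N0 = max 3 (max N1 N2)"
  define bad where "bad = (\<Union>N\<in>{1..<N0}. {n. poly (cheb N) (x n) = 2})"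
  have "finite bad" unfolding bad_def
    using finite_cheb_index[OF x(1)] by (intro finite_UN_I) auto
  then obtain n0 where n0: "\<And>n. n \<in> bad \<Longrightarrow> n < n0"
    using finite_nat_set_iff_bounded by auto
  interpret cn: absolute_value "norm :: complex \<Rightarrow> real"
    by unfold_locales (auto simp: abs_value_def norm_mult norm_triangle_ineq)
  show "\<exists>no. \<forall>n\<ge>no. norm (1 / real (degree (g n)) * (\<Sum>y | poly (map_poly \<kappa> (g n)) y = 0. ln (norm (y - \<kappa> \<alpha>))) - \<bar>ln (norm b)\<bar>) < e"
  proof (intro exI allI impI)
    fix n assume n: "n \<ge> n0"
    obtain N H where orb: "galois_orbit N H" and cheb: "poly (cheb N) (x n) = 2" and tot: "totient N \<le> 2 * degree (g n) * card Bs"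
      and sumH: "\<And>F :: complex \<Rightarrow> real. N \<ge> 3 \<Longrightarrow> (\<Sum>h\<in>H. F (unity_root N ^ h + inverse (unity_root N ^ h))) = 2 * (\<Sum>y | poly (map_poly \<kappa> (g n)) y = 0. F y)"
      by (rule conjugate_exponents[OF g k m x(2) Bs]) (rule that)
    have N: "N > 0" using orb by (simp add: galois_orbit_def)
    have NN0: "N \<ge> N0"
    proof (rule ccontr)
      assume "\<not> N \<ge> N0"
      hence "n \<in> bad" using cheb N by (auto simp: bad_def)
      thus False using n0 n by (meson not_less)
    qed
    hence N3: "N \<ge> 3" "N \<ge> N1" "N \<ge> N2" by (auto simp: N0_def)
    define d where "d = degree (g n)"
    have d: "d > 0" using minpoly_degree_pos[OF g] by (simp add: d_def)
    have "real (card H) = 2 * real (card {y. poly (map_poly \<kappa> (g n)) y = 0})"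
      using sumH[OF N3(1), of "\<lambda>_. 1"] by simp
    also have "card {y. poly (map_poly \<kappa> (g n)) y = 0} = d" unfolding d_def by (rule card_minpoly_roots[OF g k])
    finally have cH: "real (card H) = 2 * real d" .
    have "c * (real N / (log 2 (real N) + 1)) \<le> c * real (totient N)"
      using totient_ge[OF N] c by (intro mult_left_mono) auto
    also have "\<dots> \<le> c * (real (card H) * (real (card Bs) + 1))"
    proof (intro mult_left_mono)
      have "real (totient N) \<le> real (2 * d * card Bs)" using tot unfolding d_def by (rule of_nat_mono)
      also have "\<dots> = real (card H) * real (card Bs)" by (simp add: cH)
      also have "\<dots> \<le> real (card H) * (real (card Bs) + 1)" by (intro mult_left_mono) auto
      finally show "real (totient N) \<le> real (card H) * (real (card Bs) + 1)" .
    qed (use c in simp)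
    also have "\<dots> = real (card H)" by (simp add: c_def)
    finally have big: "c * (real N / (log 2 (real N) + 1)) \<le> real (card H)" .
    have lnsplit: "ln (norm ((unity_root N ^ h + inverse (unity_root N ^ h)) - \<kappa> \<alpha>)) =
        ln (norm (unity_root N ^ h - b)) + ln (norm (unity_root N ^ h - inverse b))" for h
      unfolding b(3)
    proof (rule cn.ln_plus_inverse_diff[OF _ N b(1,2)])
      show "(unity_root N ^ h) ^ N = 1" using cis_root_of_unity[OF N] by (metis mult.commute power_mult power_one)
    qed
    define T where "T = (\<Sum>y | poly (map_poly \<kappa> (g n)) y = 0. ln (norm (y - \<kappa> \<alpha>)))"
    have T2: "2 * T = (\<Sum>h\<in>H. ln (norm (unity_root N ^ h - b))) + (\<Sum>h\<in>H. ln (norm (unity_root N ^ h - inverse b)))"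
      unfolding T_def using sumH[OF N3(1), of "\<lambda>y. ln (norm (y - \<kappa> \<alpha>))"] by (simp add: lnsplit sum.distrib)
    define m1 m2 where "m1 = max 0 (ln (norm b))" and "m2 = max 0 (ln (norm (inverse b)))"
    have m12: "m1 + m2 = \<bar>ln (norm b)\<bar>" using b(1) by (simp add: m1_def m2_def norm_inverse ln_inverse max_def abs_if)
    \<comment> \<open>Each of the two averages contributes an error \<open>\<epsilon>\<close> per
      exponent. Since \<open>card H = 2 d\<close>, the error of \<open>T / d\<close> is
      \<open>2 \<epsilon> = e / 2\<close>.\<close>
    have "\<bar>2 * T - real (card H) * (m1 + m2)\<bar> \<le> 2 * (\<epsilon> * real (card H))"
      using N1[OF N3(2) orb big] N2[OF N3(3) orb big] unfolding T2 m1_def[symmetric] m2_def[symmetric]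
      by (simp add: distrib_left abs_le_iff)
    hence T3: "\<bar>T - real d * \<bar>ln (norm b)\<bar>\<bar> \<le> real d * (2 * \<epsilon>)" unfolding cH m12 by (simp add: abs_le_iff algebra_simps)
    have "1 / real d * T - \<bar>ln (norm b)\<bar> = (T - real d * \<bar>ln (norm b)\<bar>) / real d" using d by (simp add: diff_divide_distrib)
    hence "\<bar>1 / real d * T - \<bar>ln (norm b)\<bar>\<bar> \<le> 2 * \<epsilon>" using T3 d by (simp add: divide_le_eq mult.commute)
    also have "\<dots> < e" using e by (simp add: \<epsilon>_def)
    finally show "norm (1 / real (degree (g n)) * (\<Sum>y | poly (map_poly \<kappa> (g n)) y = 0. ln (norm (y - \<kappa> \<alpha>))) - \<bar>ln (norm b)\<bar>) < e"
      by (simp add: T_def d_def)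
  qed
qed

theorem theorem1p3:
  fixes m :: nat
    and x :: "nat \<Rightarrow> 'k::field_char_0 alg_closure"
    and \<alpha> :: 'k
    and v :: "('k \<Rightarrow> real) set"
    and \<iota> :: "'k \<Rightarrow> 'c::field"
    and a :: "'c \<Rightarrow> real"
    and w :: "'c alg_closure \<Rightarrow> real"
  assumes "m \<ge> 2"
    and "number_field TYPE('k)"
    and "inj x"
    and "\<And>n. preperiodic (cheb m) (x n)"
    and "\<not> preperiodic (cheb m) \<alpha>"
    and "v \<in> places"
    and "is_completion v \<iota> a"
    and "abs_value w"
    and "\<And>y. w (to_ac y) = a y"
  shows "(\<lambda>n. 1 / real (ext_degree (adjoin (x n))) *
            (\<Sum>\<sigma>\<in>embeddings_over (\<lambda>c. to_ac (\<iota> c)) (adjoin (x n)).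
               ln (w (\<sigma> (x n) - to_ac (\<iota> \<alpha>)))))
         \<longlonglongrightarrow> local_height w (cheb m) (to_ac (\<iota> \<alpha>))"
proof -
  interpret w: absolute_value w by unfold_locales fact
  define j where "j = (\<lambda>c. to_ac (\<iota> c))"
  have \<iota>: "\<iota> 1 = 1" "\<And>x y. \<iota> (x + y) = \<iota> x + \<iota> y" "\<And>x y. \<iota> (x * y) = \<iota> x * \<iota> y"
    using assms(7) by (auto simp: is_completion_def)
  have "\<iota> 0 = \<iota> 0 + \<iota> 0" using \<iota>(2)[of 0 0] by (simp only: add_0_left)
  hence \<iota>0: "\<iota> 0 = 0" by (rule add_cancel_right_right[THEN iffD1])
  have j: "field_hom j" by unfold_locales (auto simp: j_def \<iota> \<iota>0)
  interpret j: field_hom j by fact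
  interpret pj: map_poly_inj_idom_hom j ..
  have w0: "(of_nat n :: 'c alg_closure) \<noteq> 0" if "n > 0" for n
  proof -
    have "(of_nat n :: 'c alg_closure) = j (of_nat n)" by (simp add: hom_distribs)
    thus ?thesis using that by simp
  qed
  define g where "g = (\<lambda>n. SOME g. is_minpoly (x n) g)"
  have g: "is_minpoly (x n) (g n)" for n
    unfolding g_def by (rule someI_ex) (rule minpoly_exists[of "x n"], blast)
  define Y where "Y = (\<lambda>n. {y. poly (map_poly j (g n)) y = 0})"
  have cardY: "card (Y n) = degree (g n)" for n unfolding Y_def by (rule card_minpoly_roots[OF g j])
  have finY: "finite (Y n)" "Y n \<noteq> {}" for n
    using cardY[of n] minpoly_degree_pos[OF g, of n] by (auto simp: card_gt_0_iff[symmetric] intro: card_ge_0_finite)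
  obtain b where b0: "b \<noteq> 0" and b: "j \<alpha> = b + inverse b" by (rule exists_plus_inverse)
  have "inj_idom_hom j" ..
  hence "\<not> preperiodic (cheb m) (j \<alpha>)" using assms(5) preperiodic_cheb_hom by blast
  hence nr: "b ^ n \<noteq> 1" if "n > 0" for n
    using preperiodic_cheb_iff[OF b0 assms(1)] that unfolding b by blast
  have lh: "local_height w (cheb m) (j \<alpha>) = \<bar>ln (w b)\<bar>"
    unfolding b by (rule w.local_height_cheb[OF b0 assms(1)])
  have "(\<lambda>n. 1 / real (card (Y n)) * (\<Sum>y\<in>Y n. ln (w (y - j \<alpha>)))) \<longlonglongrightarrow> \<bar>ln (w b)\<bar>"
  proof (cases "w.nonarch")
    case True
    show ?thesis
    proof (rule tendstoI)
      fix e :: real assume e: "e > 0"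
      hence "e / 2 > 0" by simp
      hence "eventually (\<lambda>n. \<forall>u. u \<noteq> 0 \<longrightarrow> poly (map_poly j (g n)) (u + inverse u) = 0 \<longrightarrow>
            \<bar>ln (w ((u + inverse u) - (b + inverse b))) - \<bar>ln (w b)\<bar>\<bar> \<le> e / 2) sequentially"
        by (intro w.nonarch_case[OF True w0 j assms(1,3,4) g b0 nr]) auto
      thus "eventually (\<lambda>n. dist (1 / real (card (Y n)) * (\<Sum>y\<in>Y n. ln (w (y - j \<alpha>)))) \<bar>ln (w b)\<bar> < e) sequentially"
      proof eventually_elim
        case (elim n)
        have "\<bar>1 / real (card (Y n)) * (\<Sum>y\<in>Y n. ln (w (y - j \<alpha>))) - \<bar>ln (w b)\<bar>\<bar> \<le> e / 2"
        proof (rule average_near[OF finY])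
          fix y assume y: "y \<in> Y n"
          obtain u where u: "u \<noteq> 0" "y = u + inverse u" by (rule exists_plus_inverse)
          show "\<bar>ln (w (y - j \<alpha>)) - \<bar>ln (w b)\<bar>\<bar> \<le> e / 2"
            using elim u y unfolding b by (simp add: Y_def)
        qed
        thus ?case using e by (simp add: dist_real_def)
      qed
    qed
  next
    case False
    interpret a: absolute_value a using assms(7) by unfold_locales (simp add: is_completion_def)
    obtain s where s: "s > 0" "\<And>n. w (of_nat n) = real n powr s" using w.ostrowski_archimedean[OF False] by blast
    interpret ac: archimedean_complete a s
    proof unfold_locales
      show "a (of_nat n) = real n powr s" for n using assms(9)[of "of_nat n"] s(2)[of n] by simp
    qed (use s(1) assms(7) in \<open>auto simp: is_completion_def\<close>)
    obtain \<tau> :: "complex \<Rightarrow> 'c alg_closure" where \<tau>: "field_hom \<tau>" "\<And>z. w (\<tau> z) = norm z powr s"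
      using ac.complex_embedding[OF assms(8,9)] by blast
    interpret t: field_hom \<tau> by (rule \<tau>(1))
    interpret pt: map_poly_inj_idom_hom \<tau> ..
    \<comment> \<open>Elements of the number field are roots of integer polynomials, and such roots
      lie in the image of the complex numbers. So the embedding into the closure of the completion
      factors through a complex embedding \<kappa>.\<close>
    have "\<exists>z. j c = \<tau> z" for c
    proof -
      obtain f :: "int poly" where f: "f \<noteq> 0" "poly (map_poly of_int f) c = 0"
        using number_field_algebraic[OF assms(2)] by blast
      have "map_poly j (map_poly of_int f) = map_poly \<tau> (cpoly f)"
        by (rule poly_eqI) (simp add: coeff_map_poly hom_distribs)
      moreover have "poly (map_poly j (map_poly of_int f)) (j c) = 0" using f(2) by simp
      moreover have "cpoly f \<noteq> 0" using f(1) by (simp add: map_poly_eq_0_iff)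
      ultimately show ?thesis using root_in_range[OF \<tau>(1), of "cpoly f" "j c"] by auto
    qed
    then obtain \<kappa> where \<kappa>: "\<And>c. j c = \<tau> (\<kappa> c)" by metis
    have k: "field_hom \<kappa>"
    proof unfold_locales
      show "\<kappa> 0 = 0" using \<kappa>[of 0] by simp
      show "\<kappa> 1 = 1" using \<kappa>[of 1] by simp
      show "\<kappa> (x + y) = \<kappa> x + \<kappa> y" for x y
      proof -
        have "\<tau> (\<kappa> (x + y)) = \<tau> (\<kappa> x + \<kappa> y)" by (simp add: \<kappa>[symmetric] hom_distribs)
        thus ?thesis by simp
      qed
      show "\<kappa> (x * y) = \<kappa> x * \<kappa> y" for x y
      proof -
        have "\<tau> (\<kappa> (x * y)) = \<tau> (\<kappa> x * \<kappa> y)" by (simp add: \<kappa>[symmetric] hom_distribs)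
        thus ?thesis by simp
      qed
    qed
    interpret k: field_hom \<kappa> by fact
    interpret pk: map_poly_inj_idom_hom \<kappa> ..
    have gk: "map_poly j p = map_poly \<tau> (map_poly \<kappa> p)" for p
      by (rule poly_eqI) (simp add: coeff_map_poly \<kappa>)
    define YC where "YC = (\<lambda>n. {y. poly (map_poly \<kappa> (g n)) y = 0})"
    have YY: "Y n = \<tau> ` YC n" for n
    proof safe
      fix y assume "y \<in> Y n"
      hence "poly (map_poly \<tau> (map_poly \<kappa> (g n))) y = 0" by (simp add: Y_def gk)
      moreover have "map_poly \<kappa> (g n) \<noteq> 0" using g[of n] by (simp add: is_minpoly_def)
      ultimately obtain z where "y = \<tau> z" "poly (map_poly \<kappa> (g n)) z = 0"
        using root_in_range[OF \<tau>(1), of "map_poly \<kappa> (g n)" y] by blast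
      thus "y \<in> \<tau> ` YC n" by (auto simp: YC_def)
    qed (simp add: Y_def YC_def gk)
    have injt: "inj_on \<tau> A" for A by (rule inj_onI) simp
    obtain b' where b': "b' \<noteq> 0" "\<kappa> \<alpha> = b' + inverse b'" by (rule exists_plus_inverse)
    \<comment> \<open>The parameters \<open>b\<close> and \<open>b'\<close> come from separate
      quadratic equations, so they correspond only up to inversion; the absolute value of the
      logarithm does not see the difference.\<close>
    have tb: "b + inverse b = \<tau> b' + inverse (\<tau> b')"
      using b b' \<kappa>[of \<alpha>] by (simp add: hom_distribs)
    hence bb: "b = \<tau> b' \<or> b * \<tau> b' = 1" using plus_inverse_eq_iff[OF b0, of "\<tau> b'"] b' by simp
    hence bb': "b = \<tau> b' \<or> b = inverse (\<tau> b')" using inverse_unique[of "\<tau> b'" b] by (auto simp: mult.commute)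
    have nr': "b' ^ n \<noteq> 1" if "n > 0" for n
    proof
      assume "b' ^ n = 1"
      hence "\<tau> (b' ^ n) = 1" by simp
      hence "\<tau> b' ^ n = 1" by (simp add: hom_distribs)
      hence "b ^ n = 1" using bb' by (auto simp: power_inverse)
      thus False using nr that by blast
    qed
    have wb: "\<bar>ln (w b)\<bar> = s * \<bar>ln (norm b')\<bar>"
    proof -
      have "\<bar>ln (w b)\<bar> = \<bar>ln (w (\<tau> b'))\<bar>" using bb' b' by (auto simp: w.inverse ln_inverse)
      thus ?thesis using \<tau>(2)[of b'] b' s(1) by (simp add: ln_powr abs_mult)
    qed
    have summand: "1 / real (card (Y n)) * (\<Sum>y\<in>Y n. ln (w (y - j \<alpha>))) =
       s * (1 / real (degree (g n)) * (\<Sum>y | poly (map_poly \<kappa> (g n)) y = 0. ln (norm (y - \<kappa> \<alpha>))))" for n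
    proof -
      have "(\<Sum>y\<in>Y n. ln (w (y - j \<alpha>))) = (\<Sum>y\<in>YC n. ln (w (\<tau> y - \<tau> (\<kappa> \<alpha>))))"
        unfolding YY \<kappa> by (simp add: sum.reindex[OF injt])
      also have "\<dots> = (\<Sum>y\<in>YC n. s * ln (norm (y - \<kappa> \<alpha>)))"
      proof (rule sum.cong)
        fix y
        have "w (\<tau> y - \<tau> (\<kappa> \<alpha>)) = norm (y - \<kappa> \<alpha>) powr s" using \<tau>(2)[of "y - \<kappa> \<alpha>"] by (simp add: hom_distribs)
        thus "ln (w (\<tau> y - \<tau> (\<kappa> \<alpha>))) = s * ln (norm (y - \<kappa> \<alpha>))"
          by (cases "y = \<kappa> \<alpha>") (auto simp: ln_powr)
      qed simp
      finally show ?thesis by (simp add: cardY YC_def sum_distrib_left)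
    qed
    have "(\<lambda>n. s * (1 / real (degree (g n)) * (\<Sum>y | poly (map_poly \<kappa> (g n)) y = 0. ln (norm (y - \<kappa> \<alpha>))))) \<longlonglongrightarrow> s * \<bar>ln (norm b')\<bar>"
      by (intro tendsto_mult tendsto_const arch_case[OF assms(2) k assms(1,3,4) g b'(1) nr' b'(2)])
    thus ?thesis unfolding summand wb .
  qed
  \<comment> \<open>Evaluation at \<open>x n\<close> matches embeddings with roots of
    \<open>g n\<close>, and both the degree of the extension and the number of roots equal the
    degree of \<open>g n\<close>.\<close>
  moreover have "1 / real (ext_degree (adjoin (x n))) * (\<Sum>\<sigma>\<in>embeddings_over j (adjoin (x n)). ln (w (\<sigma> (x n) - j \<alpha>))) =
     1 / real (card (Y n)) * (\<Sum>y\<in>Y n. ln (w (y - j \<alpha>)))" for n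
    unfolding ext_degree_adjoin[OF g] cardY[symmetric]
    using sum.reindex_bij_betw[OF bij_betw_embeddings[OF g j], of "\<lambda>y. ln (w (y - j \<alpha>))" n] by (simp add: Y_def)
  ultimately show ?thesis unfolding j_def[symmetric] lh[unfolded j_def] lh[symmetric] 
    by (simp add: j_def)
qed

end
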